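(* Let $(G,\tau_G)$ be a weakly almost periodic group, let $G_d$ denote $G$ with the discrete topology, and let $\pi:G_d\to\mathcal B(\mathcal X)$ be a weakly almost periodic representation on a Banach space $\mathcal X$. Then the space of continuous vectors $$\mathcal X^\pi_{\tau_G}=\{\xi\in\mathcal X:\pi(\cdot)\xi\text{ is }\tau_G\text{-continuous on }G\}$$ is a $\pi(G)$-reducing subspace. In particular, $\mathcal W(G)$ is a complemented translation-invariant subspace of $\mathcal W(G_d)$.
   Context: For a topological group $H$, $\mathcal W(H)$ is the C*-algebra of bounded continuous complex functions $u$ on $H$ for which the weak closure of $\{u\cdot s:s\in H\}$, $(u\cdot s)(t)=u(st)$, is weakly compact in the space of bounded continuous functions (uniform norm). $(G,\tau_G)$ is weakly almost periodic if $\tau_G$ is Hausdorff and equals the initial topology $\sigma(G,\mathcal W(G))$. A (unital, weak operator continuous) representation $\pi:H\to\mathcal B(\mathcal X)$ is weakly almost periodic if the weak operator closure $\overline{\pi(H)}^{wo}$ is weak operator compact. $\mathrm{Aff}^{wo}_\pi$ is the weak operator closure of the convex hull of the range of $\pi$. A subspace $\mathcal Y$ of $\mathcal X$ is $\pi(G)$-reducing if there is an idempotent $M\in\mathrm{Aff}^{wo}_\pi$ with $\pi(s)M=M\pi(s)$ for all $s\in G$ and $\mathcal Y=M\mathcal X$. Continuity of $\pi(\cdot)\xi$ is with respect to the weak topology of $\mathcal X$. *)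

theory Defs
  imports "HOL-Analysis.Analysis" "HOL-Probability.Discrete_Topology"
begin

section \<open>Complex normed spaces\<close>

class complex_normed_vector = real_normed_vector +
  fixes scaleC :: "complex \<Rightarrow> 'a \<Rightarrow> 'a"  (infixr \<open>*\<^sub>C\<close> 75)
  assumes scaleC_add_right: "a *\<^sub>C (x + y) = a *\<^sub>C x + a *\<^sub>C y"
    and scaleC_add_left: "(a + b) *\<^sub>C x = a *\<^sub>C x + b *\<^sub>C x"
    and scaleC_scaleC: "a *\<^sub>C (b *\<^sub>C x) = (a * b) *\<^sub>C x"
    and scaleC_of_real: "complex_of_real r *\<^sub>C x = r *\<^sub>R x"
    and norm_scaleC: "norm (a *\<^sub>C x) = cmod a * norm x"

class complex_banach = complex_normed_vector + banach

instantiation complex :: complex_banach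
begin

definition scaleC_complex :: "complex \<Rightarrow> complex \<Rightarrow> complex" where
  "scaleC_complex a z = a * z"

instance
  by standard (auto simp: scaleC_complex_def algebra_simps norm_mult scaleR_conv_of_real)

end

text \<open>Bounded continuous complex functions form a complex normed space under the supremum norm.\<close>

instantiation bcontfun :: (topological_space, complex_normed_vector) complex_normed_vector
begin

context includes bcontfun.lifting begin

lift_definition scaleC_bcontfun :: "complex \<Rightarrow> ('a \<Rightarrow>\<^sub>C 'b) \<Rightarrow> 'a \<Rightarrow>\<^sub>C 'b" is
  "\<lambda>a f x. a *\<^sub>C f x"
proof -
  fix a :: complex and f :: "'a \<Rightarrow> 'b"
  assume f: "f \<in> bcontfun"
  have lin: "bounded_linear (\<lambda>y::'b. a *\<^sub>C y)"
  proof (rule bounded_linear_intro[where K = "cmod a"])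
    fix r :: real and y :: 'b
    show "a *\<^sub>C (r *\<^sub>R y) = r *\<^sub>R (a *\<^sub>C y)"
      by (metis mult.commute scaleC_of_real scaleC_scaleC)
  qed (simp_all add: scaleC_add_right norm_scaleC mult.commute)
  have "continuous_on UNIV (\<lambda>x. a *\<^sub>C f x)"
    using f by (auto simp: bcontfun_def intro: bounded_linear.continuous_on[OF lin])
  moreover have "bounded (range (\<lambda>x. a *\<^sub>C f x))"
    using f bounded_linear_image[OF _ lin, of "range f"] by (simp add: bcontfun_def image_image)
  ultimately show "(\<lambda>x. a *\<^sub>C f x) \<in> bcontfun"
    by (simp add: bcontfun_def)
qed

end

instance
proof
  fix a b :: complex and r :: real and f g :: "'a \<Rightarrow>\<^sub>C 'b"
  show "a *\<^sub>C (f + g) = a *\<^sub>C f + a *\<^sub>C g"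
    by (rule bcontfun_eqI) (simp add: scaleC_bcontfun.rep_eq scaleC_add_right)
  show "(a + b) *\<^sub>C f = a *\<^sub>C f + b *\<^sub>C f"
    by (rule bcontfun_eqI) (simp add: scaleC_bcontfun.rep_eq scaleC_add_left)
  show assoc: "c *\<^sub>C (d *\<^sub>C h) = (c * d) *\<^sub>C h" for c d and h :: "'a \<Rightarrow>\<^sub>C 'b"
    by (rule bcontfun_eqI) (simp add: scaleC_bcontfun.rep_eq scaleC_scaleC)
  show real: "complex_of_real s *\<^sub>C h = s *\<^sub>R h" for s and h :: "'a \<Rightarrow>\<^sub>C 'b"
    by (rule bcontfun_eqI) (simp add: scaleC_bcontfun.rep_eq scaleC_of_real)
  have le: "norm (c *\<^sub>C h) \<le> cmod c * norm h" for c and h :: "'a \<Rightarrow>\<^sub>C 'b"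
    by (rule norm_bound)
      (simp add: scaleC_bcontfun.rep_eq norm_scaleC mult_left_mono norm_bounded)
  show "norm (a *\<^sub>C f) = cmod a * norm f"
  proof (cases "a = 0")
    case True
    then show ?thesis using le[of 0 f] by simp
  next
    case False
    have "norm f = norm (inverse a *\<^sub>C (a *\<^sub>C f))"
      using False real[of 1 f] by (simp add: assoc)
    also have "\<dots> \<le> norm (a *\<^sub>C f) / cmod a"
      using le[of "inverse a" "a *\<^sub>C f"] by (simp add: norm_inverse divide_inverse mult.commute)
    finally have "cmod a * norm f \<le> norm (a *\<^sub>C f)"
      using False by (simp add: field_simps)
    with le[of a f] show ?thesis by simp
  qed
qed

end

definition bounded_clinear :: "('a::complex_normed_vector \<Rightarrow> 'b::complex_normed_vector) \<Rightarrow> bool" where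
  "bounded_clinear f \<longleftrightarrow> bounded_linear f \<and> (\<forall>a x. f (a *\<^sub>C x) = a *\<^sub>C f x)"

definition csubspace :: "'a::complex_normed_vector set \<Rightarrow> bool" where
  "csubspace S \<longleftrightarrow> 0 \<in> S \<and> (\<forall>x\<in>S. \<forall>y\<in>S. x + y \<in> S) \<and> (\<forall>a. \<forall>x\<in>S. a *\<^sub>C x \<in> S)"

text \<open>\<open>W\<close> is a closed subspace of \<open>V\<close> having a closed complement in \<open>V\<close>.\<close>

definition complemented_in ::
    "'a::complex_normed_vector set \<Rightarrow> 'a set \<Rightarrow> bool" where
  "complemented_in W V \<longleftrightarrow>
     csubspace W \<and> closed W \<and> W \<subseteq> V \<and>
     (\<exists>N. csubspace N \<and> closed N \<and> N \<subseteq> V \<and> W \<inter> N = {0} \<and> V = {w + n | w n. w \<in> W \<and> n \<in> N})"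


section \<open>Initial, weak and weak operator topologies\<close>

text \<open>\<open>UNIV\<close> is inserted so that the underlying set is the whole type even for an empty family.\<close>

definition initial_topology :: "('a \<Rightarrow> 'b::topological_space) set \<Rightarrow> 'a topology" where
  "initial_topology F = topology_generated_by (insert UNIV {f -` U | f U. f \<in> F \<and> open U})"

definition weak_topology :: "'a::complex_normed_vector topology" where
  "weak_topology = initial_topology {\<phi> :: 'a \<Rightarrow> complex. bounded_clinear \<phi>}"

text \<open>
  The library's type \<open>'x \<Rightarrow>\<^sub>L 'x\<close> consists of the bounded real-linear operators;
  \<open>bounded_operators\<close> is the algebra of the complex-linear ones, and it is the underlying set of
  \<open>wo_topology\<close>.
\<close>

definition bounded_operators :: "('x::complex_banach \<Rightarrow>\<^sub>L 'x) set" where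
  "bounded_operators = {T. bounded_clinear (blinfun_apply T)}"

definition wo_topology :: "('x::complex_banach \<Rightarrow>\<^sub>L 'x) topology" where
  "wo_topology =
     subtopology
       (initial_topology {\<lambda>T. \<phi> (blinfun_apply T \<xi>) | (\<phi> :: 'x \<Rightarrow> complex) \<xi>. bounded_clinear \<phi>})
       bounded_operators"


section \<open>Topological groups and weakly almost periodic functions\<close>

text \<open>
  Groups are types of class \<open>topological_group_add\<close>. The group operation is written \<open>+\<close>, but it is
  not assumed to be commutative, and the topology is not assumed to be Hausdorff.
  The type \<open>'g discrete\<close> is a copy of \<open>'g\<close> carrying the discrete topology; it becomes the group
  \<open>G\<^sub>d\<close> with the operations of \<open>'g\<close>.
\<close>

instance discrete :: (type) discrete_topology
  by standard (rule open_discrete)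

instantiation discrete :: (group_add) topological_group_add
begin

definition "0 = discrete 0"
definition "s + t = discrete (of_discrete s + of_discrete t)"
definition "- s = discrete (- of_discrete s)"
definition "s - t = discrete (of_discrete s - of_discrete t)"

instance
proof
  fix a b c :: "'a discrete"
  show "a + b + c = a + (b + c)"
    by (simp add: plus_discrete_def discrete_inverse add.assoc)
  show "0 + a = a" and "a + 0 = a"
    by (simp_all add: plus_discrete_def zero_discrete_def discrete_inverse of_discrete_inverse)
  show "- a + a = 0"
    by (simp add: plus_discrete_def zero_discrete_def uminus_discrete_def discrete_inverse)
  show "a + - b = a - b"
    by (simp add: plus_discrete_def uminus_discrete_def minus_discrete_def discrete_inverse)
  show "((\<lambda>x. fst x + snd x) \<longlongrightarrow> a + b) (nhds a \<times>\<^sub>F nhds b)"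
    by (simp add: nhds_discrete principal_prod_principal filterlim_principal eventually_principal)
  show "(uminus \<longlongrightarrow> - a) (nhds a)"
    by (simp add: nhds_discrete filterlim_principal eventually_principal)
qed

end

text \<open>
  \<open>right_translate u s\<close> is \<open>u \<cdot> s\<close> and \<open>left_translate s u\<close> is \<open>s \<cdot> u\<close>; the names refer to the side
  on which \<open>s\<close> acts on \<open>u\<close>, which is opposite to the side of the argument on which it is added.
\<close>

context includes bcontfun.lifting begin

lift_definition right_translate ::
    "('h::topological_group_add \<Rightarrow>\<^sub>C complex) \<Rightarrow> 'h \<Rightarrow> ('h \<Rightarrow>\<^sub>C complex)" is
  "\<lambda>u s t. u (s + t)"
proof -
  fix u :: "'h \<Rightarrow> complex" and s :: 'h
  assume "u \<in> bcontfun"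
  then have cont: "continuous_on UNIV u" and bdd: "bounded (range u)"
    by (simp_all add: bcontfun_def)
  have "continuous_on UNIV (\<lambda>t. u (s + t))"
    by (rule continuous_on_compose2[OF cont _ subset_UNIV]) (intro continuous_intros)
  moreover have "bounded (range (\<lambda>t. u (s + t)))"
    by (rule bounded_subset[OF bdd]) auto
  ultimately show "(\<lambda>t. u (s + t)) \<in> bcontfun"
    by (simp add: bcontfun_def)
qed

lift_definition left_translate ::
    "'h \<Rightarrow> ('h::topological_group_add \<Rightarrow>\<^sub>C complex) \<Rightarrow> ('h \<Rightarrow>\<^sub>C complex)" is
  "\<lambda>s u t. u (t + s)"
proof -
  fix u :: "'h \<Rightarrow> complex" and s :: 'h
  assume "u \<in> bcontfun"
  then have cont: "continuous_on UNIV u" and bdd: "bounded (range u)"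
    by (simp_all add: bcontfun_def)
  have "continuous_on UNIV (\<lambda>t. u (t + s))"
    by (rule continuous_on_compose2[OF cont _ subset_UNIV]) (intro continuous_intros)
  moreover have "bounded (range (\<lambda>t. u (t + s)))"
    by (rule bounded_subset[OF bdd]) auto
  ultimately show "(\<lambda>t. u (t + s)) \<in> bcontfun"
    by (simp add: bcontfun_def)
qed

text \<open>The inclusion of the bounded continuous functions on \<open>G\<close> into those on \<open>G\<^sub>d\<close>.\<close>

lift_definition on_discrete :: "('g::topological_space \<Rightarrow>\<^sub>C complex) \<Rightarrow> ('g discrete \<Rightarrow>\<^sub>C complex)" is
  "\<lambda>u s. u (of_discrete s)"
proof -
  fix u :: "'g \<Rightarrow> complex"
  assume "u \<in> bcontfun"
  then have cont: "continuous_on UNIV u" and bdd: "bounded (range u)"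
    by (simp_all add: bcontfun_def)
  have "continuous_on UNIV (\<lambda>s. u (of_discrete s))"
    by (simp add: continuous_on_open_vimage open_discrete)
  moreover have "bounded (range (\<lambda>s. u (of_discrete s)))"
    by (rule bounded_subset[OF bdd]) auto
  ultimately show "(\<lambda>s. u (of_discrete s)) \<in> bcontfun"
    by (simp add: bcontfun_def)
qed

end

definition wap_functions :: "('h::topological_group_add \<Rightarrow>\<^sub>C complex) set" where
  "wap_functions =
     {u. compactin weak_topology (weak_topology closure_of (range (right_translate u)))}"

definition wap_group :: "'g::topological_group_add itself \<Rightarrow> bool" where
  "wap_group (_ :: 'g itself) \<longleftrightarrow>
     Hausdorff_space (euclidean :: 'g topology) \<and>
     (euclidean :: 'g topology) =
       initial_topology (apply_bcontfun ` (wap_functions :: ('g \<Rightarrow>\<^sub>C complex) set))"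

definition translation_invariant :: "('h::topological_group_add \<Rightarrow>\<^sub>C complex) set \<Rightarrow> bool" where
  "translation_invariant W \<longleftrightarrow>
     (\<forall>u\<in>W. \<forall>s. right_translate u s \<in> W \<and> left_translate s u \<in> W)"


section \<open>Representations\<close>

definition representation ::
    "('h::topological_group_add \<Rightarrow> ('x::complex_banach \<Rightarrow>\<^sub>L 'x)) \<Rightarrow> bool" where
  "representation \<pi> \<longleftrightarrow>
     range \<pi> \<subseteq> bounded_operators \<and>
     \<pi> 0 = id_blinfun \<and>
     (\<forall>s t. \<pi> (s + t) = \<pi> s o\<^sub>L \<pi> t) \<and>
     continuous_map euclidean wo_topology \<pi>"

definition wap_representation ::
    "('h::topological_group_add \<Rightarrow> ('x::complex_banach \<Rightarrow>\<^sub>L 'x)) \<Rightarrow> bool" where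
  "wap_representation \<pi> \<longleftrightarrow>
     representation \<pi> \<and> compactin wo_topology (wo_topology closure_of (range \<pi>))"

definition Aff_wo :: "('h \<Rightarrow> ('x::complex_banach \<Rightarrow>\<^sub>L 'x)) \<Rightarrow> ('x \<Rightarrow>\<^sub>L 'x) set" where
  "Aff_wo \<pi> = wo_topology closure_of (convex hull (range \<pi>))"

definition reducing_subspace ::
    "('h \<Rightarrow> ('x::complex_banach \<Rightarrow>\<^sub>L 'x)) \<Rightarrow> 'x set \<Rightarrow> bool" where
  "reducing_subspace \<pi> Y \<longleftrightarrow>
     (\<exists>M \<in> Aff_wo \<pi>. M o\<^sub>L M = M \<and> (\<forall>s. \<pi> s o\<^sub>L M = M o\<^sub>L \<pi> s) \<and> Y = range (blinfun_apply M))"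

definition continuous_vectors ::
    "('g::topological_group_add discrete \<Rightarrow> ('x::complex_banach \<Rightarrow>\<^sub>L 'x)) \<Rightarrow> 'x set" where
  "continuous_vectors \<pi> =
     {\<xi>. continuous_map (euclidean :: 'g topology) weak_topology
           (\<lambda>s. blinfun_apply (\<pi> (discrete s)) \<xi>)}"

end

theory Submission
  imports Defs
begin

text \<open>
  Let \<open>\<rho>\<close> be the action of \<open>G\<close> given by the representation and let \<open>S\<close> be the closure of \<open>\<rho>(G)\<close>, a compact
  semigroup in which multiplication is separately continuous and in which the group \<open>\<rho>(G)\<close> is dense. The
  limits of \<open>\<rho> s\<close> as \<open>s \<rightarrow> 0\<close> in \<open>\<tau>\<^sub>G\<close> form a closed subsemigroup \<open>S0\<close>, invariant under conjugation, and by
  compactness a vector is continuous if and only if it is fixed by \<open>S0\<close>. So the task is to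
  average over \<open>S0\<close> by a projection that commutes with \<open>\<rho>(G)\<close>.

  A compact semigroup such as \<open>S0\<close> need not have a unique minimal idempotent, and different ones would give
  different projections. The dense group of invertible elements excludes this: if \<open>e\<close> and \<open>f\<close> are
  idempotents generating the same left ideal, then \<open>e = f\<close> (\<open>idempotents_left_ideal_eq\<close>). The reason
  is that a separately continuous function on a product of compact spaces is, on some nonempty open set of
  first arguments, almost constant uniformly in the second (\<open>fragmentation\<close>), and that translations by
  the group carry this set to the idempotent. It follows that \<open>S0\<close> has a least ideal \<open>L\<close> that is a
  group and is invariant under conjugation by \<open>\<rho>(G)\<close> (\<open>kernel_group\<close>).

  The same principle, applied to the dual ball, shows that the orbits of \<open>L\<close> are precompact in norm.
  Hence \<open>L\<close> has a mean \<open>M\<close>, the analogue of its Haar integral, and it is a limit of averages of elements of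
  \<open>L\<close> (\<open>mean_exists\<close>). These averages are taken over separated sets of maximal size; Hall's marriage
  theorem shows that they hardly change under translation. The fixed vectors of \<open>S0\<close> are the range of \<open>M\<close>,
  and \<open>M\<close> commutes with \<open>\<rho>(G)\<close> because \<open>L\<close> is invariant under conjugation (\<open>continuous_projection\<close>).

  The construction is carried out for a bounded action, on the space of vectors whose orbits are
  relatively weakly compact. For a weakly almost periodic representation this is the whole space. For
  the translation action on \<open>\<ell>\<^sup>\<infinity>(G)\<close> it is \<open>\<W>(G\<^sub>d)\<close>, the continuous vectors are the functions in \<open>\<W>(G)\<close>, and
  the kernel of \<open>M\<close> is a closed complement of \<open>\<W>(G)\<close>.
\<close>

section \<open>Sublinear functionals and the Hahn-Banach theorem\<close>

definition sublinear :: "('a::real_vector \<Rightarrow> real) \<Rightarrow> bool" where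
  "sublinear p \<longleftrightarrow> (\<forall>x y. p (x + y) \<le> p x + p y) \<and> (\<forall>c x. 0 \<le> c \<longrightarrow> p (c *\<^sub>R x) = c * p x)"

lemma sublinear_add: "sublinear p \<Longrightarrow> p (x + y) \<le> p x + p y"
  and sublinear_scale: "sublinear p \<Longrightarrow> 0 \<le> c \<Longrightarrow> p (c *\<^sub>R x) = c * p x"
  by (auto simp: sublinear_def)

lemma sublinear_zero: "sublinear p \<Longrightarrow> p 0 = 0"
  using sublinear_scale[of p 0 0] by simp

lemma sublinear_minus: "sublinear p \<Longrightarrow> - p (- x) \<le> p x"
  using sublinear_add[of p x "- x"] sublinear_zero[of p] by simp

text \<open>The shift of a sublinear functional in a direction lowers it unless it is additive in that
  direction; this is what makes minimal sublinear functionals linear.\<close>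

definition shift :: "('a::real_vector \<Rightarrow> real) \<Rightarrow> 'a \<Rightarrow> 'a \<Rightarrow> real" where
  "shift p x y = (INF t\<in>{0..}. p (y + t *\<^sub>R x) - t * p x)"

lemma shift_bdd:
  assumes "sublinear p"
  shows "bdd_below ((\<lambda>t. p (y + t *\<^sub>R x) - t * p x) ` {0..})"
proof (rule bdd_belowI2[where m = "- p (- y)"])
  fix t :: real assume t: "t \<in> {0..}"
  have "t * p x = p ((y + t *\<^sub>R x) + (- y))"
    using t assms by (simp add: sublinear_scale)
  also have "\<dots> \<le> p (y + t *\<^sub>R x) + p (- y)" by (rule sublinear_add[OF assms])
  finally show "- p (- y) \<le> p (y + t *\<^sub>R x) - t * p x" by simp
qed

lemma shift_le:
  assumes "sublinear p" "0 \<le> t"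
  shows "shift p x y \<le> p (y + t *\<^sub>R x) - t * p x"
  unfolding shift_def using shift_bdd[OF assms(1)] assms(2) by (intro cINF_lower) auto

lemma shift_le_self: "sublinear p \<Longrightarrow> shift p x y \<le> p y"
  using shift_le[of p 0 x y] by simp

lemma shift_greatest:
  "(\<And>t. 0 \<le> t \<Longrightarrow> m \<le> p (y + t *\<^sub>R x) - t * p x) \<Longrightarrow> m \<le> shift p x y"
  unfolding shift_def by (rule cINF_greatest) auto

lemma sublinear_shift:
  assumes p: "sublinear p"
  shows "sublinear (shift p x)"
  unfolding sublinear_def
proof (intro conjI allI impI)
  fix y z
  have "shift p x (y + z) \<le> (p (y + s *\<^sub>R x) - s * p x) + (p (z + t *\<^sub>R x) - t * p x)"
    if "0 \<le> s" "0 \<le> t" for s t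
  proof -
    have "shift p x (y + z) \<le> p ((y + s *\<^sub>R x) + (z + t *\<^sub>R x)) - (s + t) * p x"
      using shift_le[OF p, of "s + t" x "y + z"] that by (simp add: scaleR_add_left add_ac)
    also have "\<dots> \<le> p (y + s *\<^sub>R x) + p (z + t *\<^sub>R x) - (s + t) * p x"
      using sublinear_add[OF p] by simp
    finally show ?thesis by (simp add: algebra_simps)
  qed
  then have "shift p x (y + z) - (p (y + s *\<^sub>R x) - s * p x) \<le> shift p x z" if "0 \<le> s" for s
    using that by (intro shift_greatest) (metis add.commute diff_le_eq)
  then have "shift p x (y + z) - shift p x z \<le> shift p x y"
    by (intro shift_greatest) (metis add.commute diff_le_eq)
  then show "shift p x (y + z) \<le> shift p x y + shift p x z" by simp
next
  fix c :: real and y assume c: "0 \<le> c"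
  have le: "a * shift p x z \<le> shift p x (a *\<^sub>R z)" if a: "0 < a" for a z
  proof (rule shift_greatest)
    fix t :: real assume t: "0 \<le> t"
    have "a * shift p x z \<le> a * (p (z + (t / a) *\<^sub>R x) - t / a * p x)"
      using shift_le[OF p, of "t / a" x z] a t by simp
    also have "\<dots> = p (a *\<^sub>R (z + (t / a) *\<^sub>R x)) - t * p x"
      using a by (simp add: sublinear_scale[OF p] right_diff_distrib)
    finally show "a * shift p x z \<le> p (a *\<^sub>R z + t *\<^sub>R x) - t * p x"
      using a by (simp add: scaleR_add_right)
  qed
  show "shift p x (c *\<^sub>R y) = c * shift p x y"
  proof (cases "c = 0")
    case True
    have "0 \<le> shift p x 0"
      using p by (intro shift_greatest) (simp add: sublinear_scale)
    then show ?thesis using True shift_le_self[OF p, of x 0] sublinear_zero[OF p] by simp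
  next
    case False
    then have "0 < c" using c by simp
    then have "inverse c * shift p x (c *\<^sub>R y) \<le> shift p x (inverse c *\<^sub>R (c *\<^sub>R y))"
      by (intro le) simp
    with \<open>0 < c\<close> have "shift p x (c *\<^sub>R y) \<le> c * shift p x y"
      by (simp add: field_simps)
    then show ?thesis using le[OF \<open>0 < c\<close>, of y] by simp
  qed
qed

text \<open>The pointwise infimum of a chain of sublinear functionals below \<open>p\<close> is finite, because each
  member is at least \<open>- p (- x)\<close> at \<open>x\<close>; it is again sublinear, so Zorn's lemma applies.\<close>

lemma minimal_sublinear_below:
  assumes p: "sublinear p"
  obtains q where "sublinear q" "q \<le> p" "\<And>r. sublinear r \<Longrightarrow> r \<le> q \<Longrightarrow> r = q"
proof -
  define A where "A = {q. sublinear q \<and> q \<le> p}"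
  have "\<exists>m\<in>A. \<forall>a\<in>A. m \<ge> a \<longrightarrow> a = m"
  proof (rule predicate_Zorn)
    show "partial_order_on A (relation_of (\<ge>) A)"
      by (intro partial_order_on_relation_ofI) auto
  next
    fix C assume C: "C \<in> Chains (relation_of (\<ge>) A)"
    have CA: "C \<subseteq> A" and ch: "\<And>q r. q \<in> C \<Longrightarrow> r \<in> C \<Longrightarrow> q \<le> r \<or> r \<le> q"
      using C by (auto simp: Chains_def relation_of_def)
    show "\<exists>u\<in>A. \<forall>a\<in>C. a \<ge> u"
    proof (cases "C = {}")
      case True
      then show ?thesis using p by (auto simp: A_def)
    next
      case False
      define u where "u = (\<lambda>x. INF q\<in>C. q x)"
      have bdd: "bdd_below ((\<lambda>q. q x) ` C)" for x
      proof (rule bdd_belowI2[where m = "- p (- x)"])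
        fix q assume "q \<in> C"
        then have "sublinear q" "q \<le> p" using CA by (auto simp: A_def)
        then show "- p (- x) \<le> q x"
          using sublinear_minus[of q "x"] le_funD[of q p "- x"] sublinear_minus[of q "- x"] by simp
      qed
      have low: "u x \<le> q x" if "q \<in> C" for q x
        unfolding u_def using bdd that by (intro cINF_lower) auto
      have gr: "m \<le> u x" if "\<And>q. q \<in> C \<Longrightarrow> m \<le> q x" for m x
        unfolding u_def using False that by (intro cINF_greatest) auto
      have sl: "sublinear q" if "q \<in> C" for q using that CA by (auto simp: A_def)
      have "u (x + y) \<le> u x + u y" for x y
      proof -
        have 1: "u (x + y) \<le> q x + r y" if "q \<in> C" "r \<in> C" for q r
        proof -
          from ch[OF that] show ?thesis
          proof
            assume 1: "q \<le> r"
            then show ?thesis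
              using low[OF that(1), of "x + y"] sublinear_add[OF sl[OF that(1)], of x y] le_funD[OF 1, of y]
              by linarith
          next
            assume 2: "r \<le> q"
            then show ?thesis
              using low[OF that(2), of "x + y"] sublinear_add[OF sl[OF that(2)], of x y] le_funD[OF 2, of x]
              by linarith
          qed
        qed
        have "u (x + y) - q x \<le> u y" if "q \<in> C" for q
          using 1[OF that] by (intro gr) (metis add.commute diff_le_eq)
        then have "u (x + y) - u y \<le> u x" by (intro gr) (metis add.commute diff_le_eq)
        then show ?thesis by simp
      qed
      moreover have "u (c *\<^sub>R x) = c * u x" if c: "0 \<le> c" for c x
      proof (cases "c = 0")
        case True
        have "0 \<le> u 0" by (intro gr) (simp add: sublinear_zero sl)
        moreover from False obtain q where q: "q \<in> C" by auto
        ultimately show ?thesis using True low[OF q, of 0] sublinear_zero[OF sl[OF q]] by simp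
      next
        case False
        then have c0: "0 < c" using c by simp
        have "c * u x \<le> u (c *\<^sub>R x)"
          using c0 low by (intro gr) (simp add: sublinear_scale[OF sl])
        moreover have "u (c *\<^sub>R x) / c \<le> u x"
          using c0 low[of _ "c *\<^sub>R x"] by (intro gr) (simp add: sublinear_scale[OF sl] field_simps)
        ultimately show ?thesis using c0 by (simp add: field_simps)
      qed
      moreover have "u \<le> p"
      proof -
        from False obtain q where q: "q \<in> C" by auto
        then show ?thesis using low[OF q] CA unfolding A_def le_fun_def by (blast intro: order_trans)
      qed
      ultimately have "u \<in> A" by (auto simp: A_def sublinear_def)
      then show ?thesis using low by (auto simp: le_fun_def)
    qed
  qed
  then obtain m where m: "m \<in> A" "\<And>a. a \<in> A \<Longrightarrow> a \<le> m \<Longrightarrow> a = m" by auto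
  show thesis
  proof (rule that[of m])
    show "r = m" if "sublinear r" "r \<le> m" for r
      using m that by (auto simp: A_def)
  qed (use m in \<open>auto simp: A_def\<close>)
qed

text \<open>A minimal sublinear functional \<open>q\<close> coincides with all its shifts, and \<open>shift q x y \<le> q (y + x) - q x\<close>
  then says that \<open>q\<close> is superadditive. Starting from a shift of \<open>p\<close> in the direction \<open>a\<close> makes
  the functional agree with \<open>p\<close> at \<open>a\<close>.\<close>

theorem Hahn_Banach_sublinear:
  assumes p: "sublinear p"
  obtains f where "linear f" "\<And>x. f x \<le> p x" "f a = p a"
proof -
  obtain q where q: "sublinear q" "q \<le> shift p a" "\<And>r. sublinear r \<Longrightarrow> r \<le> q \<Longrightarrow> r = q"
    using minimal_sublinear_below[OF sublinear_shift[OF p]] by metis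
  have add: "q (y + x) = q y + q x" for x y
  proof -
    have "shift q x = q"
      using q(3)[OF sublinear_shift[OF q(1)]] shift_le_self[OF q(1)] by (auto simp: le_fun_def)
    then have "q y \<le> q (y + x) - q x"
      using shift_le[OF q(1), of 1 x y] by simp
    then show ?thesis using sublinear_add[OF q(1), of y x] by simp
  qed
  have neg: "q (- x) = - q x" for x
    using add[of x "- x"] sublinear_zero[OF q(1)] by simp
  have scale: "q (c *\<^sub>R x) = c * q x" for c x
  proof (cases "0 \<le> c")
    case True
    then show ?thesis by (rule sublinear_scale[OF q(1)])
  next
    case False
    then show ?thesis using neg[of "(- c) *\<^sub>R x"] sublinear_scale[OF q(1), of "- c" x] by simp
  qed
  have lin: "linear q" by (rule linearI) (simp_all add: add scale)
  have qp: "q x \<le> p x" for x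
    using q(2) shift_le_self[OF p, of a x] by (auto simp: le_fun_def intro: order_trans)
  have "q (- a) \<le> - p a"
    using le_funD[OF q(2), of "- a"] shift_le[OF p, of 1 a "- a"] sublinear_zero[OF p] by simp
  then have "q a = p a" using neg[of a] qp[of a] by simp
  then show thesis using that[OF lin qp] by simp
qed

text \<open>A linear functional is odd, so a one-sided bound is two-sided.\<close>

lemma bounded_linear_norm_le:
  assumes "linear f" "\<And>x. f x \<le> C * norm x"
  shows "bounded_linear f" "\<And>x. \<bar>f x\<bar> \<le> C * norm (x::'a::real_normed_vector)"
proof -
  show *: "\<bar>f x\<bar> \<le> C * norm x" for x
    using assms(2)[of x] assms(2)[of "- x"] linear_neg[OF assms(1), of x] by (simp add: abs_le_iff)
  show "bounded_linear f"
  proof (rule bounded_linear_intro[where K = C])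
    show "norm (f x) \<le> norm x * C" for x using *[of x] by (simp add: mult.commute)
  qed (simp_all add: linear_add[OF assms(1)] linear_scale[OF assms(1)])
qed

lemma norming_functional:
  fixes a :: "'a::real_normed_vector"
  obtains f where "bounded_linear f" "\<And>x. \<bar>f x\<bar> \<le> norm x" "f a = norm a"
proof -
  have "sublinear (norm :: 'a \<Rightarrow> real)" by (auto simp: sublinear_def norm_triangle_ineq)
  then obtain f where f: "linear f" "\<And>x. f x \<le> norm x" "f a = norm a"
    by (rule Hahn_Banach_sublinear[of norm a]) blast
  show thesis
    by (rule that[of f]) (use bounded_linear_norm_le[of f 1] f in auto)
qed

text \<open>A linear \<open>g\<close> below the sublinear functional \<open>y \<mapsto> inf {f x + C \<parallel>y - j x\<parallel>}\<close> satisfies \<open>g (j x) \<le> f x\<close>,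
  and equality follows by replacing \<open>x\<close> by \<open>- x\<close>. With \<open>j\<close> the identity this extends a functional that is
  defined on a subspace only; with \<open>j\<close> an embedding of function spaces it shows that the weak topology
  of the smaller space is induced by that of the larger one. At a prescribed point \<open>a\<close> the infimum is
  attained as the value of \<open>g\<close>.\<close>

lemma functional_extends_along_isometry:
  fixes j :: "'a::real_normed_vector \<Rightarrow> 'b::real_normed_vector" and f :: "'a \<Rightarrow> real"
  assumes V: "subspace V"
    and j: "\<And>x y. x \<in> V \<Longrightarrow> y \<in> V \<Longrightarrow> j (x + y) = j x + j y" "\<And>c x. x \<in> V \<Longrightarrow> j (c *\<^sub>R x) = c *\<^sub>R j x"
      "\<And>x. x \<in> V \<Longrightarrow> norm (j x) = norm x"
    and f: "\<And>x y. x \<in> V \<Longrightarrow> y \<in> V \<Longrightarrow> f (x + y) = f x + f y" "\<And>c x. x \<in> V \<Longrightarrow> f (c *\<^sub>R x) = c * f x"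
    and C: "0 \<le> C" "\<And>x. x \<in> V \<Longrightarrow> \<bar>f x\<bar> \<le> C * norm x"
  obtains g where "bounded_linear g" "\<And>x. x \<in> V \<Longrightarrow> g (j x) = f x"
    "g a = (INF x\<in>V. f x + C * norm (a - j x))"
proof -
  define p where "p y = (INF x\<in>V. f x + C * norm (y - j x))" for y
  have V0: "0 \<in> V" "V \<noteq> {}" using V subspace_0 by auto
  have j0: "j 0 = 0" and f0: "f 0 = 0" using j(2)[OF V0(1), of 0] f(2)[OF V0(1), of 0] by simp_all
  have low: "- (C * norm y) \<le> f x + C * norm (y - j x)" if "x \<in> V" for x y
  proof -
    have "C * norm x \<le> C * (norm y + norm (y - j x))"
      using norm_triangle_sub[of "j x" y] C(1) that
      by (intro mult_left_mono) (simp_all add: j(3) norm_minus_commute)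
    then show ?thesis using C(2)[OF that] by (simp add: algebra_simps abs_le_iff)
  qed
  have le: "p y \<le> f x + C * norm (y - j x)" if "x \<in> V" for x y
    unfolding p_def using low that by (intro cINF_lower bdd_belowI2) auto
  have gr: "m \<le> p y" if "\<And>x. x \<in> V \<Longrightarrow> m \<le> f x + C * norm (y - j x)" for m y
    unfolding p_def by (rule cINF_greatest[OF V0(2)]) (rule that)
  have sc: "c * p y \<le> p (c *\<^sub>R y)" if c: "0 < c" for c y
  proof (rule gr)
    fix x assume x: "x \<in> V"
    have "c * p y \<le> c * (f (inverse c *\<^sub>R x) + C * norm (y - j (inverse c *\<^sub>R x)))"
      using c x le V by (simp add: subspace_scale)
    also have "\<dots> = f x + C * norm (c *\<^sub>R (y - j (inverse c *\<^sub>R x)))"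
      using c x by (simp add: f(2) distrib_left)
    finally show "c * p y \<le> f x + C * norm (c *\<^sub>R y - j x)"
      using c x by (simp add: j(2) scaleR_diff_right)
  qed
  have "sublinear p"
    unfolding sublinear_def
  proof (intro conjI allI impI)
    fix y z
    have 1: "p (y + z) \<le> (f x + C * norm (y - j x)) + (f x' + C * norm (z - j x'))"
      if "x \<in> V" "x' \<in> V" for x x'
    proof -
      have "p (y + z) \<le> f (x + x') + C * norm ((y - j x) + (z - j x'))"
        using le[of "x + x'" "y + z"] that V by (simp add: subspace_add j(1) algebra_simps)
      also have "\<dots> \<le> f (x + x') + C * (norm (y - j x) + norm (z - j x'))"
        using C(1) norm_triangle_ineq by (intro add_left_mono mult_left_mono)
      finally show ?thesis using that by (simp add: f(1) algebra_simps)
    qed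
    have "p (y + z) - (f x + C * norm (y - j x)) \<le> p z" if "x \<in> V" for x
      using 1[OF that] by (intro gr) (metis add.commute diff_le_eq)
    then have "p (y + z) - p z \<le> p y" by (intro gr) (metis add.commute diff_le_eq)
    then show "p (y + z) \<le> p y + p z" by simp
  next
    fix c :: real and y assume c: "0 \<le> c"
    show "p (c *\<^sub>R y) = c * p y"
    proof (cases "c = 0")
      case True
      have "p 0 \<le> 0" using le[OF V0(1), of 0] by (simp add: j0 f0)
      moreover have "0 \<le> p 0" by (rule gr) (use low[of _ 0] in simp)
      ultimately show ?thesis using True by simp
    next
      case False
      then have "0 < c" using c by simp
      then show ?thesis using sc[of c y] sc[of "inverse c" "c *\<^sub>R y"] by (simp add: field_simps)
    qed
  qed
  then obtain g where g: "linear g" "\<And>x. g x \<le> p x" "g a = p a"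
    by (rule Hahn_Banach_sublinear[of p a]) blast
  have "g y \<le> C * norm y" for y
    using g(2)[of y] le[OF V0(1), of y] by (simp add: j0 f0)
  note bl = bounded_linear_norm_le(1)[OF g(1) this]
  have "g (j x) = f x" if x: "x \<in> V" for x
  proof -
    have *: "g (j z) \<le> f z" if "z \<in> V" for z using g(2)[of "j z"] le[OF that, of "j z"] by simp
    have "j (- x) = - j x" "f (- x) = - f x" using j(2)[OF x, of "-1"] f(2)[OF x, of "-1"] by simp_all
    then show ?thesis
      using *[OF x] *[of "- x"] x V by (simp add: subspace_neg linear_neg[OF g(1)])
  qed
  then show thesis using that bl g(3) by (simp add: p_def)
qed

text \<open>For the zero functional on \<open>Y\<close> the infimum above is the distance to \<open>Y\<close>.\<close>

lemma closed_subspace_separation: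
  fixes Y :: "'a::real_normed_vector set"
  assumes Y: "subspace Y" "closed Y" and a: "a \<notin> Y"
  obtains f where "bounded_linear f" "\<And>y. y \<in> Y \<Longrightarrow> f y = 0" "f a \<noteq> (0::real)"
proof -
  obtain g where g: "bounded_linear g" "\<And>y. y \<in> Y \<Longrightarrow> g y = 0" "g a = (INF y\<in>Y. 0 + 1 * norm (a - y))"
    by (rule functional_extends_along_isometry[OF Y(1), of "\<lambda>y. y" "\<lambda>_. 0" 1 a]) auto
  have "Y \<noteq> {}" using Y(1) subspace_0 by auto
  then have "g a = infdist a Y" using g(3) by (simp add: infdist_notempty dist_norm)
  then have "g a \<noteq> 0" using in_closed_iff_infdist_zero[OF Y(2) \<open>Y \<noteq> {}\<close>] a by simp
  then show thesis using that g(1,2) by blast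
qed

section \<open>Real functionals and the weak topology\<close>

lemma bounded_linear_scaleC: "bounded_linear (\<lambda>x::'a::complex_normed_vector. a *\<^sub>C x)"
proof (rule bounded_linear_intro[where K = "cmod a"])
  show "a *\<^sub>C (r *\<^sub>R x) = r *\<^sub>R (a *\<^sub>C x)" for r and x :: 'a
    by (metis mult.commute scaleC_of_real scaleC_scaleC)
qed (simp_all add: scaleC_add_right norm_scaleC mult.commute)

text \<open>The functional is \<open>\<psi> x - \<i> \<psi> (\<i> x)\<close>. Because of it the weak topology, defined by complex functionals,
  can be handled with real ones only.\<close>

lemma real_part_of_functional:
  fixes f :: "'a::complex_normed_vector \<Rightarrow> real"
  assumes f: "bounded_linear f"
  obtains \<phi> where "bounded_clinear \<phi>" "\<And>x. f x = Re (\<phi> x)"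
proof -
  interpret f: bounded_linear f by fact
  define \<phi> where "\<phi> x = complex_of_real (f x) - \<i> * complex_of_real (f (\<i> *\<^sub>C x))" for x
  have "bounded_linear (\<lambda>x. complex_of_real (f x) - \<i> * complex_of_real (f (\<i> *\<^sub>C x)))"
    by (intro bounded_linear_sub bounded_linear_const_mult bounded_linear_compose[OF bounded_linear_of_real]
        f bounded_linear_compose[OF f bounded_linear_scaleC])
  then have bl: "bounded_linear \<phi>" unfolding \<phi>_def .
  then interpret \<phi>: bounded_linear \<phi> .
  have "\<i> *\<^sub>C \<i> *\<^sub>C x = - x" for x :: 'a
    using scaleC_of_real[of "-1" x] by (simp add: scaleC_scaleC)
  then have i: "\<phi> (\<i> *\<^sub>C x) = \<i> * \<phi> x" for x
    by (simp add: \<phi>_def f.neg algebra_simps)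
  have "\<phi> (a *\<^sub>C x) = a * \<phi> x" for a x
  proof -
    have "a *\<^sub>C x = Re a *\<^sub>R x + Im a *\<^sub>R (\<i> *\<^sub>C x)"
    proof -
      have "a *\<^sub>C x = (complex_of_real (Re a) + complex_of_real (Im a) * \<i>) *\<^sub>C x"
        using complex_eq[of a] by (simp add: mult.commute)
      then show ?thesis
        unfolding scaleC_add_left scaleC_scaleC[symmetric] scaleC_of_real .
    qed
    then have "\<phi> (a *\<^sub>C x) = Re a *\<^sub>R \<phi> x + Im a *\<^sub>R (\<i> * \<phi> x)"
      by (simp add: \<phi>.add \<phi>.scaleR i)
    also have "\<dots> = (Re a + \<i> * Im a) * \<phi> x"
      by (simp add: scaleR_conv_of_real algebra_simps)
    finally show ?thesis using complex_eq[of a] by simp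
  qed
  then have "bounded_clinear \<phi>" using bl by (simp add: bounded_clinear_def scaleC_complex_def)
  moreover have "f x = Re (\<phi> x)" for x by (simp add: \<phi>_def)
  ultimately show thesis using that by blast
qed

lemma topspace_weak [simp]: "topspace weak_topology = UNIV"
  by (auto simp: weak_topology_def initial_topology_def)

lemma continuous_map_initial_topology:
  assumes "f \<in> F"
  shows "continuous_map (initial_topology F) euclidean f"
proof -
  have "openin (initial_topology F) (f -` U)" if "open U" for U
    unfolding initial_topology_def by (rule topology_generated_by_Basis) (use assms that in blast)
  moreover have "topspace (initial_topology F) = UNIV"
    by (auto simp: initial_topology_def)
  ultimately show ?thesis by (auto simp: continuous_map vimage_def)
qed

lemma continuous_map_into_initial_topology:
  assumes "\<And>\<phi>. \<phi> \<in> F \<Longrightarrow> continuous_map X euclidean (\<lambda>t. \<phi> (f t))"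
  shows "continuous_map X (initial_topology F) f"
  unfolding initial_topology_def
proof (rule continuous_on_generated_topo)
  fix U assume "U \<in> insert UNIV {f -` U | f U. f \<in> F \<and> open U}"
  then consider "U = UNIV" | \<phi> V where "\<phi> \<in> F" "open V" "U = \<phi> -` V" by blast
  then show "openin X (f -` U \<inter> topspace X)"
  proof cases
    case 2
    have "openin X {t \<in> topspace X. \<phi> (f t) \<in> V}"
      using assms[OF 2(1)] 2(2) by (auto intro: openin_continuous_map_preimage)
    moreover have "{t \<in> topspace X. \<phi> (f t) \<in> V} = f -` U \<inter> topspace X"
      using 2 by auto
    ultimately show ?thesis by simp
  qed auto
qed auto

lemma continuous_map_euclidean_compose:
  "continuous_map X euclidean f \<Longrightarrow> continuous_on UNIV g \<Longrightarrow> continuous_map X euclidean (\<lambda>t. g (f t))"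
  using continuous_map_compose[of X euclidean f euclidean g] by (simp add: o_def)

lemma continuous_map_weak_functional:
  fixes f :: "'a::complex_normed_vector \<Rightarrow> real"
  assumes "bounded_linear f"
  shows "continuous_map weak_topology euclideanreal f"
proof -
  obtain \<phi> where \<phi>: "bounded_clinear \<phi>" "\<And>x. f x = Re (\<phi> x)"
    using real_part_of_functional[OF assms] by metis
  have "continuous_map weak_topology euclidean \<phi>"
    unfolding weak_topology_def using \<phi> by (intro continuous_map_initial_topology) simp
  then have "continuous_map weak_topology euclideanreal (\<lambda>x. Re (\<phi> x))"
    by (rule continuous_map_euclidean_compose) (intro continuous_intros)
  moreover have "f = (\<lambda>x. Re (\<phi> x))" using \<phi>(2) by auto
  ultimately show ?thesis by simp
qed

lemma continuous_map_complex:
  assumes "continuous_map X euclideanreal (\<lambda>t. Re (f t))" "continuous_map X euclideanreal (\<lambda>t. Im (f t))"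
  shows "continuous_map X euclidean f"
proof -
  have "continuous_map X (prod_topology euclideanreal euclideanreal) (\<lambda>t. (Re (f t), Im (f t)))"
    using assms by (rule continuous_map_pairedI)
  then have "continuous_map X euclidean (\<lambda>t. (Re (f t), Im (f t)))" by simp
  moreover have "continuous_on UNIV (\<lambda>p. Complex (fst p) (snd p))"
    by (intro continuous_on_Complex continuous_on_fst continuous_on_snd continuous_on_id)
  ultimately show ?thesis
    using continuous_map_euclidean_compose[of X "\<lambda>t. (Re (f t), Im (f t))" "\<lambda>p. Complex (fst p) (snd p)"]
    by simp
qed

lemma bounded_clinear_Re_Im:
  assumes "bounded_clinear \<phi>"
  shows "bounded_linear (\<lambda>x. Re (\<phi> x))" "bounded_linear (\<lambda>x. Im (\<phi> x))"
  using assms bounded_linear_compose[OF bounded_linear_Re, of \<phi>]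
    bounded_linear_compose[OF bounded_linear_Im, of \<phi>]
  by (auto simp: bounded_clinear_def)

lemma continuous_map_into_weak:
  assumes "\<And>\<psi>::'a::complex_normed_vector \<Rightarrow> real. bounded_linear \<psi> \<Longrightarrow> continuous_map X euclideanreal (\<lambda>t. \<psi> (f t))"
  shows "continuous_map X weak_topology f"
  unfolding weak_topology_def
  by (rule continuous_map_into_initial_topology)
     (auto intro!: continuous_map_complex assms bounded_clinear_Re_Im)

lemma continuous_map_weak_compose:
  assumes "continuous_map X weak_topology f" "bounded_linear \<psi>"
  shows "continuous_map X euclideanreal (\<lambda>t. \<psi> (f t))"
  using continuous_map_compose[OF assms(1) continuous_map_weak_functional[OF assms(2)]] by (simp add: o_def)

lemma bounded_linear_weakly_continuous:
  assumes "bounded_linear T"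
  shows "continuous_map weak_topology weak_topology T"
  by (intro continuous_map_into_weak continuous_map_weak_functional bounded_linear_compose[OF _ assms])

lemma closedin_Collect_le:
  assumes "continuous_map X euclideanreal f" "continuous_map X euclideanreal g"
  shows "closedin X {x \<in> topspace X. f x \<le> g x}"
proof -
  have "continuous_map X euclideanreal (\<lambda>x. f x - g x)"
    using assms by (intro continuous_intros)
  then have "closedin X {x \<in> topspace X. f x - g x \<in> {..0}}"
    by (rule closedin_continuous_map_preimage) simp
  then show ?thesis by simp
qed

lemma closedin_Collect_eq:
  assumes "continuous_map X euclideanreal f" "continuous_map X euclideanreal g"
  shows "closedin X {x \<in> topspace X. f x = g x}"
proof -
  have "closedin X ({x \<in> topspace X. f x \<le> g x} \<inter> {x \<in> topspace X. g x \<le> f x})"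
    using assms by (intro closedin_Int closedin_Collect_le)
  moreover have "{x \<in> topspace X. f x \<le> g x} \<inter> {x \<in> topspace X. g x \<le> f x} = {x \<in> topspace X. f x = g x}"
    by auto
  ultimately show ?thesis by simp
qed

lemma openin_Collect_less:
  assumes "continuous_map X euclideanreal f" "continuous_map X euclideanreal g"
  shows "openin X {x \<in> topspace X. f x < g x}"
proof -
  have "continuous_map X euclideanreal (\<lambda>x. f x - g x)"
    using assms by (intro continuous_intros)
  then have "openin X {x \<in> topspace X. f x - g x \<in> {..<0}}"
    by (rule openin_continuous_map_preimage) simp
  then show ?thesis by simp
qed

lemma functionals_separate:
  fixes x y :: "'a::real_normed_vector"
  assumes "\<And>f::'a \<Rightarrow> real. bounded_linear f \<Longrightarrow> f x = f y"
  shows "x = y"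
proof -
  obtain f where f: "bounded_linear f" "f (x - y) = norm (x - y)"
    by (rule norming_functional[of "x - y"]) blast
  have "f (x - y) = 0" using assms[OF f(1)] f(1) by (simp add: bounded_linear.linear linear_diff)
  then show ?thesis using f(2) by simp
qed

lemma Hausdorff_weak: "Hausdorff_space (weak_topology :: 'a::complex_normed_vector topology)"
  unfolding Hausdorff_space_def
proof (intro allI impI, elim conjE)
  fix x y :: 'a assume "x \<noteq> y"
  then obtain f :: "'a \<Rightarrow> real" where f: "bounded_linear f" "f x \<noteq> f y"
    using functionals_separate by metis
  have *: "\<exists>U V. openin weak_topology U \<and> openin weak_topology V \<and> a \<in> U \<and> b \<in> V \<and> disjnt U V"
    if "f a < f b" for a b
  proof (intro exI conjI)
    show "openin weak_topology {z \<in> topspace weak_topology. f z < (f a + f b) / 2}"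
      "openin weak_topology {z \<in> topspace weak_topology. (f a + f b) / 2 < f z}"
      by (intro openin_Collect_less continuous_map_weak_functional f continuous_intros; simp)+
  qed (use that in \<open>auto simp: disjnt_def\<close>)
  show "\<exists>U V. openin weak_topology U \<and> openin weak_topology V \<and> x \<in> U \<and> y \<in> V \<and> disjnt U V"
  proof (cases "f x < f y")
    case True
    then show ?thesis by (rule *)
  next
    case False
    then obtain U V where "openin weak_topology U" "openin weak_topology V" "y \<in> U" "x \<in> V" "disjnt U V"
      using *[of y x] f(2) by auto
    then show ?thesis by (intro exI[of _ V] exI[of _ U]) (simp add: disjnt_sym)
  qed
qed

text \<open>The ball is an intersection of half-spaces of norming functionals.\<close>

lemma closedin_weak_cball: "closedin weak_topology (cball (0::'a::complex_normed_vector) r)"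
proof -
  let ?F = "{f::'a \<Rightarrow> real. bounded_linear f \<and> (\<forall>x. \<bar>f x\<bar> \<le> norm x)}"
  have "norm x \<le> r" if "\<forall>f\<in>?F. f x \<le> r" for x
  proof -
    obtain f where "bounded_linear f" "\<And>y. \<bar>f y\<bar> \<le> norm y" "f x = norm x"
      by (rule norming_functional[of x]) blast
    then show ?thesis using that by auto
  qed
  moreover have "f x \<le> r" if "norm x \<le> r" "f \<in> ?F" for f x
  proof -
    from that have "\<bar>f x\<bar> \<le> norm x" by blast
    then show ?thesis using that(1) by linarith
  qed
  ultimately have iff: "norm x \<le> r \<longleftrightarrow> (\<forall>f\<in>?F. f x \<le> r)" for x by blast
  have "cball 0 r = (\<Inter>f\<in>?F. {x \<in> topspace weak_topology. f x \<le> r})"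
    unfolding set_eq_iff INT_iff mem_cball_0 iff by simp
  moreover have "closedin weak_topology (\<Inter>f\<in>?F. {x \<in> topspace weak_topology. f x \<le> r})"
  proof (rule closedin_INT)
    have "(\<lambda>_. 0) \<in> ?F" by simp
    then show "?F \<noteq> {}" by blast
    fix f assume "f \<in> ?F"
    then have "continuous_map weak_topology euclideanreal f" by (simp add: continuous_map_weak_functional)
    then show "closedin weak_topology {x \<in> topspace weak_topology. f x \<le> r}"
      by (rule closedin_Collect_le) simp
  qed
  ultimately show ?thesis by simp
qed

lemma closedin_weak_subspace:
  fixes Y :: "'a::complex_normed_vector set"
  assumes Y: "subspace Y" "closed Y"
  shows "closedin weak_topology Y"
proof -
  let ?F = "{f::'a \<Rightarrow> real. bounded_linear f \<and> (\<forall>y\<in>Y. f y = 0)}"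
  have "x \<in> Y" if "\<forall>f\<in>?F. f x = 0" for x
  proof (rule ccontr)
    assume "x \<notin> Y"
    then obtain f where "bounded_linear f" "\<And>y. y \<in> Y \<Longrightarrow> f y = 0" "f x \<noteq> (0::real)"
      by (rule closed_subspace_separation[OF Y]) blast
    then show False using that by auto
  qed
  then have iff: "x \<in> Y \<longleftrightarrow> (\<forall>f\<in>?F. f x = 0)" for x by blast
  have "Y = (\<Inter>f\<in>?F. {x \<in> topspace weak_topology. f x = 0})"
    unfolding set_eq_iff INT_iff iff by simp
  moreover have "closedin weak_topology (\<Inter>f\<in>?F. {x \<in> topspace weak_topology. f x = 0})"
  proof (rule closedin_INT)
    have "(\<lambda>_. 0) \<in> ?F" by simp
    then show "?F \<noteq> {}" by blast
    fix f assume "f \<in> ?F"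
    then have "continuous_map weak_topology euclideanreal f" by (simp add: continuous_map_weak_functional)
    then show "closedin weak_topology {x \<in> topspace weak_topology. f x = 0}"
      by (rule closedin_Collect_eq) simp
  qed
  ultimately show ?thesis by simp
qed

section \<open>The dual ball and uniform boundedness\<close>

definition dual_ball :: "('a::real_normed_vector \<Rightarrow> real) set" where
  "dual_ball = {f. linear f \<and> (\<forall>x. \<bar>f x\<bar> \<le> norm x)}"

lemma dual_ball_bounded_linear: "f \<in> dual_ball \<Longrightarrow> bounded_linear f"
  using bounded_linear_norm_le(1)[of f 1] by (auto simp: dual_ball_def abs_le_iff)

lemma norm_le_dual_ball:
  assumes "\<And>f. f \<in> dual_ball \<Longrightarrow> f x \<le> c"
  shows "norm x \<le> c"
proof -
  obtain f where "bounded_linear f" "\<And>y. \<bar>f y\<bar> \<le> norm y" "f x = norm x"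
    by (rule norming_functional[of x]) blast
  then show ?thesis using assms[of f] by (simp add: dual_ball_def bounded_linear.linear)
qed

text \<open>Banach-Alaoglu: the dual ball is a closed subset of a product of compact intervals.\<close>

lemma compact_dual_ball: "compact (dual_ball :: ('a::real_normed_vector \<Rightarrow> real) set)"
proof -
  let ?P = "PiE UNIV (\<lambda>x::'a. cball (0::real) (norm x))"
  have "compactin (product_topology (\<lambda>_::'a. euclideanreal) UNIV) ?P"
    by (subst compactin_PiE) auto
  then have P: "compact ?P" by (simp add: euclidean_product_topology)
  have cl: "closed {f::'a \<Rightarrow> real. f (x + y) = f x + f y}" "closed {f::'a \<Rightarrow> real. f (c *\<^sub>R x) = c * f x}" for x y c
    by (intro closed_Collect_eq continuous_on_add continuous_on_mult continuous_on_const
        continuous_on_product_coordinates)+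
  have "dual_ball = ?P \<inter> ((\<Inter>x. \<Inter>y. {f. f (x + y) = f x + f y}) \<inter> (\<Inter>c. \<Inter>x. {f. f (c *\<^sub>R x) = c * f x}))"
    by (auto simp: dual_ball_def linear_iff)
  also have "compact \<dots>"
    by (intro compact_Int_closed P closed_Int closed_INT ballI cl)
  finally show ?thesis .
qed

text \<open>The sets where all \<open>T i\<close> are bounded by \<open>n\<close> are closed and cover the space, so by Baire's theorem one
  of them contains a ball.\<close>

theorem uniform_boundedness:
  fixes T :: "'i \<Rightarrow> 'a::banach \<Rightarrow> 'b::real_normed_vector"
  assumes T: "\<And>i. i \<in> I \<Longrightarrow> bounded_linear (T i)"
    and bdd: "\<And>x. \<exists>B. \<forall>i\<in>I. norm (T i x) \<le> B"
  obtains C where "0 \<le> C" "\<And>i x. i \<in> I \<Longrightarrow> norm (T i x) \<le> C * norm x"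
proof -
  define F where "F n = (\<Inter>i\<in>I. {x. norm (T i x) \<le> real n})" for n
  have "closed (F n)" for n
    unfolding F_def using T
    by (intro closed_INT ballI closed_Collect_le continuous_on_norm continuous_on_const)
       (auto intro: linear_continuous_on)
  moreover have "(\<Union>n. F n) = UNIV"
  proof -
    have "\<exists>n. x \<in> F n" for x
    proof -
      obtain B where B: "\<forall>i\<in>I. norm (T i x) \<le> B" using bdd by blast
      obtain n where "B \<le> real n" using real_arch_simple by blast
      then have "x \<in> F n" using B by (fastforce simp: F_def)
      then show ?thesis ..
    qed
    then show ?thesis by auto
  qed
  moreover have "interior (\<Union>n. F n) = {}" if "\<And>n. interior (F n) = {}"
    using Baire_category_alt[of "euclidean :: 'a topology" "range F"] completely_metrizable_space_euclidean
      calculation(1) that by auto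
  ultimately obtain n where "interior (F n) \<noteq> {}" by fastforce
  then obtain a r where r: "0 < r" "cball a r \<subseteq> F n"
    using mem_interior_cball by blast
  have le: "norm (T i y) \<le> 2 * n" if "i \<in> I" "norm y \<le> r" for i y
  proof -
    interpret T: bounded_linear "T i" using T that by blast
    have "a + y \<in> F n" "a \<in> F n" using r that by (auto simp: dist_norm)
    then have "norm (T i (a + y)) \<le> n" "norm (T i a) \<le> n" using that by (auto simp: F_def)
    then show ?thesis using norm_triangle_ineq4[of "T i (a + y)" "T i a"] by (simp add: T.add)
  qed
  show thesis
  proof (rule that[of "2 * n / r"])
    fix i x assume i: "i \<in> I"
    interpret T: bounded_linear "T i" using T i by blast
    show "norm (T i x) \<le> 2 * n / r * norm x"
    proof (cases "x = 0")
      case False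
      have "norm (T i ((r / norm x) *\<^sub>R x)) \<le> 2 * n"
        using r(1) False by (intro le i) simp
      then show ?thesis using r(1) False by (simp add: T.scaleR field_simps)
    qed (simp add: T.zero)
  qed (use r in simp)
qed

text \<open>Uniform boundedness for the evaluations at the points of \<open>A\<close>, which are operators on the dual space.\<close>

lemma weakly_bounded_imp_bounded:
  fixes A :: "'a::real_normed_vector set"
  assumes "\<And>f::'a \<Rightarrow> real. bounded_linear f \<Longrightarrow> \<exists>B. \<forall>x\<in>A. \<bar>f x\<bar> \<le> B"
  shows "\<exists>B. \<forall>x\<in>A. norm x \<le> B"
proof -
  define T where "T x f = blinfun_apply f x" for x :: 'a and f :: "'a \<Rightarrow>\<^sub>L real"
  obtain C where C: "0 \<le> C" "\<And>x f. x \<in> A \<Longrightarrow> norm (T x f) \<le> C * norm f"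
  proof (rule uniform_boundedness[of A T])
    show "bounded_linear (T x)" for x
      unfolding T_def using bounded_linear_apply_blinfun by blast
    show "\<exists>B. \<forall>x\<in>A. norm (T x f) \<le> B" for f
      using assms[of "blinfun_apply f"] by (simp add: T_def blinfun.bounded_linear_right)
  qed blast
  have "norm x \<le> C" if x: "x \<in> A" for x
  proof (rule norm_le_dual_ball)
    fix f :: "'a \<Rightarrow> real" assume f: "f \<in> dual_ball"
    then have a: "blinfun_apply (Blinfun f) = f" by (simp add: bounded_linear_Blinfun_apply dual_ball_bounded_linear)
    have "norm (Blinfun f) \<le> 1"
      by (rule norm_blinfun_bound) (use f a in \<open>auto simp: dual_ball_def\<close>)
    then have "C * norm (Blinfun f) \<le> C" using C(1) by (simp add: mult_left_le)
    then show "f x \<le> C" using C(2)[OF x, of "Blinfun f"] a by (simp add: T_def)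
  qed
  then show ?thesis by blast
qed

section \<open>Separately continuous functions on products of compact spaces\<close>

lemma compact_space_cluster_point:
  fixes p :: "nat \<Rightarrow> 'a"
  assumes X: "compact_space X" and p: "\<And>n. p n \<in> topspace X"
  obtains a where "a \<in> topspace X" "\<And>W N. openin X W \<Longrightarrow> a \<in> W \<Longrightarrow> \<exists>n>N. p n \<in> W"
proof -
  have "\<exists>a\<in>topspace X. \<forall>W. openin X W \<and> a \<in> W \<longrightarrow> infinite {n. p n \<in> W}"
  proof (rule ccontr)
    assume "\<not> ?thesis"
    then have "\<forall>a\<in>topspace X. \<exists>W. openin X W \<and> a \<in> W \<and> finite {n. p n \<in> W}" by blast
    then obtain W where W: "\<And>a. a \<in> topspace X \<Longrightarrow> openin X (W a) \<and> a \<in> W a \<and> finite {n. p n \<in> W a}"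
      by metis
    then have "\<exists>\<F>. finite \<F> \<and> \<F> \<subseteq> W ` topspace X \<and> topspace X \<subseteq> \<Union>\<F>"
      by (intro compactinD[OF X[unfolded compact_space_def]]) auto
    then obtain \<F> where \<F>: "finite \<F>" "\<F> \<subseteq> W ` topspace X" "topspace X \<subseteq> \<Union>\<F>" by blast
    have "finite (\<Union>V\<in>\<F>. {n. p n \<in> V})" using \<F> W by (intro finite_UN_I) auto
    moreover have "(\<Union>V\<in>\<F>. {n. p n \<in> V}) = UNIV" using p \<F>(3) by blast
    ultimately show False by simp
  qed
  then obtain a where a: "a \<in> topspace X" "\<And>W. openin X W \<Longrightarrow> a \<in> W \<Longrightarrow> infinite {n. p n \<in> W}"
    by blast
  show thesis
  proof (rule that[OF a(1)])
    show "\<exists>n>N. p n \<in> W" if "openin X W" "a \<in> W" for W N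
      using a(2)[OF that] unfolding infinite_nat_iff_unbounded by auto
  qed
qed

text \<open>This is where compactness turns pointwise convergence into uniform convergence. If every nonempty
  open set \<open>V\<close> of \<open>X\<close> contained two points whose difference exceeds \<open>\<epsilon>\<close> somewhere on \<open>Y\<close>, one could
  choose shrinking pairs \<open>U\<^sub>n \<subseteq> X\<close>, \<open>R\<^sub>n \<subseteq> Y\<close> and points \<open>b\<^sub>n\<close>, \<open>k\<^sub>n\<close> with the following property:
  \<open>F b\<^sub>m k\<^sub>n\<close> is within \<open>1 / (m + 1)\<close> of \<open>F b\<^sub>m k\<^sub>m\<close> for \<open>n > m\<close>, but \<open>F b\<^sub>n k\<^sub>m\<close> is at distance more than \<open>\<epsilon> / 2\<close> from
  \<open>F b\<^sub>m k\<^sub>m\<close> for \<open>n > m\<close>. At a common cluster point \<open>(a, c)\<close> of the pairs \<open>(b\<^sub>n, k\<^sub>n)\<close> the two iterated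
  limits of \<open>F\<close> would differ, although both are \<open>F a c\<close> by separate continuity.\<close>

theorem fragmentation:
  fixes F :: "'a \<Rightarrow> 'b \<Rightarrow> real"
  assumes X: "compact_space X" "topspace X \<noteq> {}" and Y: "compact_space Y"
    and cX: "\<And>y. y \<in> topspace Y \<Longrightarrow> continuous_map X euclideanreal (\<lambda>x. F x y)"
    and cY: "\<And>x. x \<in> topspace X \<Longrightarrow> continuous_map Y euclideanreal (F x)"
    and \<epsilon>: "0 < \<epsilon>"
  obtains U where "openin X U" "U \<noteq> {}"
    "\<And>x x' y. x \<in> U \<Longrightarrow> x' \<in> U \<Longrightarrow> y \<in> topspace Y \<Longrightarrow> \<bar>F x y - F x' y\<bar> \<le> \<epsilon>"
proof (rule ccontr)
  assume "\<not> thesis"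
  note no = this that
  \<comment> \<open>A pair is bad if the gap occurs on \<open>Q\<close> within every nonempty open subset of \<open>U\<close>; unlike
      the mere presence of a gap, this passes to smaller \<open>U\<close>.\<close>
  define gap where "gap U Q \<longleftrightarrow> (\<exists>x\<in>U. \<exists>x'\<in>U. \<exists>q\<in>Q. \<bar>F x q - F x' q\<bar> > \<epsilon>)" for U Q
  define bad where "bad U Q \<longleftrightarrow> openin X U \<and> U \<noteq> {} \<and> (\<forall>V. openin X V \<and> V \<noteq> {} \<and> V \<subseteq> U \<longrightarrow> gap V Q)"
    for U Q
  have bad0: "bad (topspace X) (topspace Y)"
  proof -
    have "gap V (topspace Y)" if "openin X V" "V \<noteq> {}" for V
      using no(1) no(2)[OF that] unfolding gap_def by (meson not_le)
    then show ?thesis using X(2) by (auto simp: bad_def)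
  qed
  have bad_sub: "bad V Q" if "bad U Q" "openin X V" "V \<noteq> {}" "V \<subseteq> U" for U V Q
    using that unfolding bad_def by blast
  \<comment> \<open>Badness passes to one member of a finite cover after shrinking the open set.\<close>
  have split: "\<exists>Q\<in>\<Q>. \<exists>V\<subseteq>U. bad V Q" if "finite \<Q>" "bad U (\<Union>\<Q>)" for \<Q> U
    using that
  proof (induction \<Q> arbitrary: U)
    case empty
    then have "gap U {}" unfolding bad_def by (metis Union_empty subset_refl)
    then show ?case by (simp add: gap_def)
  next
    case (insert Q \<Q>)
    show ?case
    proof (cases "bad U Q")
      case False
      then obtain V where V: "openin X V" "V \<noteq> {}" "V \<subseteq> U" "\<not> gap V Q"
        using insert.prems unfolding bad_def by blast
      have "gap V' (\<Union>\<Q>)" if "openin X V'" "V' \<noteq> {}" "V' \<subseteq> V" for V'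
      proof -
        have "gap V' (\<Union>(insert Q \<Q>))"
          using insert.prems that V(3) unfolding bad_def by blast
        moreover have "\<not> gap V' Q" using V(4) that(3) unfolding gap_def by blast
        ultimately show ?thesis unfolding gap_def by blast
      qed
      then have "bad V (\<Union>\<Q>)" using V by (simp add: bad_def)
      from insert.IH[OF this] show ?thesis using V(3) by blast
    qed blast
  qed
  have step: "\<exists>V R b k. bad V R \<and> V \<subseteq> U \<and> R \<subseteq> Q \<and> b \<in> U \<and> k \<in> R \<and> (\<forall>r\<in>R. \<bar>F b r - F b k\<bar> \<le> \<delta>) \<and>
      (\<forall>x\<in>V. \<bar>F b k - F x k\<bar> > \<epsilon> / 2)"
    if bad: "bad U Q" and Q: "Q \<subseteq> topspace Y" and \<delta>: "0 < \<delta>" for U Q \<delta>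
  proof -
    obtain b where b: "b \<in> U" "b \<in> topspace X"
      using bad openin_subset unfolding bad_def by blast
    have "compactin Y (topspace Y)" using Y by (simp add: compact_space_def)
    from image_compactin[OF this cY[OF b(2)]] have "compact (F b ` topspace Y)" by simp
    then obtain A where A: "finite A" "F b ` topspace Y \<subseteq> (\<Union>c\<in>A. ball c (\<delta> / 2))"
      using \<delta> unfolding compact_eq_totally_bounded by (meson half_gt_zero)
    \<comment> \<open>The values of \<open>F b\<close> on \<open>Q\<close> are covered by finitely many small balls; one of the corresponding
        parts of \<open>Q\<close> stays bad.\<close>
    have "\<Union>((\<lambda>c. {q \<in> Q. F b q \<in> ball c (\<delta> / 2)}) ` A) = Q" using A(2) Q by blast
    with bad have "bad U (\<Union>((\<lambda>c. {q \<in> Q. F b q \<in> ball c (\<delta> / 2)}) ` A))" by simp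
    from split[OF finite_imageI[OF A(1)] this]
    obtain c V where V: "V \<subseteq> U" "bad V {q \<in> Q. F b q \<in> ball c (\<delta> / 2)}" by auto
    define R where "R = {q \<in> Q. F b q \<in> ball c (\<delta> / 2)}"
    have "gap V R" using V(2) unfolding bad_def R_def by blast
    then obtain x x' k where k: "x \<in> V" "x' \<in> V" "k \<in> R" "\<bar>F x k - F x' k\<bar> > \<epsilon>"
      unfolding gap_def by blast
    \<comment> \<open>Of two points with a gap above \<open>\<epsilon>\<close>, one is more than \<open>\<epsilon> / 2\<close> away from \<open>b\<close>.\<close>
    define V' where "V' = V \<inter> {x \<in> topspace X. \<epsilon> / 2 < \<bar>F b k - F x k\<bar>}"
    have "k \<in> topspace Y" using k(3) Q by (auto simp: R_def)
    then have "openin X V'"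
      unfolding V'_def using V(2)
      by (intro openin_Int openin_Collect_less continuous_intros cX) (auto simp: bad_def)
    moreover have "x \<in> topspace X" "x' \<in> topspace X"
      using k(1,2) V(2) openin_subset unfolding bad_def by blast+
    then have "x \<in> V' \<or> x' \<in> V'" using k unfolding V'_def by (auto simp: abs_if split: if_splits)
    ultimately have "bad V' R" using bad_sub[of V R V'] V(2) by (auto simp: R_def V'_def)
    moreover have "\<bar>F b r - F b k\<bar> \<le> \<delta>" if "r \<in> R" for r
    proof -
      have "dist c (F b r) < \<delta> / 2" "dist c (F b k) < \<delta> / 2" using that k(3) by (auto simp: R_def)
      then show ?thesis unfolding dist_real_def by linarith
    qed
    ultimately show ?thesis
      using V(1) b(1) k(3) by (intro exI[of _ V'] exI[of _ R] exI[of _ b] exI[of _ k]) (auto simp: V'_def R_def)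
  qed
  define P where "P n s = (case s of (U, R, b, k) \<Rightarrow> bad U R \<and> R \<subseteq> topspace Y \<and> b \<in> topspace X \<and> k \<in> R \<and>
      (\<forall>r\<in>R. \<bar>F b r - F b k\<bar> \<le> 1 / real (Suc n)) \<and> (\<forall>x\<in>U. \<bar>F b k - F x k\<bar> > \<epsilon> / 2))"
    for n :: nat and s :: "'a set \<times> 'b set \<times> 'a \<times> 'b"
  define D where "D s s' = (case s of (U, R, b, k) \<Rightarrow> case s' of (U', R', b', k') \<Rightarrow>
      U' \<subseteq> U \<and> R' \<subseteq> R \<and> b' \<in> U)" for s s' :: "'a set \<times> 'b set \<times> 'a \<times> 'b"
  have bad_top: "U \<subseteq> topspace X" if "bad U R" for U R using that openin_subset by (auto simp: bad_def)
  have "\<exists>s. \<forall>n. P n (s n) \<and> D (s n) (s (Suc n))"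
  proof (rule dependent_nat_choice)
    show "\<exists>s. P 0 s" using step[OF bad0 order_refl, of 1] by (auto simp: P_def)
  next
    fix s n assume "P n s"
    moreover obtain U R b k where s: "s = (U, R, b, k)" by (cases s)
    ultimately have "bad U R" "R \<subseteq> topspace Y" by (auto simp: P_def)
    from step[OF this, of "1 / real (Suc (Suc n))"]
    obtain V R' b' k' where *: "bad V R'" "V \<subseteq> U" "R' \<subseteq> R" "b' \<in> U" "k' \<in> R'"
      "\<forall>r\<in>R'. \<bar>F b' r - F b' k'\<bar> \<le> 1 / real (Suc (Suc n))" "\<forall>x\<in>V. \<bar>F b' k' - F x k'\<bar> > \<epsilon> / 2"
      by auto
    have "P (Suc n) (V, R', b', k')" "D s (V, R', b', k')"
      unfolding P_def D_def s prod.case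
      using * \<open>R \<subseteq> topspace Y\<close> bad_top[OF \<open>bad U R\<close>] by blast+
    then show "\<exists>s'. P (Suc n) s' \<and> D s s'" by blast
  qed
  then obtain s where s: "\<And>n. P n (s n)" "\<And>n. D (s n) (s (Suc n))" by blast
  define U R b k where "U n = fst (s n)" and "R n = fst (snd (s n))" and "b n = fst (snd (snd (s n)))"
    and "k n = snd (snd (snd (s n)))" for n
  have seq: "s n = (U n, R n, b n, k n)" for n by (simp add: U_def R_def b_def k_def)
  have P: "bad (U n) (R n)" "R n \<subseteq> topspace Y" "b n \<in> topspace X" "k n \<in> R n"
    "\<And>r. r \<in> R n \<Longrightarrow> \<bar>F (b n) r - F (b n) (k n)\<bar> \<le> 1 / real (Suc n)"
    "\<And>x. x \<in> U n \<Longrightarrow> \<bar>F (b n) (k n) - F x (k n)\<bar> > \<epsilon> / 2" for n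
    using s(1)[of n] by (auto simp: P_def seq)
  have D: "U (Suc n) \<subseteq> U n" "R (Suc n) \<subseteq> R n" "b (Suc n) \<in> U n" for n
    using s(2)[of n] by (auto simp: D_def seq)
  have U_anti: "U n \<subseteq> U m" if "m \<le> n" for m n using lift_Suc_antimono_le[of U, OF D(1) that] .
  have R_anti: "R n \<subseteq> R m" if "m \<le> n" for m n using lift_Suc_antimono_le[of R, OF D(2) that] .
  have later: "b n \<in> U m" "k n \<in> R m" if "m < n" for m n
  proof -
    from that obtain i where "n = Suc i" "m \<le> i" by (cases n) auto
    then show "b n \<in> U m" using D(3)[of i] U_anti by blast
    show "k n \<in> R m" using P(4)[of n] R_anti[of m n] that by auto
  qed
  have kY: "k n \<in> topspace Y" for n using P(2,4) by blast
  \<comment> \<open>A cluster point in the product controls both coordinates along the same indices.\<close>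
  obtain z where z: "z \<in> topspace (prod_topology X Y)"
    "\<And>W N. openin (prod_topology X Y) W \<Longrightarrow> z \<in> W \<Longrightarrow> \<exists>n>N. (b n, k n) \<in> W"
  proof (rule compact_space_cluster_point[of "prod_topology X Y" "\<lambda>n. (b n, k n)"])
    show "compact_space (prod_topology X Y)" using X Y by (simp add: compact_space_prod_topology)
  qed (use P(3) kY in auto)
  obtain a c where ac: "z = (a, c)" "a \<in> topspace X" "c \<in> topspace Y" using z(1) by auto
  have cluster: "\<exists>n>N. b n \<in> V \<and> k n \<in> W" if "openin X V" "openin Y W" "a \<in> V" "c \<in> W" for V W N
    using z(2)[of "V \<times> W" N] that ac by (auto simp: openin_prod_Times_iff)
  have near: "\<bar>F (b m) c - F (b m) (k m)\<bar> \<le> 1 / real (Suc m)" for m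
  proof (rule ccontr)
    assume "\<not> ?thesis"
    then have "\<exists>n>m. b n \<in> topspace X \<and> k n \<in> {y \<in> topspace Y. 1 / real (Suc m) < \<bar>F (b m) y - F (b m) (k m)\<bar>}"
      using ac by (intro cluster openin_Collect_less continuous_intros cY P) auto
    then show False using P(5) later(2) by fastforce
  qed
  have far: "\<epsilon> / 2 \<le> \<bar>F (b m) (k m) - F a (k m)\<bar>" for m
  proof (rule ccontr)
    assume "\<not> ?thesis"
    then have "\<exists>n>m. b n \<in> {x \<in> topspace X. \<bar>F (b m) (k m) - F x (k m)\<bar> < \<epsilon> / 2} \<and> k n \<in> topspace Y"
      using ac kY by (intro cluster openin_Collect_less continuous_intros cX) auto
    then obtain n where "n > m" "\<bar>F (b m) (k m) - F (b n) (k m)\<bar> < \<epsilon> / 2" by blast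
    then show False using P(6)[OF later(1)] by fastforce
  qed
  obtain N where N: "1 / real (Suc N) < \<epsilon> / 8" using nat_approx_posE[of "\<epsilon> / 8"] \<epsilon> by auto
  have "\<exists>n>N. b n \<in> {x \<in> topspace X. \<bar>F x c - F a c\<bar> < \<epsilon> / 8} \<and> k n \<in> {y \<in> topspace Y. \<bar>F a y - F a c\<bar> < \<epsilon> / 8}"
    using ac \<epsilon> by (intro cluster openin_Collect_less continuous_intros cX cY) auto
  then obtain n where n: "n > N" "\<bar>F (b n) c - F a c\<bar> < \<epsilon> / 8" "\<bar>F a (k n) - F a c\<bar> < \<epsilon> / 8"
    by blast
  have "1 / real (Suc n) \<le> 1 / real (Suc N)" using n(1) by (intro divide_left_mono) auto
  then show False using near[of n] far[of n] n N by linarith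
qed

section \<open>Compact semitopological semigroups with a dense group\<close>

text \<open>By compactness a chain of nonempty closed sets has nonempty intersection, so Zorn's lemma yields
  minimal members.\<close>

lemma minimal_closed_member:
  assumes X: "compact_space X" and A: "A \<in> \<C>"
    and cl: "\<And>C. C \<in> \<C> \<Longrightarrow> closedin X C \<and> C \<noteq> {}"
    and Int: "\<And>\<D>. \<D> \<noteq> {} \<Longrightarrow> \<D> \<subseteq> \<C> \<Longrightarrow> \<Inter>\<D> \<noteq> {} \<Longrightarrow> \<Inter>\<D> \<in> \<C>"
  obtains M where "M \<in> \<C>" "\<And>C. C \<in> \<C> \<Longrightarrow> C \<subseteq> M \<Longrightarrow> C = M"
proof -
  have "\<exists>m\<in>\<C>. \<forall>a\<in>\<C>. m \<supseteq> a \<longrightarrow> a = m"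
  proof (rule predicate_Zorn)
    show "partial_order_on \<C> (relation_of (\<supseteq>) \<C>)"
      by (intro partial_order_on_relation_ofI) auto
  next
    fix \<D> assume "\<D> \<in> Chains (relation_of (\<supseteq>) \<C>)"
    then have sub: "\<D> \<subseteq> \<C>" and ch: "\<And>C D. C \<in> \<D> \<Longrightarrow> D \<in> \<D> \<Longrightarrow> C \<subseteq> D \<or> D \<subseteq> C"
      by (auto simp: Chains_def relation_of_def)
    show "\<exists>u\<in>\<C>. \<forall>a\<in>\<D>. a \<supseteq> u"
    proof (cases "\<D> = {}")
      case True
      then show ?thesis using A by auto
    next
      case False
      have "\<Inter>\<F> \<noteq> {}" if "finite \<F>" "\<F> \<subseteq> \<D>" for \<F>
      proof (cases "\<F> = {}")
        case False
        have "subset.chain \<C> \<F>"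
          unfolding subset_chain_def using that(2) sub ch by blast
        then have "\<Inter>\<F> \<in> \<F>" by (intro Inter_in_chain that(1) False)
        then show ?thesis using that(2) sub cl by blast
      qed simp
      moreover have "\<forall>C\<in>\<D>. closedin X C" using sub cl by blast
      ultimately have "\<Inter>\<D> \<noteq> {}" using X[unfolded compact_space_fip, rule_format, of \<D>] by simp
      then show ?thesis using Int[OF False sub] by blast
    qed
  qed
  then show thesis using that by blast
qed

lemma compact_Hausdorff_eqI:
  assumes X: "compact_space X" "Hausdorff_space X" and xy: "x \<in> topspace X" "y \<in> topspace X"
    and eq: "\<And>h. continuous_map X euclideanreal h \<Longrightarrow> h x = h y"
  shows "x = y"
proof (rule ccontr)
  assume "x \<noteq> y"
  have "normal_space X" using X by (simp add: compact_Hausdorff_or_regular_imp_normal_space)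
  moreover have "closedin X {x}" "closedin X {y}"
    using X(2) xy by (simp_all add: closedin_Hausdorff_singleton)
  ultimately obtain h where h: "continuous_map X (top_of_set {0..1::real}) h" "h ` {x} \<subseteq> {0}" "h ` {y} \<subseteq> {1}"
    using Urysohn_lemma[of X "{x}" "{y}" 0 1] \<open>x \<noteq> y\<close> by (auto simp: disjnt_def)
  then have "continuous_map X euclideanreal h" by (simp add: continuous_map_in_subtopology)
  from eq[OF this] h show False by simp
qed

text \<open>The model is the weak operator closure of a group of operators, where composition is continuous in
  each factor separately but in general not jointly.\<close>

locale dense_group_semigroup =
  fixes X :: "'a topology" and mult :: "'a \<Rightarrow> 'a \<Rightarrow> 'a" (infixl \<open>\<cdot>\<close> 70) and \<gamma> :: "'g::group_add \<Rightarrow> 'a"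
  assumes compact: "compact_space X" and Hausdorff: "Hausdorff_space X"
    and closed: "x \<in> topspace X \<Longrightarrow> y \<in> topspace X \<Longrightarrow> x \<cdot> y \<in> topspace X"
    and assoc: "x \<in> topspace X \<Longrightarrow> y \<in> topspace X \<Longrightarrow> z \<in> topspace X \<Longrightarrow> (x \<cdot> y) \<cdot> z = x \<cdot> (y \<cdot> z)"
    and cont_left: "a \<in> topspace X \<Longrightarrow> continuous_map X X (\<lambda>x. a \<cdot> x)"
    and cont_right: "a \<in> topspace X \<Longrightarrow> continuous_map X X (\<lambda>x. x \<cdot> a)"
    and unit: "x \<in> topspace X \<Longrightarrow> \<gamma> 0 \<cdot> x = x" "x \<in> topspace X \<Longrightarrow> x \<cdot> \<gamma> 0 = x"
    and hom: "\<gamma> (s + t) = \<gamma> s \<cdot> \<gamma> t"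
    and group_in: "\<gamma> s \<in> topspace X"
    and dense: "X closure_of range \<gamma> = topspace X"
begin

lemma dense_obtain:
  assumes "openin X W" "x \<in> W"
  obtains s where "\<gamma> s \<in> W"
proof -
  have "W \<inter> X closure_of range \<gamma> \<noteq> {}"
    using assms openin_subset[OF assms(1)] dense by auto
  then have "W \<inter> range \<gamma> \<noteq> {}"
    by (simp add: openin_Int_closure_of_eq_empty[OF assms(1)])
  then show thesis using that by auto
qed

lemma cancel: "x \<in> topspace X \<Longrightarrow> \<gamma> (- s) \<cdot> (\<gamma> s \<cdot> x) = x" "x \<in> topspace X \<Longrightarrow> \<gamma> s \<cdot> (\<gamma> (- s) \<cdot> x) = x"
  using unit(1)[of x] unfolding assoc[OF group_in group_in, symmetric] hom[symmetric] by simp_all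

text \<open>The axioms are symmetric, which makes every statement about left ideals one about right ideals.\<close>

lemma opposite: "dense_group_semigroup X (\<lambda>x y. y \<cdot> x) (\<lambda>s. \<gamma> (- s))"
proof
  have "range (\<lambda>s. \<gamma> (- s)) = range \<gamma>" by (metis add.inverse_inverse image_cong surj_def image_image surjI)
  then show "X closure_of range (\<lambda>s. \<gamma> (- s)) = topspace X" using dense by simp
qed (use compact Hausdorff closed assoc cont_left cont_right unit group_in in \<open>auto simp: minus_add simp flip: hom\<close>)

text \<open>The decisive consequence of the dense group. Let \<open>K = X \<cdot> e\<close> and let \<open>h\<close> be continuous. By
  fragmentation some nonempty open part of \<open>K\<close> is almost constant for the distance
  \<open>sup\<^sub>b \<bar>h (b \<cdot> x) - h (b \<cdot> x')\<bar>\<close>. It contains a point \<open>\<gamma> g \<cdot> e\<close>. The distance is invariant under the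
  group, so it is small on a neighbourhood of \<open>e\<close> in \<open>K\<close>. As \<open>e \<cdot> e = e \<cdot> f = e\<close>, both \<open>\<gamma> s \<cdot> e\<close> and
  \<open>\<gamma> s \<cdot> f\<close> lie in that neighbourhood for some \<open>s\<close>, and translating back by \<open>\<gamma> (- s)\<close> makes \<open>h e\<close> and
  \<open>h f\<close> close.\<close>

lemma idempotents_left_ideal_eq:
  assumes ef: "e \<in> topspace X" "f \<in> topspace X" and e: "e \<cdot> e = e" and eq: "e \<cdot> f = e" "f \<cdot> e = f"
  shows "e = f"
proof (rule compact_Hausdorff_eqI[OF compact Hausdorff ef])
  fix h assume h: "continuous_map X euclideanreal h"
  have "\<bar>h e - h f\<bar> \<le> \<epsilon>" if \<epsilon>: "0 < \<epsilon>" for \<epsilon>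
  proof -
    define K where "K = (\<lambda>x. x \<cdot> e) ` topspace X"
    have Ksub: "K \<subseteq> topspace X" using closed ef by (auto simp: K_def)
    have "compactin X K"
      unfolding K_def using compact cont_right[OF ef(1)] by (auto simp: compact_space_def intro: image_compactin)
    then have XK: "compact_space (subtopology X K)" by (simp add: compact_space_subtopology)
    have tK: "topspace (subtopology X K) = K" using Ksub by auto
    have hc: "continuous_map X euclideanreal (\<lambda>x. h (a \<cdot> x))" "continuous_map X euclideanreal (\<lambda>x. h (x \<cdot> a))"
      if "a \<in> topspace X" for a
      using continuous_map_compose[OF cont_left[OF that] h] continuous_map_compose[OF cont_right[OF that] h]
      by (simp_all add: o_def)
    obtain U where U: "openin (subtopology X K) U" "U \<noteq> {}"
      "\<And>x x' b. x \<in> U \<Longrightarrow> x' \<in> U \<Longrightarrow> b \<in> topspace X \<Longrightarrow> \<bar>h (b \<cdot> x) - h (b \<cdot> x')\<bar> \<le> \<epsilon>"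
    proof (rule fragmentation[of "subtopology X K" X "\<lambda>x b. h (b \<cdot> x)" \<epsilon>])
      show "topspace (subtopology X K) \<noteq> {}" using tK ef by (auto simp: K_def)
      show "continuous_map (subtopology X K) euclideanreal (\<lambda>x. h (y \<cdot> x))" if "y \<in> topspace X" for y
        by (intro continuous_map_from_subtopology hc that)
      show "continuous_map X euclideanreal (\<lambda>b. h (b \<cdot> x))" if "x \<in> topspace (subtopology X K)" for x
        using that Ksub tK by (intro hc) auto
    qed (use XK compact \<epsilon> in auto)
    then obtain T where T: "openin X T" "U = T \<inter> K" by (auto simp: openin_subtopology)
    have "openin X {x \<in> topspace X. x \<cdot> e \<in> T}"
      by (rule openin_continuous_map_preimage[OF cont_right[OF ef(1)] T(1)])
    moreover from U(2) T(2) obtain u where "u \<in> {x \<in> topspace X. x \<cdot> e \<in> T}" by (auto simp: K_def)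
    ultimately obtain g where "\<gamma> g \<in> {x \<in> topspace X. x \<cdot> e \<in> T}" by (rule dense_obtain)
    then have g: "\<gamma> g \<cdot> e \<in> T" by simp
    have o: "openin X {x \<in> topspace X. \<gamma> g \<cdot> (x \<cdot> a) \<in> T}" if "a \<in> topspace X" for a
    proof -
      have "continuous_map X X (\<lambda>x. \<gamma> g \<cdot> (x \<cdot> a))"
        using continuous_map_compose[OF cont_right[OF that] cont_left[OF group_in]] by (simp add: o_def)
      then show ?thesis using T(1) by (rule openin_continuous_map_preimage)
    qed
    have "openin X ({x \<in> topspace X. \<gamma> g \<cdot> (x \<cdot> e) \<in> T} \<inter> {x \<in> topspace X. \<gamma> g \<cdot> (x \<cdot> f) \<in> T})"
      by (intro openin_Int o ef)
    moreover have "e \<in> {x \<in> topspace X. \<gamma> g \<cdot> (x \<cdot> e) \<in> T} \<inter> {x \<in> topspace X. \<gamma> g \<cdot> (x \<cdot> f) \<in> T}"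
      using ef g e eq by simp
    ultimately obtain s where
      "\<gamma> s \<in> {x \<in> topspace X. \<gamma> g \<cdot> (x \<cdot> e) \<in> T} \<inter> {x \<in> topspace X. \<gamma> g \<cdot> (x \<cdot> f) \<in> T}"
      by (rule dense_obtain)
    then have s: "\<gamma> g \<cdot> (\<gamma> s \<cdot> e) \<in> T" "\<gamma> g \<cdot> (\<gamma> s \<cdot> f) \<in> T" by auto
    have gs: "\<gamma> g \<cdot> (\<gamma> s \<cdot> x) = \<gamma> (g + s) \<cdot> x" if "x \<in> topspace X" for x
      using that by (simp add: hom assoc group_in)
    have "\<gamma> (g + s) \<cdot> e \<in> U" "\<gamma> (g + s) \<cdot> f \<in> U"
    proof -
      show "\<gamma> (g + s) \<cdot> e \<in> U" using s(1) ef group_in unfolding T(2) K_def by (auto simp: gs)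
      have "\<gamma> (g + s) \<cdot> f = (\<gamma> (g + s) \<cdot> f) \<cdot> e" using eq(2) ef by (simp add: assoc group_in)
      then show "\<gamma> (g + s) \<cdot> f \<in> U" using s(2) ef group_in closed unfolding T(2) K_def by (auto simp: gs)
    qed
    from U(3)[OF this group_in[of "- (g + s)"]] show ?thesis using ef by (simp add: cancel)
  qed
  from this[of "\<bar>h e - h f\<bar> / 2"] show "h e = h f" by (cases "h e = h f") simp_all
qed

lemma idempotents_right_ideal_eq:
  assumes "e \<in> topspace X" "f \<in> topspace X" "e \<cdot> e = e" "e \<cdot> f = f" "f \<cdot> e = e"
  shows "e = f"
  using dense_group_semigroup.idempotents_left_ideal_eq[OF opposite assms(1,2,3)] assms by simp

lemma closedin_image_right:
  assumes "closedin X L" "a \<in> topspace X"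
  shows "closedin X ((\<lambda>x. x \<cdot> a) ` L)"
proof -
  have "compactin X ((\<lambda>x. x \<cdot> a) ` L)"
    by (rule image_compactin[OF closedin_compact_space[OF compact assms(1)] cont_right[OF assms(2)]])
  then show ?thesis by (rule compactin_imp_closedin[OF Hausdorff])
qed

text \<open>In a minimal closed subsemigroup \<open>M\<close> every \<open>a\<close> satisfies \<open>M \<cdot> a = M\<close>, and then
  \<open>{x \<in> M. x \<cdot> a = a}\<close> is a nonempty closed subsemigroup, hence all of \<open>M\<close>.\<close>

lemma idempotent_exists:
  assumes J: "closedin X J" "J \<noteq> {}" "\<And>x y. x \<in> J \<Longrightarrow> y \<in> J \<Longrightarrow> x \<cdot> y \<in> J"
  obtains e where "e \<in> J" "e \<cdot> e = e"
proof -
  define \<C> where "\<C> = {C. closedin X C \<and> C \<noteq> {} \<and> C \<subseteq> J \<and> (\<forall>x\<in>C. \<forall>y\<in>C. x \<cdot> y \<in> C)}"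
  obtain M where M: "M \<in> \<C>" "\<And>C. C \<in> \<C> \<Longrightarrow> C \<subseteq> M \<Longrightarrow> C = M"
  proof (rule minimal_closed_member[OF compact, of J \<C>])
    show "\<Inter>\<D> \<in> \<C>" if "\<D> \<noteq> {}" "\<D> \<subseteq> \<C>" "\<Inter>\<D> \<noteq> {}" for \<D>
    proof -
      have "closedin X (\<Inter>\<D>)" using that(1,2) by (intro closedin_Inter) (auto simp: \<C>_def)
      moreover have "\<Inter>\<D> \<subseteq> J" using that(1,2) unfolding \<C>_def by blast
      moreover have "x \<cdot> y \<in> \<Inter>\<D>" if "x \<in> \<Inter>\<D>" "y \<in> \<Inter>\<D>" for x y
        using that \<open>\<D> \<subseteq> \<C>\<close> unfolding \<C>_def by blast
      ultimately show ?thesis using that(3) by (simp add: \<C>_def)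
    qed
  qed (use J in \<open>auto simp: \<C>_def\<close>)
  then have cM: "closedin X M" and M0: "M \<noteq> {}" and mM: "\<And>x y. x \<in> M \<Longrightarrow> y \<in> M \<Longrightarrow> x \<cdot> y \<in> M"
    and MJ: "M \<subseteq> J"
    by (auto simp: \<C>_def)
  have MX: "M \<subseteq> topspace X" using cM closedin_subset by auto
  obtain a where a: "a \<in> M" using M0 by blast
  have aX: "a \<in> topspace X" using a MX by auto
  have "closedin X ((\<lambda>x. x \<cdot> a) ` M)" by (rule closedin_image_right[OF cM aX])
  moreover have "x \<cdot> a \<cdot> (y \<cdot> a) = (x \<cdot> a \<cdot> y) \<cdot> a" if "x \<in> M" "y \<in> M" for x y
  proof -
    have "x \<in> topspace X" "y \<in> topspace X" using that MX by auto
    then show ?thesis using aX closed by (simp add: assoc)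
  qed
  ultimately have "(\<lambda>x. x \<cdot> a) ` M \<in> \<C>"
    using M0 mM subsetD[OF MJ] a unfolding \<C>_def by auto
  then have Ma: "(\<lambda>x. x \<cdot> a) ` M = M" using M(2) mM a by auto
  define B where "B = M \<inter> {x \<in> topspace X. x \<cdot> a \<in> {a}}"
  have "closedin X B"
    unfolding B_def using cM aX Hausdorff
    by (intro closedin_Int closedin_continuous_map_preimage[OF cont_right]) (simp_all add: closedin_Hausdorff_singleton)
  moreover have "B \<noteq> {}"
  proof -
    obtain x where "x \<in> M" "x \<cdot> a = a" using a Ma by (metis imageE)
    then show ?thesis using MX by (auto simp: B_def)
  qed
  moreover have "x \<cdot> y \<in> B" if "x \<in> B" "y \<in> B" for x y
    using that mM aX closed by (auto simp: B_def assoc)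
  ultimately have "B \<in> \<C>" using MJ by (auto simp: \<C>_def B_def)
  then have "B = M" using M(2) by (auto simp: B_def)
  then have "a \<cdot> a = a" using a by (auto simp: B_def)
  then show thesis using that a MJ by blast
qed

end

locale invariant_subsemigroup = dense_group_semigroup +
  fixes N
  assumes N_closedin: "closedin X N" and N_nonempty: "N \<noteq> {}"
    and N_mult: "x \<in> N \<Longrightarrow> y \<in> N \<Longrightarrow> x \<cdot> y \<in> N"
    and N_conj: "x \<in> N \<Longrightarrow> \<gamma> s \<cdot> x \<cdot> \<gamma> (- s) \<in> N"
begin

text \<open>A left ideal is minimal if each of its elements generates it; in this form minimality is
  transported by conjugation without comparing ideals.\<close>

definition minimal_left_ideal where
  "minimal_left_ideal L \<longleftrightarrow> closedin X L \<and> L \<noteq> {} \<and> L \<subseteq> N \<and> (\<forall>y\<in>L. (\<lambda>x. x \<cdot> y) ` N = L)"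

lemma NX: "x \<in> N \<Longrightarrow> x \<in> topspace X"
  using N_closedin closedin_subset by auto

lemma mli:
  assumes "minimal_left_ideal L"
  shows "closedin X L" "L \<noteq> {}" "y \<in> L \<Longrightarrow> y \<in> N" "x \<in> N \<Longrightarrow> y \<in> L \<Longrightarrow> x \<cdot> y \<in> L"
    "y \<in> L \<Longrightarrow> z \<in> L \<Longrightarrow> \<exists>x\<in>N. z = x \<cdot> y"
  using assms unfolding minimal_left_ideal_def by blast+

lemma minimal_left_ideal_exists:
  obtains L where "minimal_left_ideal L"
proof -
  define \<C> where "\<C> = {L. closedin X L \<and> L \<noteq> {} \<and> L \<subseteq> N \<and> (\<forall>x\<in>N. \<forall>y\<in>L. x \<cdot> y \<in> L)}"
  obtain M where M: "M \<in> \<C>" "\<And>C. C \<in> \<C> \<Longrightarrow> C \<subseteq> M \<Longrightarrow> C = M"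
  proof (rule minimal_closed_member[OF compact, of N \<C>])
    show "\<Inter>\<D> \<in> \<C>" if "\<D> \<noteq> {}" "\<D> \<subseteq> \<C>" "\<Inter>\<D> \<noteq> {}" for \<D>
    proof -
      have "closedin X (\<Inter>\<D>)" using that(1,2) by (intro closedin_Inter) (auto simp: \<C>_def)
      moreover have "\<Inter>\<D> \<subseteq> N" using that(1,2) unfolding \<C>_def by blast
      moreover have "x \<cdot> y \<in> \<Inter>\<D>" if "x \<in> N" "y \<in> \<Inter>\<D>" for x y
        using that \<open>\<D> \<subseteq> \<C>\<close> unfolding \<C>_def by blast
      ultimately show ?thesis using that(3) by (simp add: \<C>_def)
    qed
  qed (use N_closedin N_nonempty N_mult in \<open>auto simp: \<C>_def\<close>)
  have "(\<lambda>x. x \<cdot> y) ` N = M" if y: "y \<in> M" for y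
  proof (rule M(2))
    have yX: "y \<in> topspace X" and yN: "y \<in> N" using y M(1) NX by (auto simp: \<C>_def)
    have "x \<cdot> (z \<cdot> y) = (x \<cdot> z) \<cdot> y" if "x \<in> N" "z \<in> N" for x z
      using that yX NX by (simp add: assoc)
    then show "(\<lambda>x. x \<cdot> y) ` N \<in> \<C>"
      using closedin_image_right[OF N_closedin yX] N_nonempty N_mult yN unfolding \<C>_def by auto
    show "(\<lambda>x. x \<cdot> y) ` N \<subseteq> M" using M(1) y by (auto simp: \<C>_def)
  qed
  then have "minimal_left_ideal M" using M(1) by (simp add: minimal_left_ideal_def \<C>_def)
  then show thesis by (rule that)
qed

text \<open>Two idempotents of a minimal left ideal satisfy \<open>e \<cdot> f = e\<close> and \<open>f \<cdot> e = f\<close>.\<close>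

lemma minimal_left_ideal_idempotents_eq:
  assumes L: "minimal_left_ideal L" and e: "e \<in> L" "e \<cdot> e = e" and f: "f \<in> L" "f \<cdot> f = f"
  shows "e = f"
proof -
  have *: "a \<cdot> b = a" if ab: "a \<in> L" "b \<in> L" "b \<cdot> b = b" for a b
  proof -
    obtain x where "x \<in> N" "a = x \<cdot> b" using mli(5)[OF L ab(2,1)] by blast
    then show ?thesis using ab mli(3)[OF L] NX by (simp add: assoc)
  qed
  show ?thesis
    by (rule idempotents_left_ideal_eq[OF NX NX e(2) *[OF e(1) f] *[OF f(1) e]])
       (rule mli(3)[OF L], fact)+
qed

lemma minimal_left_ideal_fixing_idempotent:
  assumes L: "minimal_left_ideal L" and c: "c \<in> topspace X" and x: "x \<in> L" "x \<cdot> c = c"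
  obtains f where "f \<in> L" "f \<cdot> f = f" "f \<cdot> c = c"
proof -
  define B where "B = L \<inter> {x \<in> topspace X. x \<cdot> c \<in> {c}}"
  obtain f where "f \<in> B" "f \<cdot> f = f"
  proof (rule idempotent_exists[of B])
    show "closedin X B"
      unfolding B_def using mli(1)[OF L] c Hausdorff
      by (intro closedin_Int closedin_continuous_map_preimage[OF cont_right]) (simp_all add: closedin_Hausdorff_singleton)
    show "B \<noteq> {}" using x mli(3)[OF L] NX by (auto simp: B_def)
    show "y \<cdot> z \<in> B" if "y \<in> B" "z \<in> B" for y z
      using that c closed mli(3,4)[OF L] by (auto simp: B_def assoc)
  qed blast
  then show thesis using that by (auto simp: B_def)
qed

text \<open>The other minimal left ideal contains an idempotent \<open>f\<close> generating the same right ideal as \<open>e\<close>, and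
  such idempotents are equal by the symmetric form of the lemma on left ideals.\<close>

lemma idempotent_in_every_minimal_left_ideal:
  assumes L: "minimal_left_ideal L" and L': "minimal_left_ideal L'" and e: "e \<in> L" "e \<cdot> e = e"
  shows "e \<in> L'"
proof -
  have eN: "e \<in> N" and eX: "e \<in> topspace X" using mli(3)[OF L] NX e by auto
  obtain y where y: "y \<in> L'" using mli(2)[OF L'] by blast
  have "y \<cdot> e \<in> L" using mli(4)[OF L] mli(3)[OF L'] y e by blast
  then obtain x where x: "x \<in> N" "e = x \<cdot> (y \<cdot> e)" using mli(5)[OF L _ e(1)] by blast
  have "(x \<cdot> y) \<cdot> e = e" using x y mli(3)[OF L'] NX eX by (simp add: assoc)
  then obtain f where f: "f \<in> L'" "f \<cdot> f = f" "f \<cdot> e = e"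
    using minimal_left_ideal_fixing_idempotent[OF L' eX] mli(4)[OF L' x(1) y] by blast
  have fX: "f \<in> topspace X" using f(1) mli(3)[OF L'] NX by auto
  have ef: "e \<cdot> f \<in> L'" using mli(4)[OF L' eN f(1)] .
  obtain z where z: "z \<in> N" "f = z \<cdot> (e \<cdot> f)" using mli(5)[OF L' ef f(1)] by blast
  have idem: "(e \<cdot> f) \<cdot> (e \<cdot> f) = e \<cdot> f"
  proof -
    have "(e \<cdot> f) \<cdot> (e \<cdot> f) = e \<cdot> ((f \<cdot> e) \<cdot> f)" using eX fX closed by (simp add: assoc)
    then show ?thesis using f(3) e(2) eX fX by (simp add: assoc[symmetric])
  qed
  have "f \<cdot> (e \<cdot> f) = (z \<cdot> (e \<cdot> f)) \<cdot> (e \<cdot> f)"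
    using z(2) by (rule arg_cong[where f = "\<lambda>u. u \<cdot> (e \<cdot> f)"])
  also have "\<dots> = z \<cdot> (e \<cdot> f)"
    using closed[OF eX fX] NX[OF z(1)] by (simp add: assoc[of z "e \<cdot> f"] idem)
  finally have "f \<cdot> (e \<cdot> f) = f" using z(2) by simp
  moreover have "f \<cdot> (e \<cdot> f) = e \<cdot> f" using f(3) eX fX by (simp add: assoc[symmetric])
  ultimately have "e \<cdot> f = f" by simp
  then have "e = f" using idempotents_right_ideal_eq[OF eX fX e(2)] f(3) by simp
  then show ?thesis using f by simp
qed

lemma minimal_left_ideal_conj:
  assumes L: "minimal_left_ideal L"
  shows "minimal_left_ideal ((\<lambda>x. \<gamma> s \<cdot> x \<cdot> \<gamma> (- s)) ` L)"
proof -
  have LX: "x \<in> topspace X" if "x \<in> L" for x using that mli(3)[OF L] NX by auto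
  have "continuous_map X X (\<lambda>x. \<gamma> s \<cdot> x \<cdot> \<gamma> (- s))"
    using continuous_map_compose[OF cont_left[OF group_in[of s]] cont_right[OF group_in[of "- s"]]] by (simp add: o_def)
  then have "closedin X ((\<lambda>x. \<gamma> s \<cdot> x \<cdot> \<gamma> (- s)) ` L)"
    by (rule compactin_imp_closedin[OF Hausdorff image_compactin[OF closedin_compact_space[OF compact mli(1)[OF L]]]])
  moreover have conj_mult: "(\<gamma> s \<cdot> x \<cdot> \<gamma> (- s)) \<cdot> (\<gamma> s \<cdot> y \<cdot> \<gamma> (- s)) = \<gamma> s \<cdot> (x \<cdot> y) \<cdot> \<gamma> (- s)"
    if "x \<in> topspace X" "y \<in> topspace X" for x y
    using that closed by (simp add: assoc group_in cancel)
  have onto: "\<exists>x'\<in>N. x = \<gamma> s \<cdot> x' \<cdot> \<gamma> (- s)" if "x \<in> N" for x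
  proof
    show "\<gamma> (- s) \<cdot> x \<cdot> \<gamma> s \<in> N" using N_conj[OF that, of "- s"] by simp
    have "\<gamma> s \<cdot> \<gamma> (- s) = \<gamma> 0" by (simp add: hom[symmetric])
    then show "x = \<gamma> s \<cdot> (\<gamma> (- s) \<cdot> x \<cdot> \<gamma> s) \<cdot> \<gamma> (- s)"
      using that NX closed by (simp add: assoc group_in cancel unit)
  qed
  moreover have "(\<lambda>x. x \<cdot> (\<gamma> s \<cdot> y \<cdot> \<gamma> (- s))) ` N = (\<lambda>x. \<gamma> s \<cdot> x \<cdot> \<gamma> (- s)) ` L" if y: "y \<in> L" for y
  proof (intro equalityI subsetI)
    fix z assume "z \<in> (\<lambda>x. x \<cdot> (\<gamma> s \<cdot> y \<cdot> \<gamma> (- s))) ` N"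
    then obtain x where x: "x \<in> N" "z = x \<cdot> (\<gamma> s \<cdot> y \<cdot> \<gamma> (- s))" by blast
    obtain x' where x': "x' \<in> N" "x = \<gamma> s \<cdot> x' \<cdot> \<gamma> (- s)" using onto[OF x(1)] by blast
    show "z \<in> (\<lambda>x. \<gamma> s \<cdot> x \<cdot> \<gamma> (- s)) ` L"
      unfolding x(2) x'(2) conj_mult[OF NX[OF x'(1)] LX[OF y]] using mli(4)[OF L x'(1) y] by blast
  next
    fix z assume "z \<in> (\<lambda>x. \<gamma> s \<cdot> x \<cdot> \<gamma> (- s)) ` L"
    then obtain w where w: "w \<in> L" "z = \<gamma> s \<cdot> w \<cdot> \<gamma> (- s)" by blast
    obtain x where x: "x \<in> N" "w = x \<cdot> y" using mli(5)[OF L y w(1)] by blast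
    have "z = (\<gamma> s \<cdot> x \<cdot> \<gamma> (- s)) \<cdot> (\<gamma> s \<cdot> y \<cdot> \<gamma> (- s))"
      using w(2) x(2) conj_mult[OF NX[OF x(1)] LX[OF y]] by simp
    then show "z \<in> (\<lambda>x. x \<cdot> (\<gamma> s \<cdot> y \<cdot> \<gamma> (- s))) ` N"
      using N_conj[OF x(1)] by blast
  qed
  moreover have "(\<lambda>x. \<gamma> s \<cdot> x \<cdot> \<gamma> (- s)) ` L \<subseteq> N" using N_conj mli(3)[OF L] by blast
  ultimately show ?thesis using mli(2)[OF L] by (auto simp: minimal_left_ideal_def)
qed

text \<open>Since each minimal left ideal has one idempotent and all share it, there is a single minimal
  left ideal. It is a group, and uniqueness makes it invariant under conjugation. Without the dense
  group around it, the least ideal of a compact semigroup would only be a union of groups.\<close>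

theorem kernel_group:
  obtains L e where "closedin X L" "L \<subseteq> N" "e \<in> L"
    "\<And>h k. h \<in> L \<Longrightarrow> k \<in> L \<Longrightarrow> h \<cdot> k \<in> L"
    "\<And>h. h \<in> L \<Longrightarrow> e \<cdot> h = h" "\<And>h. h \<in> L \<Longrightarrow> h \<cdot> e = h"
    "\<And>h. h \<in> L \<Longrightarrow> \<exists>k\<in>L. k \<cdot> h = e \<and> h \<cdot> k = e"
    "\<And>x h. x \<in> N \<Longrightarrow> h \<in> L \<Longrightarrow> x \<cdot> h \<in> L"
    "\<And>s h. h \<in> L \<Longrightarrow> \<gamma> s \<cdot> h \<cdot> \<gamma> (- s) \<in> L"
proof -
  obtain L where L: "minimal_left_ideal L" by (rule minimal_left_ideal_exists)
  have LX: "h \<in> topspace X" if "h \<in> L" for h using that mli(3)[OF L] NX by auto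
  obtain e where e: "e \<in> L" "e \<cdot> e = e"
    using idempotent_exists[OF mli(1,2)[OF L]] mli(3,4)[OF L] by blast
  have right: "h \<cdot> e = h" if h: "h \<in> L" for h
  proof -
    obtain x where "x \<in> N" "h = x \<cdot> e" using mli(5)[OF L e(1) h] by blast
    then show ?thesis using e LX NX by (simp add: assoc)
  qed
  have inv: "\<exists>k\<in>L. k \<cdot> h = z" if h: "h \<in> L" "z \<in> L" for h z
  proof -
    have "e \<cdot> h \<in> L" using mli(3,4)[OF L] e h by blast
    then obtain x where x: "x \<in> N" "z = x \<cdot> (e \<cdot> h)" using mli(5)[OF L _ h(2)] by blast
    then have "(x \<cdot> e) \<cdot> h = z" using NX LX e h by (simp add: assoc)
    then show ?thesis using mli(4)[OF L x(1) e(1)] by blast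
  qed
  have left: "e \<cdot> h = h" if h: "h \<in> L" for h
  proof -
    obtain k where k: "k \<in> L" "k \<cdot> h = h" using inv[OF h h] by blast
    obtain f where "f \<in> L" "f \<cdot> f = f" "f \<cdot> h = h"
      using minimal_left_ideal_fixing_idempotent[OF L LX[OF h] k] by blast
    then show ?thesis using minimal_left_ideal_idempotents_eq[OF L e] by blast
  qed
  have two: "\<exists>k\<in>L. k \<cdot> h = e \<and> h \<cdot> k = e" if h: "h \<in> L" for h
  proof -
    obtain k where k: "k \<in> L" "k \<cdot> h = e" using inv[OF h e(1)] by blast
    obtain j where j: "j \<in> L" "j \<cdot> k = e" using inv[OF k(1) e(1)] by blast
    have "j = h" using assoc[OF LX[OF j(1)] LX[OF k(1)] LX[OF h]] j k left[OF h] right[OF j(1)] by simp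
    then show ?thesis using j k by blast
  qed
  have conj: "\<gamma> s \<cdot> h \<cdot> \<gamma> (- s) \<in> L" if h: "h \<in> L" for s h
  proof -
    let ?L = "(\<lambda>x. \<gamma> s \<cdot> x \<cdot> \<gamma> (- s)) ` L"
    have L': "minimal_left_ideal ?L" by (rule minimal_left_ideal_conj[OF L])
    have "e \<in> ?L" by (rule idempotent_in_every_minimal_left_ideal[OF L L' e])
    then have "?L = L" using L L' e(1) unfolding minimal_left_ideal_def by metis
    then show ?thesis using h by blast
  qed
  show thesis
    by (rule that[of L e]) (use mli[OF L] e left right two conj in auto)
qed

end

section \<open>Averaging over a group of operators with precompact orbits\<close>

text \<open>Hall's marriage theorem, by Rado's argument: an acceptability set with two elements can lose one
  of them without violating the counting condition.\<close>

lemma marriage: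
  assumes "finite A" "\<And>a. a \<in> A \<Longrightarrow> finite (N a)" "\<And>I. I \<subseteq> A \<Longrightarrow> card I \<le> card (\<Union>a\<in>I. N a)"
  shows "\<exists>f. inj_on f A \<and> (\<forall>a\<in>A. f a \<in> N a)"
  using assms(2,3)
proof (induction "\<Sum>a\<in>A. card (N a)" arbitrary: N rule: less_induct)
  case less
  note fin = less.prems(1) and hall = less.prems(2)
  show ?case
  proof (cases "\<exists>a\<in>A. \<exists>x\<in>N a. \<exists>y\<in>N a. x \<noteq> y")
    case False
    define f where "f a = (SOME y. y \<in> N a)" for a
    have f: "f a \<in> N a" if "a \<in> A" for a
      unfolding f_def some_in_eq using hall[of "{a}"] that by auto
    have N: "N a = {f a}" if "a \<in> A" for a using f[OF that] False that by blast
    have "inj_on f A"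
    proof (rule inj_onI, rule ccontr)
      fix a b assume ab: "a \<in> A" "b \<in> A" "f a = f b" "a \<noteq> b"
      then have "(\<Union>c\<in>{a, b}. N c) = {f a}" using N by auto
      then show False using hall[of "{a, b}"] ab by simp
    qed
    then show ?thesis using f by blast
  next
    case True
    then obtain a x y where a: "a \<in> A" "x \<in> N a" "y \<in> N a" "x \<noteq> y" by blast
    define N' where "N' z = N(a := N a - {z})" for z
    have finN': "finite (N' z c)" if "c \<in> A" for z c using fin that by (auto simp: N'_def)
    have "\<exists>z\<in>{x, y}. \<forall>I\<subseteq>A. card I \<le> card (\<Union>c\<in>I. N' z c)"
    proof (rule ccontr)
      assume "\<not> ?thesis"
      then obtain I J where I: "I \<subseteq> A" "card (\<Union>c\<in>I. N' x c) < card I"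
        and J: "J \<subseteq> A" "card (\<Union>c\<in>J. N' y c) < card J" by (auto simp: not_le)
      have aI: "a \<in> I" and aJ: "a \<in> J"
      proof -
        have "(\<Union>c\<in>K. N' z c) = (\<Union>c\<in>K. N c)" if "a \<notin> K" for K z
          using that by (auto simp: N'_def)
        then show "a \<in> I" "a \<in> J" using hall[OF I(1)] hall[OF J(1)] I(2) J(2) by (metis not_le)+
      qed
      define P Q where "P = (\<Union>c\<in>I. N' x c)" and "Q = (\<Union>c\<in>J. N' y c)"
      have fI: "finite I" "finite J" using I(1) J(1) \<open>finite A\<close> finite_subset by auto
      have fPQ: "finite P" "finite Q"
        unfolding P_def Q_def using fI I(1) J(1) finN' by (auto intro!: finite_UN_I)
      have N'a: "c \<noteq> a \<Longrightarrow> N' z c = N c" "N' z a = N a - {z}" for z c by (auto simp: N'_def)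
      have "(\<Union>c\<in>I \<union> J. N c) \<subseteq> P \<union> Q"
      proof
        fix w assume "w \<in> (\<Union>c\<in>I \<union> J. N c)"
        then obtain c where c: "c \<in> I \<union> J" "w \<in> N c" by blast
        show "w \<in> P \<union> Q"
        proof (cases "c = a")
          case True
          then have "w \<in> N' x a \<or> w \<in> N' y a" using c(2) a(4) by (auto simp: N'a(2))
          then show ?thesis using aI aJ unfolding P_def Q_def by blast
        next
          case False
          then have "w \<in> N' x c" "w \<in> N' y c" using c(2) by (simp_all add: N'a(1))
          then show ?thesis using c(1) unfolding P_def Q_def by blast
        qed
      qed
      then have 1: "card (I \<union> J) \<le> card (P \<union> Q)"
        using hall[of "I \<union> J"] I(1) J(1) card_mono[of "P \<union> Q"] fPQ by (metis Un_least finite_UnI order_trans)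
      have "w \<in> P \<inter> Q" if "c \<in> I \<inter> J - {a}" "w \<in> N c" for c w
      proof -
        have "w \<in> N' x c" "w \<in> N' y c" using that by (simp_all add: N'a(1))
        then show ?thesis using that(1) unfolding P_def Q_def by blast
      qed
      then have "(\<Union>c\<in>I \<inter> J - {a}. N c) \<subseteq> P \<inter> Q" by blast
      then have 2: "card (I \<inter> J - {a}) \<le> card (P \<inter> Q)"
        using hall[of "I \<inter> J - {a}"] I(1) card_mono[of "P \<inter> Q"] fPQ by (metis Diff_subset Int_lower1 finite_Int order_trans)
      have "card (I \<inter> J - {a}) = card (I \<inter> J) - 1" "0 < card (I \<inter> J)"
        using aI aJ fI by (auto simp: card_gt_0_iff)
      then have "card I + card J \<le> card P + card Q + 1"
        using 1 2 card_Un_Int[OF fI] card_Un_Int[OF fPQ] by linarith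
      then show False using I(2) J(2) unfolding P_def Q_def by linarith
    qed
    then obtain z where z: "z \<in> N a" "\<And>I. I \<subseteq> A \<Longrightarrow> card I \<le> card (\<Union>c\<in>I. N' z c)" using a by auto
    have "(\<Sum>c\<in>A. card (N' z c)) < (\<Sum>c\<in>A. card (N c))"
    proof (rule sum_strict_mono_ex1[OF \<open>finite A\<close>])
      show "\<forall>c\<in>A. card (N' z c) \<le> card (N c)" using fin by (auto simp: N'_def intro: card_mono)
      have "card (N' z a) < card (N a)"
        unfolding N'_def fun_upd_same by (rule card_Diff1_less[OF fin[OF a(1)] z(1)])
      then show "\<exists>c\<in>A. card (N' z c) < card (N c)" using a(1) by blast
    qed
    from less.hyps[OF this finN' z(2)] obtain f where "inj_on f A" "\<forall>c\<in>A. f c \<in> N' z c" by blast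
    then show ?thesis by (intro exI[of _ f]) (auto simp: N'_def split: if_splits)
  qed
qed

text \<open>If \<open>I \<subseteq> A\<close> had fewer than \<open>card I\<close> partners, replacing the partners by \<open>I\<close> would turn the image \<open>\<tau> ` A\<close>
  into a larger separated set; so the condition of the marriage theorem holds.\<close>

lemma maximal_separated_matching:
  assumes A: "finite A" "A \<subseteq> L" "pairwise (\<lambda>x y. \<not> R x y) A"
    and max: "\<And>B. B \<subseteq> L \<Longrightarrow> finite B \<Longrightarrow> pairwise (\<lambda>x y. \<not> R x y) B \<Longrightarrow> card B \<le> card A"
    and R: "\<And>x. x \<in> L \<Longrightarrow> R x x" "\<And>x y. R x y \<Longrightarrow> R y x"
    and \<tau>: "\<And>a. a \<in> A \<Longrightarrow> \<tau> a \<in> L" "\<And>a b. a \<in> A \<Longrightarrow> b \<in> A \<Longrightarrow> R (\<tau> a) (\<tau> b) \<Longrightarrow> a = b"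
  obtains f where "bij_betw f A A" "\<And>a. a \<in> A \<Longrightarrow> R a (\<tau> (f a))"
proof -
  define N where "N a = {b \<in> A. R a (\<tau> b)}" for a
  have "card I \<le> card (\<Union>a\<in>I. N a)" if I: "I \<subseteq> A" for I
  proof -
    define B where "B = (\<Union>a\<in>I. N a)"
    have BA: "B \<subseteq> A" by (auto simp: B_def N_def)
    have inj: "inj_on \<tau> A" using \<tau> R(1) by (metis inj_onI)
    have disj: "I \<inter> \<tau> ` (A - B) = {}"
    proof -
      have False if "b \<in> A - B" "\<tau> b \<in> I" for b
        using that R(1)[OF \<tau>(1)[of b]] by (auto simp: B_def N_def)
      then show ?thesis by blast
    qed
    have "pairwise (\<lambda>x y. \<not> R x y) (I \<union> \<tau> ` (A - B))"
    proof (rule pairwiseI)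
      fix x y assume xy: "x \<in> I \<union> \<tau> ` (A - B)" "y \<in> I \<union> \<tau> ` (A - B)" "x \<noteq> y"
      have mixed: "\<not> R u (\<tau> b)" if "u \<in> I" "b \<in> A - B" for u b
        using that I by (auto simp: B_def N_def)
      from xy(1,2) consider "x \<in> I" "y \<in> I" | "x \<in> I" "y \<in> \<tau> ` (A - B)" | "x \<in> \<tau> ` (A - B)" "y \<in> I"
        | "x \<in> \<tau> ` (A - B)" "y \<in> \<tau> ` (A - B)" by blast
      then show "\<not> R x y"
      proof cases
        case 1
        then show ?thesis using A(3) I xy(3) unfolding pairwise_def by blast
      next
        case 2
        then show ?thesis using mixed by blast
      next
        case 3
        then show ?thesis using mixed R(2) by blast
      next
        case 4
        then show ?thesis using \<tau>(2) xy(3) by blast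
      qed
    qed
    moreover have "I \<union> \<tau> ` (A - B) \<subseteq> L" using I A(2) \<tau>(1) by blast
    moreover have "finite (I \<union> \<tau> ` (A - B))" using A(1) I finite_subset by auto
    ultimately have "card (I \<union> \<tau> ` (A - B)) \<le> card A" by (intro max)
    moreover have "card (I \<union> \<tau> ` (A - B)) = card I + card (\<tau> ` (A - B))"
      using A(1) I disj finite_subset by (intro card_Un_disjoint) auto
    moreover have "card (\<tau> ` (A - B)) = card (A - B)"
      using inj by (intro card_image) (auto intro: inj_on_subset)
    moreover have "card (A - B) = card A - card B" "card B \<le> card A"
      using A(1) BA by (auto intro: card_Diff_subset finite_subset card_mono)
    ultimately show ?thesis by (simp add: B_def)
  qed
  then obtain f where f: "inj_on f A" "\<forall>a\<in>A. f a \<in> N a"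
    using marriage[OF A(1), of N] A(1) by (auto simp: N_def)
  have "f ` A = A"
    by (rule endo_inj_surj[OF A(1) _ f(1)]) (use f(2) in \<open>auto simp: N_def\<close>)
  then show thesis using f by (intro that[of f]) (auto simp: bij_betw_def N_def)
qed

definition average :: "('a \<Rightarrow> 'b::real_vector) set \<Rightarrow> 'a \<Rightarrow> 'b" where
  "average A x = (1 / real (card A)) *\<^sub>R (\<Sum>a\<in>A. a x)"

lemma average_diff_le:
  fixes f :: "'c \<Rightarrow> 'b::real_normed_vector"
  assumes A: "finite A" "A \<noteq> {}" and le: "\<And>a. a \<in> A \<Longrightarrow> norm (f a - g a) \<le> \<epsilon>"
  shows "norm ((1 / real (card A)) *\<^sub>R (\<Sum>a\<in>A. f a) - (1 / real (card A)) *\<^sub>R (\<Sum>a\<in>A. g a)) \<le> \<epsilon>"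
proof -
  have c: "0 < card A" using A by (simp add: card_gt_0_iff)
  have "norm (\<Sum>a\<in>A. f a - g a) \<le> real (card A) * \<epsilon>"
    using sum_norm_le[of A "\<lambda>a. f a - g a" "\<lambda>_. \<epsilon>"] le by simp
  then show ?thesis
    using c by (simp flip: scaleR_diff_right sum_subtractf) (simp add: field_simps)
qed

lemma eq_if_norm_diff_le:
  fixes u v :: "'b::real_normed_vector"
  assumes "\<And>\<epsilon>. 0 < \<epsilon> \<Longrightarrow> norm (u - v) \<le> D * \<epsilon>" "0 < D"
  shows "u = v"
proof (rule ccontr)
  assume "u \<noteq> v"
  then show False using assms(1)[of "norm (u - v) / (2 * D)"] assms(2) by simp
qed

lemma norm_sum_le3:
  fixes a b c :: "'b::real_normed_vector"
  assumes "x = a + b - c" "norm a \<le> \<alpha>" "norm b \<le> \<beta>" "norm c \<le> \<delta>"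
  shows "norm x \<le> \<alpha> + \<beta> + \<delta>"
  using norm_triangle_ineq4[of "a + b" c] norm_triangle_ineq[of a b] assms by simp

text \<open>The total boundedness of the group on each orbit is expressed by a colouring of \<open>L\<close> with finitely
  many colours, so that several orbits can be treated at once by combining colours. The unit \<open>e\<close> of
  \<open>L\<close> need not be the identity of \<open>V\<close>.\<close>

locale compact_operator_group =
  fixes V :: "'x::banach set" and L :: "('x \<Rightarrow> 'x) set" and e :: "'x \<Rightarrow> 'x" and C :: real
  assumes V: "subspace V" "closed V"
    and maps: "h \<in> L \<Longrightarrow> x \<in> V \<Longrightarrow> h x \<in> V"
    and add: "h \<in> L \<Longrightarrow> x \<in> V \<Longrightarrow> y \<in> V \<Longrightarrow> h (x + y) = h x + h y"
    and scale: "h \<in> L \<Longrightarrow> x \<in> V \<Longrightarrow> h (r *\<^sub>R x) = r *\<^sub>R h x"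
    and C: "1 \<le> C" and bound: "h \<in> L \<Longrightarrow> x \<in> V \<Longrightarrow> norm (h x) \<le> C * norm x"
    and e: "e \<in> L" and comp: "h \<in> L \<Longrightarrow> k \<in> L \<Longrightarrow> h \<circ> k \<in> L"
    and unit: "h \<in> L \<Longrightarrow> e \<circ> h = h" "h \<in> L \<Longrightarrow> h \<circ> e = h"
    and inverse: "h \<in> L \<Longrightarrow> \<exists>k\<in>L. k \<circ> h = e \<and> h \<circ> k = e"
    and precompact: "x \<in> V \<Longrightarrow> 0 < \<epsilon> \<Longrightarrow>
      \<exists>c::('x \<Rightarrow> 'x) \<Rightarrow> nat. finite (c ` L) \<and> (\<forall>h\<in>L. \<forall>k\<in>L. c h = c k \<longrightarrow> norm (h x - k x) \<le> \<epsilon>)"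
begin

lemma diff: "h \<in> L \<Longrightarrow> x \<in> V \<Longrightarrow> y \<in> V \<Longrightarrow> h (x - y) = h x - h y"
  using add[of h "x - y" y] V(1) by (simp add: subspace_diff)

lemma apply_sum: "finite A \<Longrightarrow> h \<in> L \<Longrightarrow> (\<And>a. a \<in> A \<Longrightarrow> f a \<in> V) \<Longrightarrow> h (\<Sum>a\<in>A. f a) = (\<Sum>a\<in>A. h (f a))"
proof (induction A rule: finite_induct)
  case empty
  then show ?case using scale[of h 0 0] V(1) by (simp add: subspace_0)
next
  case (insert a A)
  then show ?case using V(1) by (simp add: add subspace_sum)
qed

lemma average_mem: "A \<subseteq> L \<Longrightarrow> x \<in> V \<Longrightarrow> average A x \<in> V"
  unfolding average_def using V(1) maps by (intro subspace_scale subspace_sum) auto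

lemma apply_average:
  "h \<in> L \<Longrightarrow> A \<subseteq> L \<Longrightarrow> finite A \<Longrightarrow> x \<in> V \<Longrightarrow> h (average A x) = (1 / real (card A)) *\<^sub>R (\<Sum>a\<in>A. h (a x))"
  unfolding average_def using V(1) maps by (subst scale) (auto simp: apply_sum subspace_sum subset_iff)

lemma norm_average_le:
  assumes "A \<subseteq> L" "finite A" "A \<noteq> {}" "x \<in> V"
  shows "norm (average A x) \<le> C * norm x"
  using average_diff_le[of A "\<lambda>a. a x" "\<lambda>_. 0" "C * norm x"] assms bound
  by (auto simp: average_def subset_iff)

lemma precompact_finite:
  assumes "finite \<Xi>" "\<Xi> \<subseteq> V" "0 < \<epsilon>"
  shows "\<exists>c::('x \<Rightarrow> 'x) \<Rightarrow> nat. finite (c ` L) \<and> (\<forall>x\<in>\<Xi>. \<forall>h\<in>L. \<forall>k\<in>L. c h = c k \<longrightarrow> norm (h x - k x) \<le> \<epsilon>)"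
  using assms(1,2)
proof (induction \<Xi> rule: finite_induct)
  case empty
  have "finite ((\<lambda>_. 0::nat) ` L)" by (rule finite_subset[of _ "{0}"]) auto
  then show ?case by blast
next
  case (insert x \<Xi>)
  then obtain c where c: "finite (c ` L)" "\<forall>x\<in>\<Xi>. \<forall>h\<in>L. \<forall>k\<in>L. c h = (c k :: nat) \<longrightarrow> norm (h x - k x) \<le> \<epsilon>"
    by blast
  obtain d where d: "finite (d ` L)" "\<forall>h\<in>L. \<forall>k\<in>L. d h = (d k :: nat) \<longrightarrow> norm (h x - k x) \<le> \<epsilon>"
    using precompact[of x \<epsilon>] insert.prems assms(3) by blast
  have "(\<lambda>h. prod_encode (c h, d h)) ` L \<subseteq> prod_encode ` (c ` L \<times> d ` L)" by blast
  then have "finite ((\<lambda>h. prod_encode (c h, d h)) ` L)"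
    by (rule finite_subset) (use c(1) d(1) in simp)
  then show ?case using c(2) d(2) by (intro exI[of _ "\<lambda>h. prod_encode (c h, d h)"]) auto
qed

definition close where
  "close \<Xi> \<epsilon> h k \<longleftrightarrow> (\<forall>x\<in>\<Xi>. \<forall>u\<in>L. \<forall>v\<in>L. norm (u (h (v x)) - u (k (v x))) \<le> \<epsilon>)"

text \<open>Closeness asks for small distance after multiplication from both sides, so that left and right
  translations preserve it. The factors on the right are reduced to finitely many by
  precompactness, those on the left are absorbed by the bound \<open>C\<close>.\<close>

lemma close_colouring:
  assumes \<Xi>: "finite \<Xi>" "\<Xi> \<subseteq> V" "0 < \<epsilon>"
  obtains c :: "('x \<Rightarrow> 'x) \<Rightarrow> nat" where "finite (c ` L)" "\<And>h k. h \<in> L \<Longrightarrow> k \<in> L \<Longrightarrow> c h = c k \<Longrightarrow> close \<Xi> \<epsilon> h k"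
proof -
  \<comment> \<open>Three errors \<open>C \<delta>\<close>, \<open>\<delta>\<close>, \<open>C \<delta>\<close> arise, and applying the left factor multiplies them by \<open>C\<close>.\<close>
  define \<delta> where "\<delta> = \<epsilon> / (3 * C * C)"
  have \<delta>: "0 < \<delta>" "C * (2 * (C * \<delta>) + \<delta>) \<le> \<epsilon>"
  proof -
    show "0 < \<delta>" using \<Xi>(3) C by (simp add: \<delta>_def)
    then have "C * (2 * (C * \<delta>) + \<delta>) \<le> C * (2 * (C * \<delta>) + C * \<delta>)"
      using C by (intro mult_left_mono add_left_mono) auto
    also have "\<dots> = \<epsilon>" using C by (simp add: \<delta>_def field_simps)
    finally show "C * (2 * (C * \<delta>) + \<delta>) \<le> \<epsilon>" .
  qed
  obtain c where c: "finite (c ` L)" "\<forall>x\<in>\<Xi>. \<forall>h\<in>L. \<forall>k\<in>L. c h = (c k :: nat) \<longrightarrow> norm (h x - k x) \<le> \<delta>"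
    using precompact_finite[OF \<Xi>(1,2) \<delta>(1)] by blast
  obtain K where K: "K \<subseteq> L" "finite K" "c ` L = c ` K"
    using finite_subset_image[OF c(1) subset_refl] by blast
  have "finite ((\<lambda>(k, x). k x) ` (K \<times> \<Xi>))" "(\<lambda>(k, x). k x) ` (K \<times> \<Xi>) \<subseteq> V"
  proof -
    show "(\<lambda>(k, x). k x) ` (K \<times> \<Xi>) \<subseteq> V"
      using subsetD[OF K(1)] subsetD[OF \<Xi>(2)] maps by auto
  qed (use K \<Xi> in simp)
  from precompact_finite[OF this \<delta>(1)]
  obtain d where d: "finite (d ` L)"
    "\<And>v x h k. v \<in> K \<Longrightarrow> x \<in> \<Xi> \<Longrightarrow> h \<in> L \<Longrightarrow> k \<in> L \<Longrightarrow> d h = (d k :: nat) \<Longrightarrow> norm (h (v x) - k (v x)) \<le> \<delta>"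
    by fastforce
  show thesis
  proof (rule that[OF d(1)])
    fix h k assume h: "h \<in> L" and k: "k \<in> L" and eq: "d h = d k"
    show "close \<Xi> \<epsilon> h k"
      unfolding close_def
    proof (intro ballI)
      fix x u v assume x: "x \<in> \<Xi>" and u: "u \<in> L" and v: "v \<in> L"
      have xV: "x \<in> V" using x \<Xi> by auto
      from v have "c v \<in> c ` K" using K by blast
      then obtain w where w: "w \<in> K" "w \<in> L" "c v = c w" using K by auto
      have vw: "norm (v x - w x) \<le> \<delta>" using c(2) x v w by blast
      have V': "v x \<in> V" "w x \<in> V" using maps xV v w by auto
      have "norm (h (v x) - h (w x)) \<le> C * \<delta>" if "h \<in> L" for h
        using bound[OF that, of "v x - w x"] V' V(1) vw C diff[OF that V']
        by (smt (verit, best) mult_left_mono subspace_diff)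
      note hw = this[OF h] this[OF k]
      have "norm (h (v x) - k (v x)) \<le> C * \<delta> + \<delta> + C * \<delta>"
        by (rule norm_sum_le3[OF _ hw(1) d(2)[OF w(1) x h k eq] hw(2)]) simp
      then have n: "norm (h (v x) - k (v x)) \<le> 2 * (C * \<delta>) + \<delta>" by simp
      have "norm (u (h (v x)) - u (k (v x))) = norm (u (h (v x) - k (v x)))"
        using u h k V' maps by (simp add: diff)
      also have "\<dots> \<le> C * norm (h (v x) - k (v x))"
        using u h k V' maps V(1) by (intro bound) (auto intro: subspace_diff)
      also have "\<dots> \<le> C * (2 * (C * \<delta>) + \<delta>)" using n C by (intro mult_left_mono) auto
      finally show "norm (u (h (v x)) - u (k (v x))) \<le> \<epsilon>" using \<delta>(2) by linarith
    qed
  qed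
qed

definition good where
  "good \<epsilon> A x \<longleftrightarrow> finite A \<and> A \<noteq> {} \<and> A \<subseteq> L \<and>
     (\<forall>h\<in>L. norm (h (average A x) - average A x) \<le> \<epsilon> \<and> norm (average A (h x) - average A x) \<le> \<epsilon>)"

text \<open>The uniform average over a separated set of maximal size: its left and right translates are also
  separated sets of maximal size, and by the marriage theorem such sets can be matched up to \<open>\<epsilon>\<close>.\<close>

lemma good_exists:
  assumes \<Xi>: "finite \<Xi>" "\<Xi> \<subseteq> V" "0 < \<epsilon>"
  obtains A where "\<And>x. x \<in> \<Xi> \<Longrightarrow> good \<epsilon> A x" "finite A" "A \<noteq> {}" "A \<subseteq> L"
proof -
  obtain c :: "('x \<Rightarrow> 'x) \<Rightarrow> nat" where c: "finite (c ` L)" "\<And>h k. h \<in> L \<Longrightarrow> k \<in> L \<Longrightarrow> c h = c k \<Longrightarrow> close \<Xi> \<epsilon> h k"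
    by (rule close_colouring[OF \<Xi>]) blast
  define sep where "sep B \<longleftrightarrow> B \<subseteq> L \<and> finite B \<and> pairwise (\<lambda>x y. \<not> close \<Xi> \<epsilon> x y) B" for B
  have "card B \<le> card (c ` L)" if "sep B" for B
  proof -
    have "inj_on c B" using that c(2) unfolding sep_def pairwise_def inj_on_def by blast
    then have "card B = card (c ` B)" by (simp add: card_image)
    also have "\<dots> \<le> card (c ` L)" using that c(1) by (intro card_mono) (auto simp: sep_def)
    finally show ?thesis .
  qed
  moreover have "sep {e}" using e by (simp add: sep_def)
  ultimately obtain A where A: "sep A" "\<And>B. sep B \<Longrightarrow> card B \<le> card A"
    using ex_has_greatest_nat[of sep "{e}" card "Suc (card (c ` L))"] by (metis le_imp_less_Suc)
  have "card A \<ge> 1" using A(2)[OF \<open>sep {e}\<close>] by simp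
  then have A0: "A \<noteq> {}" by auto
  have fA: "finite A" and AL: "A \<subseteq> L" and pA: "pairwise (\<lambda>x y. \<not> close \<Xi> \<epsilon> x y) A"
    using A(1) by (auto simp: sep_def)
  have refl: "close \<Xi> \<epsilon> h h" for h using \<Xi>(3) by (simp add: close_def)
  have sym: "close \<Xi> \<epsilon> h k \<Longrightarrow> close \<Xi> \<epsilon> k h" for h k by (simp add: close_def norm_minus_commute)
  have eV: "h (e x) = h x" "e (h x) = h x" if "h \<in> L" for h x using unit[OF that] by (metis o_apply)+
  have match: "\<exists>f. bij_betw f A A \<and> (\<forall>a\<in>A. close \<Xi> \<epsilon> a (\<tau> (f a)))"
    if "\<And>a. a \<in> A \<Longrightarrow> \<tau> a \<in> L" "\<And>a b. a \<in> A \<Longrightarrow> b \<in> A \<Longrightarrow> close \<Xi> \<epsilon> (\<tau> a) (\<tau> b) \<Longrightarrow> close \<Xi> \<epsilon> a b" for \<tau>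
  proof (rule maximal_separated_matching[of A L "close \<Xi> \<epsilon>" \<tau>])
    show "a = b" if "a \<in> A" "b \<in> A" "close \<Xi> \<epsilon> (\<tau> a) (\<tau> b)" for a b
      using pA that \<open>\<And>a b. a \<in> A \<Longrightarrow> b \<in> A \<Longrightarrow> close \<Xi> \<epsilon> (\<tau> a) (\<tau> b) \<Longrightarrow> close \<Xi> \<epsilon> a b\<close>[OF that]
      unfolding pairwise_def by blast
  qed (use fA AL pA A(2) refl sym that(1) in \<open>auto simp: sep_def\<close>)
  have "good \<epsilon> A x" if x: "x \<in> \<Xi>" for x
  proof -
    have xV: "x \<in> V" using x \<Xi> by auto
    have "norm (h (average A x) - average A x) \<le> \<epsilon> \<and> norm (average A (h x) - average A x) \<le> \<epsilon>"
      if h: "h \<in> L" for h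
    proof -
      obtain k where k: "k \<in> L" "k \<circ> h = e" "h \<circ> k = e" using inverse[OF h] by blast
      have kh: "k (h y) = e y" "h (k y) = e y" for y using k(2,3) by (metis o_apply)+
      obtain f where f: "bij_betw f A A" "\<forall>a\<in>A. close \<Xi> \<epsilon> a (h \<circ> f a)"
      proof -
        have "close \<Xi> \<epsilon> a b" if "a \<in> A" "b \<in> A" "close \<Xi> \<epsilon> (h \<circ> a) (h \<circ> b)" for a b
          unfolding close_def
        proof (intro ballI)
          fix y u v assume "y \<in> \<Xi>" "u \<in> L" "v \<in> L"
          then have "norm ((u \<circ> k) ((h \<circ> a) (v y)) - (u \<circ> k) ((h \<circ> b) (v y))) \<le> \<epsilon>"
            using that(3) comp k(1) unfolding close_def by blast
          then show "norm (u (a (v y)) - u (b (v y))) \<le> \<epsilon>"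
            using that AL \<open>u \<in> L\<close> by (simp add: kh eV subset_iff)
        qed
        then show thesis using match[of "\<lambda>a. h \<circ> a"] AL comp h that by blast
      qed
      obtain g where g: "bij_betw g A A" "\<forall>a\<in>A. close \<Xi> \<epsilon> a (g a \<circ> h)"
      proof -
        have "close \<Xi> \<epsilon> a b" if "a \<in> A" "b \<in> A" "close \<Xi> \<epsilon> (a \<circ> h) (b \<circ> h)" for a b
          unfolding close_def
        proof (intro ballI)
          fix y u v assume "y \<in> \<Xi>" "u \<in> L" "v \<in> L"
          then have "norm (u ((a \<circ> h) ((k \<circ> v) y)) - u ((b \<circ> h) ((k \<circ> v) y))) \<le> \<epsilon>"
            using that(3) comp k(1) unfolding close_def by blast
          then show "norm (u (a (v y)) - u (b (v y))) \<le> \<epsilon>"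
            using \<open>v \<in> L\<close> by (simp add: kh eV)
        qed
        then show thesis using match[of "\<lambda>a. a \<circ> h"] AL comp h that by blast
      qed
      have near: "norm (a x - b x) \<le> \<epsilon>" if "a \<in> L" "b \<in> L" "close \<Xi> \<epsilon> a b" for a b
      proof -
        have "norm (e (a (e x)) - e (b (e x))) \<le> \<epsilon>" using that(3) x e unfolding close_def by blast
        then show ?thesis using that(1,2) by (simp add: eV)
      qed
      have fA': "f a \<in> L" "g a \<in> L" if "a \<in> A" for a
        using that f(1) g(1) AL bij_betwE by blast+
      have 1: "h (average A x) = (1 / real (card A)) *\<^sub>R (\<Sum>a\<in>A. h (f a x))"
        using apply_average[OF h AL fA xV] sum.reindex_bij_betw[OF f(1), of "\<lambda>a. h (a x)"] by simp
      have 2: "average A (h x) = (1 / real (card A)) *\<^sub>R (\<Sum>a\<in>A. g a (h x))"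
        unfolding average_def using sum.reindex_bij_betw[OF g(1), of "\<lambda>a. a (h x)"] by simp
      have n1: "norm (h (f a x) - a x) \<le> \<epsilon>" and n2: "norm (g a (h x) - a x) \<le> \<epsilon>" if a: "a \<in> A" for a
      proof -
        have aL: "a \<in> L" using a AL by auto
        show "norm (h (f a x) - a x) \<le> \<epsilon>"
          using near[OF aL comp[OF h fA'(1)[OF a]]] f(2) a by (simp add: norm_minus_commute)
        show "norm (g a (h x) - a x) \<le> \<epsilon>"
          using near[OF aL comp[OF fA'(2)[OF a] h]] g(2) a by (simp add: norm_minus_commute)
      qed
      have "norm (h (average A x) - average A x) \<le> \<epsilon>"
        unfolding 1 unfolding average_def by (rule average_diff_le[OF fA A0 n1])
      moreover have "norm (average A (h x) - average A x) \<le> \<epsilon>"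
        unfolding 2 unfolding average_def by (rule average_diff_le[OF fA A0 n2])
      ultimately show ?thesis by blast
    qed
    then show ?thesis using fA A0 AL by (simp add: good_def)
  qed
  then show thesis using that fA A0 AL by blast
qed

text \<open>Compare both averages with the double average \<open>average A (average B x)\<close>: left invariance of \<open>B\<close> gives
  one estimate, right invariance of \<open>A\<close> the other.\<close>

lemma good_close:
  assumes A: "good \<epsilon> A x" and B: "good \<delta> B x" and x: "x \<in> V"
  shows "norm (average A x - average B x) \<le> \<epsilon> + \<delta>"
proof -
  have A': "finite A" "A \<noteq> {}" "A \<subseteq> L" and B': "finite B" "B \<noteq> {}" "B \<subseteq> L"
    using A B by (auto simp: good_def)
  have c: "card A > 0" "card B > 0" using A' B' by (auto simp: card_gt_0_iff)
  have const: "(1 / real (card D)) *\<^sub>R (\<Sum>a\<in>D. y) = y" if "card D > 0" for D :: "('x \<Rightarrow> 'x) set" and y :: 'x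
    using that by (simp add: scaleR_sum_left[symmetric] sum_constant_scaleR)
  have "norm (average A (average B x) - average B x) \<le> \<delta>"
    using average_diff_le[of A "\<lambda>a. a (average B x)" "\<lambda>_. average B x" \<delta>] A' B const[OF c(1)]
    by (auto simp: average_def[of A] good_def)
  moreover have "norm (average A (average B x) - average A x) \<le> \<epsilon>"
  proof -
    have "average A (average B x) = (1 / real (card A)) *\<^sub>R (\<Sum>a\<in>A. (1 / real (card B)) *\<^sub>R (\<Sum>b\<in>B. a (b x)))"
      unfolding average_def[of A "average B x"] using A' B' x
      by (intro arg_cong[where f = "\<lambda>y. (1 / real (card A)) *\<^sub>R y"] sum.cong refl apply_average) auto
    also have "\<dots> = (1 / real (card B)) *\<^sub>R (\<Sum>b\<in>B. average A (b x))"
      unfolding average_def scaleR_sum_right[symmetric] by (subst sum.swap) (simp add: mult.commute)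
    finally have eq: "average A (average B x) = (1 / real (card B)) *\<^sub>R (\<Sum>b\<in>B. average A (b x))" .
    show ?thesis
      using average_diff_le[of B "\<lambda>b. average A (b x)" "\<lambda>_. average A x" \<epsilon>] B' A const[OF c(2)]
      unfolding eq by (auto simp: good_def)
  qed
  ultimately show ?thesis
    using norm_triangle_ineq4[of "average A (average B x) - average B x" "average A (average B x) - average A x"]
    by simp
qed

lemma limit_exists:
  assumes x: "x \<in> V"
  shows "\<exists>y\<in>V. \<forall>\<epsilon> A. good \<epsilon> A x \<longrightarrow> norm (average A x - y) \<le> \<epsilon>"
proof -
  have "\<exists>A. good (1 / real (Suc n)) A x" for n
    using good_exists[of "{x}" "1 / real (Suc n)"] x by auto
  then obtain A where A: "\<And>n. good (1 / real (Suc n)) (A n) x" by metis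
  have inv0: "(\<lambda>n. 1 / real (Suc n)) \<longlonglongrightarrow> 0" using LIMSEQ_inverse_real_of_nat by (simp add: inverse_eq_divide)
  have "Cauchy (\<lambda>n. average (A n) x)"
  proof (rule CauchyI)
    fix \<epsilon> :: real assume \<epsilon>: "0 < \<epsilon>"
    obtain N where N: "1 / real (Suc N) < \<epsilon> / 2" using nat_approx_posE[of "\<epsilon> / 2"] \<epsilon> by auto
    have "norm (average (A m) x - average (A n) x) < \<epsilon>" if "N \<le> m" "N \<le> n" for m n
    proof -
      have "1 / real (Suc m) \<le> 1 / real (Suc N)" "1 / real (Suc n) \<le> 1 / real (Suc N)"
        using that by (auto intro!: divide_left_mono)
      then show ?thesis using good_close[OF A[of m] A[of n] x] N by linarith
    qed
    then show "\<exists>M. \<forall>m\<ge>M. \<forall>n\<ge>M. norm (average (A m) x - average (A n) x) < \<epsilon>" by blast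
  qed
  then obtain y where y: "(\<lambda>n. average (A n) x) \<longlonglongrightarrow> y" using Cauchy_convergent convergent_def by blast
  have "y \<in> V"
    using closed_sequentially[OF V(2) _ y] average_mem[OF _ x] A by (auto simp: good_def)
  moreover have "norm (average B x - y) \<le> \<epsilon>" if B: "good \<epsilon> B x" for \<epsilon> B
  proof (rule LIMSEQ_le)
    show "(\<lambda>n. norm (average B x - average (A n) x)) \<longlonglongrightarrow> norm (average B x - y)"
      by (intro tendsto_intros y)
    show "(\<lambda>n. \<epsilon> + 1 / real (Suc n)) \<longlonglongrightarrow> \<epsilon>" using tendsto_add[OF tendsto_const[of \<epsilon>] inv0] by simp
    show "\<exists>N. \<forall>n\<ge>N. norm (average B x - average (A n) x) \<le> \<epsilon> + 1 / real (Suc n)"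
      using good_close[OF B A x] by blast
  qed
  ultimately show ?thesis by blast
qed

text \<open>The limit of the almost invariant averages plays the role of the Haar integral \<open>\<integral> h x dh\<close>. Additivity
  holds because one average can be almost invariant at finitely many vectors at once.\<close>

lemma mean_exists:
  obtains M where "\<And>x. x \<in> V \<Longrightarrow> M x \<in> V"
    "\<And>x y. x \<in> V \<Longrightarrow> y \<in> V \<Longrightarrow> M (x + y) = M x + M y"
    "\<And>x. x \<in> V \<Longrightarrow> norm (M x) \<le> C * norm x"
    "\<And>h x. h \<in> L \<Longrightarrow> x \<in> V \<Longrightarrow> h (M x) = M x" "\<And>h x. h \<in> L \<Longrightarrow> x \<in> V \<Longrightarrow> M (h x) = M x"
    "\<And>\<Xi> \<epsilon>. finite \<Xi> \<Longrightarrow> \<Xi> \<subseteq> V \<Longrightarrow> 0 < \<epsilon> \<Longrightarrow>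
       \<exists>A. finite A \<and> A \<noteq> {} \<and> A \<subseteq> L \<and> (\<forall>x\<in>\<Xi>. norm (M x - average A x) \<le> \<epsilon>)"
proof -
  obtain M where M: "\<And>x. x \<in> V \<Longrightarrow> M x \<in> V"
    "\<And>x \<epsilon> A. x \<in> V \<Longrightarrow> good \<epsilon> A x \<Longrightarrow> norm (average A x - M x) \<le> \<epsilon>"
    using limit_exists by metis
  have approx: "\<exists>A. finite A \<and> A \<noteq> {} \<and> A \<subseteq> L \<and> (\<forall>x\<in>\<Xi>. good \<epsilon> A x \<and> norm (M x - average A x) \<le> \<epsilon>)"
    if \<Xi>: "finite \<Xi>" "\<Xi> \<subseteq> V" "0 < \<epsilon>" for \<Xi> \<epsilon>
  proof -
    obtain A where A: "\<And>x. x \<in> \<Xi> \<Longrightarrow> good \<epsilon> A x" "finite A" "A \<noteq> {}" "A \<subseteq> L"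
      by (rule good_exists[OF \<Xi>]) blast
    moreover have "norm (M x - average A x) \<le> \<epsilon>" if "x \<in> \<Xi>" for x
      using M(2)[OF _ A(1)[OF that]] that \<Xi>(2) by (auto simp: norm_minus_commute)
    ultimately show ?thesis by blast
  qed
  have add: "M (x + y) = M x + M y" if xy: "x \<in> V" "y \<in> V" for x y
  proof (rule eq_if_norm_diff_le[where D = 3])
    fix \<epsilon> :: real assume "0 < \<epsilon>"
    moreover have "{x, y, x + y} \<subseteq> V" using xy V(1) by (simp add: subspace_add)
    ultimately obtain A where A: "A \<subseteq> L" "\<forall>z\<in>{x, y, x + y}. norm (M z - average A z) \<le> \<epsilon>"
      using approx[of "{x, y, x + y}" \<epsilon>] by blast
    have av: "average A (x + y) = average A x + average A y"
      unfolding average_def scaleR_add_right[symmetric] sum.distrib[symmetric]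
      using A(1) xy by (intro arg_cong[where f = "\<lambda>y. (1 / real (card A)) *\<^sub>R y"] sum.cong refl add) auto
    have n: "norm (M x - average A x) \<le> \<epsilon>" "norm (M y - average A y) \<le> \<epsilon>" "norm (M (x + y) - average A (x + y)) \<le> \<epsilon>"
      using A(2) by auto
    have "norm (M (x + y) - (M x + M y)) \<le> \<epsilon> + \<epsilon> + \<epsilon>"
      by (rule norm_sum_le3[of _ "M (x + y) - average A (x + y)" "average A x - M x" "M y - average A y"])
         (use n in \<open>simp_all add: av norm_minus_commute\<close>)
    then show "norm (M (x + y) - (M x + M y)) \<le> 3 * \<epsilon>" by simp
  qed simp
  have bnd: "norm (M x) \<le> C * norm x" if x: "x \<in> V" for x
  proof (rule field_le_epsilon)
    fix \<epsilon> :: real assume "0 < \<epsilon>"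
    then obtain A where A: "finite A" "A \<noteq> {}" "A \<subseteq> L" "norm (M x - average A x) \<le> \<epsilon>"
      using approx[of "{x}" \<epsilon>] x by auto
    show "norm (M x) \<le> C * norm x + \<epsilon>"
      using norm_triangle_sub[of "M x" "average A x"] norm_average_le[OF A(3,1,2) x] A(4) by linarith
  qed
  have hM: "h (M x) = M x" if h: "h \<in> L" and x: "x \<in> V" for h x
  proof (rule eq_if_norm_diff_le[where D = "C + 2"])
    fix \<epsilon> :: real assume "0 < \<epsilon>"
    then obtain A where A: "A \<subseteq> L" "good \<epsilon> A x" "norm (M x - average A x) \<le> \<epsilon>"
      using approx[of "{x}" \<epsilon>] x by auto
    have aV: "average A x \<in> V" by (rule average_mem[OF A(1) x])
    have "norm (h (M x) - h (average A x)) \<le> C * norm (M x - average A x)"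
      using bound[OF h, of "M x - average A x"] diff[OF h M(1)[OF x] aV] V(1) M(1)[OF x] aV
      by (simp add: subspace_diff)
    also have "\<dots> \<le> C * \<epsilon>" using A(3) C by (intro mult_left_mono) auto
    finally have 1: "norm (h (M x) - h (average A x)) \<le> C * \<epsilon>" .
    have 2: "norm (h (average A x) - average A x) \<le> \<epsilon>" using A(2) h by (simp add: good_def)
    have "norm (h (M x) - M x) \<le> C * \<epsilon> + \<epsilon> + \<epsilon>"
      by (rule norm_sum_le3[OF _ 1 2 A(3)]) simp
    then show "norm (h (M x) - M x) \<le> (C + 2) * \<epsilon>" by (simp add: algebra_simps)
  qed (use C in simp)
  have Mh: "M (h x) = M x" if h: "h \<in> L" and x: "x \<in> V" for h x
  proof (rule eq_if_norm_diff_le[where D = 3])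
    fix \<epsilon> :: real assume "0 < \<epsilon>"
    moreover have "{x, h x} \<subseteq> V" using x h maps by simp
    ultimately obtain A where A: "\<forall>z\<in>{x, h x}. good \<epsilon> A z \<and> norm (M z - average A z) \<le> \<epsilon>"
      using approx[of "{x, h x}" \<epsilon>] by blast
    have 2: "norm (average A (h x) - average A x) \<le> \<epsilon>" using A h by (simp add: good_def)
    have "norm (M (h x) - M x) \<le> \<epsilon> + \<epsilon> + \<epsilon>"
      by (rule norm_sum_le3[of _ "M (h x) - average A (h x)" "average A (h x) - average A x" "M x - average A x"])
         (use 2 A in simp_all)
    then show "norm (M (h x) - M x) \<le> 3 * \<epsilon>" by simp
  qed simp
  show thesis
  proof (rule that[of M])
    show "M x \<in> V" if "x \<in> V" for x using that by (rule M(1))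
    show "M (x + y) = M x + M y" if "x \<in> V" "y \<in> V" for x y using that by (rule add)
    show "norm (M x) \<le> C * norm x" if "x \<in> V" for x using that by (rule bnd)
    show "h (M x) = M x" "M (h x) = M x" if "h \<in> L" "x \<in> V" for h x using that by (rule hM, rule Mh)
  next
    fix \<Xi> :: "'x set" and \<epsilon> :: real assume "finite \<Xi>" "\<Xi> \<subseteq> V" "0 < \<epsilon>"
    from approx[OF this] show "\<exists>A. finite A \<and> A \<noteq> {} \<and> A \<subseteq> L \<and> (\<forall>x\<in>\<Xi>. norm (M x - average A x) \<le> \<epsilon>)"
      by blast
  qed
qed

end

section \<open>Weakly almost periodic vectors of a bounded group of operators\<close>

text \<open>The topology of pointwise weak convergence; on bounded operators it is the weak operator topology.\<close>

abbreviation pw :: "('i \<Rightarrow> 'x::complex_normed_vector) topology" where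
  "pw \<equiv> product_topology (\<lambda>_. weak_topology) UNIV"

lemma topspace_pw [simp]: "topspace pw = UNIV"
  by auto

lemma continuous_map_into_pw: "(\<And>x. continuous_map X weak_topology (\<lambda>t. f t x)) \<Longrightarrow> continuous_map X pw f"
  by (simp add: continuous_map_componentwise_UNIV)

lemma continuous_map_pw_eval: "continuous_map pw weak_topology (\<lambda>f. f x)"
  by (rule continuous_map_product_coordinates) simp

lemma Hausdorff_pw: "Hausdorff_space pw"
  by (simp add: Hausdorff_space_product_topology Hausdorff_weak)

lemma continuous_map_weak_add:
  assumes "continuous_map X weak_topology f" "continuous_map X weak_topology g"
  shows "continuous_map X weak_topology (\<lambda>t. f t + g t)"
proof (rule continuous_map_into_weak)
  fix \<psi> :: "'b \<Rightarrow> real" assume \<psi>: "bounded_linear \<psi>"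
  have "continuous_map X euclideanreal (\<lambda>t. \<psi> (f t) + \<psi> (g t))"
    by (intro continuous_intros continuous_map_weak_compose[OF _ \<psi>] assms)
  then show "continuous_map X euclideanreal (\<lambda>t. \<psi> (f t + g t))"
    using \<psi> by (simp add: bounded_linear.linear linear_add)
qed

lemma continuous_map_weak_linear_compose:
  assumes "continuous_map X weak_topology f" "bounded_linear T"
  shows "continuous_map X weak_topology (\<lambda>t. T (f t))"
  using continuous_map_compose[OF assms(1) bounded_linear_weakly_continuous[OF assms(2)]] by (simp add: o_def)

lemma continuous_map_weak_diff:
  assumes "continuous_map X weak_topology f" "continuous_map X weak_topology g"
  shows "continuous_map X weak_topology (\<lambda>t. f t - g t)"
  using continuous_map_weak_add[OF assms(1) continuous_map_weak_linear_compose[OF assms(2), of uminus]]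
  by (simp add: bounded_linear_minus[OF bounded_linear_ident])

lemma csubspace_imp_subspace:
  assumes "csubspace V"
  shows "subspace V"
  unfolding subspace_def
proof (intro conjI ballI allI)
  show "c *\<^sub>R x \<in> V" if "x \<in> V" for c x
    using assms that by (simp add: csubspace_def flip: scaleC_of_real)
qed (use assms in \<open>auto simp: csubspace_def\<close>)

lemma continuous_map_uniform_limit_real:
  assumes f: "\<And>n::nat. continuous_map X euclideanreal (f n)"
    and lim: "\<And>n x. x \<in> topspace X \<Longrightarrow> \<bar>f n x - g x\<bar> \<le> c n" and c: "c \<longlonglongrightarrow> 0"
  shows "continuous_map X euclideanreal g"
proof -
  have "continuous_map X Met_TC.mtopology g"
  proof (rule Met_TC.continuous_map_uniform_limit[where F = sequentially])
    fix \<epsilon> :: real assume "0 < \<epsilon>"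
    then have "\<forall>\<^sub>F n in sequentially. c n < \<epsilon>" using c by (rule order_tendstoD(2)[rotated])
    then show "\<forall>\<^sub>F n in sequentially. \<forall>x\<in>topspace X. g x \<in> UNIV \<and> dist (f n x) (g x) < \<epsilon>"
      by eventually_elim (use lim in \<open>fastforce simp: dist_real_def intro: le_less_trans\<close>)
  qed (use f in auto)
  then show ?thesis by simp
qed

text \<open>An action of the discrete group; the topology of the group enters only through the neighbourhoods
  of \<open>0\<close>.\<close>

locale bounded_action =
  fixes \<rho> :: "'g::topological_group_add \<Rightarrow> 'x::complex_banach \<Rightarrow> 'x" and C :: real
  assumes clinear: "bounded_clinear (\<rho> s)"
    and act_add: "\<rho> (s + t) x = \<rho> s (\<rho> t x)" and act_zero: "\<rho> 0 x = x"
    and C: "1 \<le> C" and act_bound: "norm (\<rho> s x) \<le> C * norm x"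
begin

lemma linear_act: "bounded_linear (\<rho> s)"
  using clinear by (simp add: bounded_clinear_def)

lemmas act_simps =
  linear_add[OF bounded_linear.linear[OF linear_act]]
  linear_0[OF bounded_linear.linear[OF linear_act]]
  linear_diff[OF bounded_linear.linear[OF linear_act]]

lemma act_scaleC: "\<rho> s (a *\<^sub>C x) = a *\<^sub>C \<rho> s x"
  using clinear by (simp add: bounded_clinear_def)

lemma act_cancel: "\<rho> (- s) (\<rho> s x) = x" "\<rho> s (\<rho> (- s) x) = x"
  by (simp_all add: act_zero flip: act_add)

definition orbit :: "'x \<Rightarrow> 'x set" where
  "orbit x = range (\<lambda>s. \<rho> s x)"

definition orbit_closure :: "'x \<Rightarrow> 'x set" where
  "orbit_closure x = weak_topology closure_of orbit x"

definition wap :: "'x set" where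
  "wap = {x. compactin weak_topology (orbit_closure x)}"

lemma wapI:
  assumes "compactin weak_topology Q" "orbit x \<subseteq> Q"
  shows "x \<in> wap" "orbit_closure x \<subseteq> Q"
proof -
  have "closedin weak_topology Q" by (rule compactin_imp_closedin[OF Hausdorff_weak assms(1)])
  then show sub: "orbit_closure x \<subseteq> Q" unfolding orbit_closure_def using assms(2) by (intro closure_of_minimal)
  have "compactin weak_topology (orbit_closure x)"
    by (rule closed_compactin[OF assms(1) sub]) (simp add: orbit_closure_def)
  then show "x \<in> wap" by (simp add: wap_def)
qed

lemma compact_orbit_closure: "x \<in> wap \<Longrightarrow> compactin weak_topology (orbit_closure x)"
  by (simp add: wap_def)

lemma orbit_subset_orbit_closure: "orbit x \<subseteq> orbit_closure x"
  unfolding orbit_closure_def by (rule closure_of_subset) simp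

lemma act_in_orbit_closure: "\<rho> s x \<in> orbit_closure x"
  using orbit_subset_orbit_closure by (auto simp: orbit_def)

lemma act_orbit_closure: "y \<in> orbit_closure x \<Longrightarrow> \<rho> s y \<in> orbit_closure x"
proof -
  assume "y \<in> orbit_closure x"
  then have "\<rho> s y \<in> weak_topology closure_of \<rho> s ` orbit x"
    using continuous_map_image_closure_subset[OF bounded_linear_weakly_continuous[OF linear_act]]
    unfolding orbit_closure_def by blast
  moreover have "\<rho> s ` orbit x \<subseteq> orbit x" by (auto simp: orbit_def simp flip: act_add)
  ultimately show ?thesis unfolding orbit_closure_def using closure_of_mono by blast
qed

lemma orbit_closure_subset_wap:
  assumes "x \<in> wap"
  shows "orbit_closure x \<subseteq> wap"
proof
  fix y assume "y \<in> orbit_closure x"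
  then have "orbit y \<subseteq> orbit_closure x" by (auto simp: orbit_def act_orbit_closure)
  then show "y \<in> wap" using compact_orbit_closure[OF assms] by (rule wapI(1)[rotated])
qed

lemma act_wap: "x \<in> wap \<Longrightarrow> \<rho> s x \<in> wap"
  using orbit_closure_subset_wap act_in_orbit_closure by blast

lemma wap_linear_image:
  assumes x: "x \<in> wap" and T: "bounded_linear T" and comm: "\<And>s y. \<rho> s (T y) = T (\<rho> s y)"
  shows "T x \<in> wap"
proof (rule wapI(1))
  show "compactin weak_topology (T ` orbit_closure x)"
    by (rule image_compactin[OF compact_orbit_closure[OF x] bounded_linear_weakly_continuous[OF T]])
  show "orbit (T x) \<subseteq> T ` orbit_closure x" using act_in_orbit_closure by (auto simp: orbit_def comm)
qed

lemma wap_add: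
  assumes x: "x \<in> wap" and y: "y \<in> wap"
  shows "x + y \<in> wap"
proof (rule wapI(1))
  have "compactin (prod_topology weak_topology weak_topology) (orbit_closure x \<times> orbit_closure y)"
    using compact_orbit_closure[OF x] compact_orbit_closure[OF y] by (simp add: compactin_Times)
  moreover have "continuous_map (prod_topology weak_topology weak_topology) weak_topology (\<lambda>p. fst p + snd p :: 'x)"
    by (intro continuous_map_weak_add continuous_map_fst continuous_map_snd)
  ultimately show "compactin weak_topology ((\<lambda>p. fst p + snd p) ` (orbit_closure x \<times> orbit_closure y))"
    by (rule image_compactin)
  show "orbit (x + y) \<subseteq> (\<lambda>p. fst p + snd p) ` (orbit_closure x \<times> orbit_closure y)"
    using act_in_orbit_closure by (force simp: orbit_def act_simps)
qed

lemma csubspace_wap: "csubspace wap"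
  unfolding csubspace_def
proof (intro conjI ballI allI)
  have "orbit 0 \<subseteq> {0}" by (auto simp: orbit_def act_simps)
  then show "0 \<in> wap" by (intro wapI(1)[of "{0}"]) simp_all
  show "a *\<^sub>C x \<in> wap" if "x \<in> wap" for a x
    by (rule wap_linear_image[OF that bounded_linear_scaleC]) (simp add: act_scaleC)
qed (rule wap_add)

text \<open>Let \<open>u\<^sub>n\<close> be vectors with weakly compact orbit closures and limit \<open>l\<close>. The orbit of the sequence
  has compact closure \<open>Z\<close> in the product of these closures. The elements of \<open>Z\<close> are Cauchy sequences,
  uniformly, because \<open>\<parallel>p\<^sub>m - p\<^sub>n\<parallel> \<le> C \<parallel>u\<^sub>m - u\<^sub>n\<parallel>\<close> is a weakly closed condition. Hence the limit is a
  weakly continuous function on \<open>Z\<close>, and its image is a weakly compact set containing the orbit of \<open>l\<close>.\<close>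

lemma closed_wap: "closed wap"
  unfolding closed_sequential_limits
proof (intro allI impI, elim conjE)
  fix u :: "nat \<Rightarrow> 'x" and l assume u: "\<forall>n. u n \<in> wap" and lim: "u \<longlonglongrightarrow> l"
  define D where "D = range (\<lambda>s n. \<rho> s (u n))"
  define Z where "Z = pw closure_of D"
  have "compactin pw (PiE UNIV (\<lambda>n. orbit_closure (u n)))"
    using u by (subst compactin_PiE) (simp add: compact_orbit_closure)
  moreover have "Z \<subseteq> PiE UNIV (\<lambda>n. orbit_closure (u n))"
    unfolding Z_def
  proof (rule closure_of_minimal)
    show "D \<subseteq> PiE UNIV (\<lambda>n. orbit_closure (u n))" by (auto simp: D_def act_in_orbit_closure)
    show "closedin pw (PiE UNIV (\<lambda>n. orbit_closure (u n)))"
      using calculation by (rule compactin_imp_closedin[OF Hausdorff_pw])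
  qed
  ultimately have Z: "compactin pw Z"
    by (rule closed_compactin) (simp add: Z_def)
  have cmp: "norm (p m - p n) \<le> C * norm (u m - u n)" if "p \<in> Z" for p m n
  proof -
    have "Z \<subseteq> {p \<in> topspace pw. p m - p n \<in> cball 0 (C * norm (u m - u n))}"
      unfolding Z_def
    proof (rule closure_of_minimal)
      show "D \<subseteq> {p \<in> topspace pw. p m - p n \<in> cball 0 (C * norm (u m - u n))}"
        using act_bound[of _ "u m - u n"] by (auto simp: D_def act_simps)
      show "closedin pw {p \<in> topspace pw. p m - p n \<in> cball 0 (C * norm (u m - u n))}"
        by (rule closedin_continuous_map_preimage[OF continuous_map_weak_diff closedin_weak_cball])
           (rule continuous_map_pw_eval)+
    qed
    then show ?thesis using that by auto
  qed
  define \<Lambda> where "\<Lambda> p = lim (\<lambda>n. p n)" for p :: "nat \<Rightarrow> 'x"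
  have \<Lambda>: "p \<longlonglongrightarrow> \<Lambda> p" "norm (p n - \<Lambda> p) \<le> C * norm (u n - l)" if p: "p \<in> Z" for p n
  proof -
    have "Cauchy p"
    proof (rule CauchyI)
      fix \<epsilon> :: real assume "0 < \<epsilon>"
      then have "0 < \<epsilon> / C" using C by simp
      then obtain M where M: "\<And>m n. m \<ge> M \<Longrightarrow> n \<ge> M \<Longrightarrow> norm (u m - u n) < \<epsilon> / C"
        using LIMSEQ_imp_Cauchy[OF lim] CauchyD by blast
      have "norm (p m - p n) < \<epsilon>" if "m \<ge> M" "n \<ge> M" for m n
      proof -
        have "C * norm (u m - u n) < \<epsilon>" using M[OF that] C by (simp add: field_simps)
        then show ?thesis using cmp[OF p, of m n] by linarith
      qed
      then show "\<exists>M. \<forall>m\<ge>M. \<forall>n\<ge>M. norm (p m - p n) < \<epsilon>" by blast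
    qed
    then show *: "p \<longlonglongrightarrow> \<Lambda> p" unfolding \<Lambda>_def using Cauchy_convergent convergent_LIMSEQ_iff by blast
    have "(\<lambda>m. norm (p n - p m)) \<longlonglongrightarrow> norm (p n - \<Lambda> p)" "(\<lambda>m. C * norm (u n - u m)) \<longlonglongrightarrow> C * norm (u n - l)"
      by (intro tendsto_intros * lim)+
    then show "norm (p n - \<Lambda> p) \<le> C * norm (u n - l)"
      by (rule LIMSEQ_le) (use cmp[OF p] in blast)
  qed
  have "continuous_map (subtopology pw Z) weak_topology \<Lambda>"
  proof (rule continuous_map_into_weak)
    fix \<psi> :: "'x \<Rightarrow> real" assume \<psi>: "bounded_linear \<psi>"
    obtain B where B: "\<And>x. \<bar>\<psi> x\<bar> \<le> norm x * B" "0 \<le> B" using bounded_linear.nonneg_bounded[OF \<psi>] by auto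
    show "continuous_map (subtopology pw Z) euclideanreal (\<lambda>p. \<psi> (\<Lambda> p))"
    proof (rule continuous_map_uniform_limit_real)
      show "continuous_map (subtopology pw Z) euclideanreal (\<lambda>p. \<psi> (p n))" for n
        by (intro continuous_map_from_subtopology continuous_map_weak_compose[OF continuous_map_pw_eval \<psi>])
      show "\<bar>\<psi> (p n) - \<psi> (\<Lambda> p)\<bar> \<le> C * norm (u n - l) * B" if "p \<in> topspace (subtopology pw Z)" for n p
      proof -
        have "p \<in> Z" using that by simp
        then have "norm (p n - \<Lambda> p) * B \<le> C * norm (u n - l) * B"
          using \<Lambda>(2) B(2) by (intro mult_right_mono) auto
        then show ?thesis using B(1)[of "p n - \<Lambda> p"] \<psi> by (simp add: bounded_linear.linear linear_diff)
      qed
      have "(\<lambda>n. C * norm (u n - l) * B) \<longlonglongrightarrow> C * norm (l - l) * B"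
        by (intro tendsto_intros lim)
      then show "(\<lambda>n. C * norm (u n - l) * B) \<longlonglongrightarrow> 0" by simp
    qed
  qed
  moreover have "compactin (subtopology pw Z) Z" using Z by (simp add: compactin_subtopology)
  ultimately have "compactin weak_topology (\<Lambda> ` Z)" by (rule image_compactin[rotated])
  moreover have "orbit l \<subseteq> \<Lambda> ` Z"
  proof -
    have "\<rho> s l \<in> \<Lambda> ` Z" for s
    proof
      show "(\<lambda>n. \<rho> s (u n)) \<in> Z"
        unfolding Z_def by (rule subsetD[OF closure_of_subset]) (auto simp: D_def)
      then have "(\<lambda>n. \<rho> s (u n)) \<longlonglongrightarrow> \<Lambda> (\<lambda>n. \<rho> s (u n))" by (rule \<Lambda>(1))
      moreover have "(\<lambda>n. \<rho> s (u n)) \<longlonglongrightarrow> \<rho> s l" by (rule bounded_linear.tendsto[OF linear_act lim])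
      ultimately show "\<rho> s l = \<Lambda> (\<lambda>n. \<rho> s (u n))" using LIMSEQ_unique by blast
    qed
    then show ?thesis by (auto simp: orbit_def)
  qed
  ultimately show "l \<in> wap" by (rule wapI(1))
qed

lemma subspace_wap: "subspace wap"
  by (rule csubspace_imp_subspace[OF csubspace_wap])

subsection \<open>The enveloping semigroup\<close>

text \<open>Only the action on \<open>wap\<close> matters. The value zero elsewhere keeps \<open>\<gamma>\<close> multiplicative and makes the
  pointwise weak closure of its range compact.\<close>

definition \<gamma> :: "'g \<Rightarrow> 'x \<Rightarrow> 'x" where
  "\<gamma> s x = (if x \<in> wap then \<rho> s x else 0)"

definition S :: "('x \<Rightarrow> 'x) set" where
  "S = pw closure_of range \<gamma>"

lemma \<gamma>_in_S: "\<gamma> s \<in> S"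
  unfolding S_def by (rule subsetD[OF closure_of_subset]) auto

lemma \<gamma>_wap: "x \<in> wap \<Longrightarrow> \<gamma> s x = \<rho> s x"
  by (simp add: \<gamma>_def)

text \<open>\<open>S\<close> is closed in a product of weakly compact orbit closures.\<close>

lemma compactin_S: "compactin pw S"
proof (rule closed_compactin)
  let ?P = "PiE UNIV (\<lambda>x. if x \<in> wap then orbit_closure x else {0})"
  show c: "compactin pw ?P" by (subst compactin_PiE) (auto simp: compact_orbit_closure)
  show "S \<subseteq> ?P"
    unfolding S_def
  proof (rule closure_of_minimal)
    show "closedin pw ?P" using c by (rule compactin_imp_closedin[OF Hausdorff_pw])
  qed (auto simp: \<gamma>_def act_in_orbit_closure)
qed (simp add: S_def)

lemma S_orbit_closure: "T \<in> S \<Longrightarrow> x \<in> wap \<Longrightarrow> T x \<in> orbit_closure x"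
proof -
  assume "T \<in> S" and x: "x \<in> wap"
  then have "T x \<in> (\<lambda>f. f x) ` (pw closure_of range \<gamma>)" by (simp add: S_def)
  then have "T x \<in> weak_topology closure_of ((\<lambda>f. f x) ` range \<gamma>)"
    by (rule subsetD[OF continuous_map_image_closure_subset[OF continuous_map_pw_eval]])
  moreover have "(\<lambda>f. f x) ` range \<gamma> \<subseteq> orbit x" using x by (auto simp: orbit_def \<gamma>_def)
  ultimately show ?thesis unfolding orbit_closure_def using closure_of_mono by blast
qed

lemma S_wap: "T \<in> S \<Longrightarrow> x \<in> wap \<Longrightarrow> T x \<in> wap"
  using S_orbit_closure orbit_closure_subset_wap by blast

text \<open>Equations between weakly continuous expressions pass from the group to its closure; linearity of the
  elements of \<open>S\<close> follows in this way.\<close>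

lemma S_eqI:
  assumes "T \<in> S" "continuous_map pw weak_topology f" "continuous_map pw weak_topology g" "\<And>s. f (\<gamma> s) = g (\<gamma> s)"
  shows "f T = (g T :: 'x)"
  using assms by (intro forall_in_closure_of_eq[of T pw "range \<gamma>" weak_topology f g]) (auto simp: S_def Hausdorff_weak)

lemma S_off: "T \<in> S \<Longrightarrow> x \<notin> wap \<Longrightarrow> T x = 0"
  by (rule S_eqI[where f = "\<lambda>f. f x" and g = "\<lambda>_. 0"]) (simp_all add: \<gamma>_def continuous_map_pw_eval)

lemma S_zero: "T \<in> S \<Longrightarrow> T 0 = 0"
  by (rule S_eqI[where f = "\<lambda>f. f 0" and g = "\<lambda>_. 0"])
     (simp_all add: \<gamma>_def continuous_map_pw_eval act_simps)

lemma S_add: "T \<in> S \<Longrightarrow> x \<in> wap \<Longrightarrow> y \<in> wap \<Longrightarrow> T (x + y) = T x + T y"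
  by (rule S_eqI[where f = "\<lambda>f. f (x + y)" and g = "\<lambda>f. f x + f y"])
     (simp_all add: continuous_map_weak_add continuous_map_pw_eval \<gamma>_wap wap_add act_simps)

lemma wap_scaleC: "x \<in> wap \<Longrightarrow> a *\<^sub>C x \<in> wap"
  using csubspace_wap by (simp add: csubspace_def)

lemma S_scaleC: "T \<in> S \<Longrightarrow> x \<in> wap \<Longrightarrow> T (a *\<^sub>C x) = a *\<^sub>C T x"
  by (rule S_eqI[where f = "\<lambda>f. f (a *\<^sub>C x)" and g = "\<lambda>f. a *\<^sub>C f x"])
     (simp_all add: continuous_map_weak_linear_compose[OF continuous_map_pw_eval bounded_linear_scaleC]
       continuous_map_pw_eval \<gamma>_wap wap_scaleC act_scaleC)

lemma S_scaleR: "T \<in> S \<Longrightarrow> x \<in> wap \<Longrightarrow> T (r *\<^sub>R x) = r *\<^sub>R T x"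
  using S_scaleC[of T x "complex_of_real r"] by (simp add: scaleC_of_real)

lemma S_bound: "T \<in> S \<Longrightarrow> norm (T x) \<le> C * norm x"
proof -
  assume T: "T \<in> S"
  have "S \<subseteq> {f \<in> topspace pw. f x \<in> cball 0 (C * norm x)}"
    unfolding S_def
  proof (rule closure_of_minimal)
    show "closedin pw {f \<in> topspace pw. f x \<in> cball 0 (C * norm x)}"
      by (rule closedin_continuous_map_preimage[OF continuous_map_pw_eval closedin_weak_cball])
  qed (use C act_bound in \<open>auto simp: \<gamma>_def\<close>)
  then show ?thesis using T by auto
qed

text \<open>An element of \<open>S\<close> is linear on \<open>wap\<close> only; composing it with a functional and extending the
  result to the whole space shows that it is weakly continuous on \<open>wap\<close>.\<close>

lemma S_weakly_continuous:
  assumes T: "T \<in> S" and f: "continuous_map X weak_topology f" "\<And>t. t \<in> topspace X \<Longrightarrow> f t \<in> wap"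
  shows "continuous_map X weak_topology (\<lambda>t. T (f t))"
proof (rule continuous_map_into_weak)
  fix \<psi> :: "'x \<Rightarrow> real" assume \<psi>: "bounded_linear \<psi>"
  interpret \<psi>: bounded_linear \<psi> by fact
  obtain B where B: "\<And>x. \<bar>\<psi> x\<bar> \<le> norm x * B" "0 \<le> B" using \<psi>.nonneg_bounded by auto
  have bound: "\<bar>\<psi> (T x)\<bar> \<le> B * C * norm x" for x
  proof -
    have "norm (T x) * B \<le> C * norm x * B" using S_bound[OF T] B(2) by (intro mult_right_mono)
    then show ?thesis using B(1)[of "T x"] by (simp add: mult_ac)
  qed
  obtain g where g: "bounded_linear g" "\<And>x. x \<in> wap \<Longrightarrow> g x = \<psi> (T x)"
    by (rule functional_extends_along_isometry[OF subspace_wap, of "\<lambda>x. x" "\<lambda>x. \<psi> (T x)" "B * C" 0])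
       (use bound B C in \<open>simp_all add: S_add[OF T] S_scaleR[OF T] \<psi>.add \<psi>.scaleR\<close>)
  have "continuous_map X euclideanreal (\<lambda>t. g (f t))" by (rule continuous_map_weak_compose[OF f(1) g(1)])
  then show "continuous_map X euclideanreal (\<lambda>t. \<psi> (T (f t)))"
    by (rule continuous_map_eq) (simp add: g(2) f(2))
qed

abbreviation SX :: "('x \<Rightarrow> 'x) topology" where
  "SX \<equiv> subtopology pw S"

lemma cont_comp_right: "continuous_map SX pw (\<lambda>T. T \<circ> U)"
  by (intro continuous_map_into_pw continuous_map_from_subtopology) (simp add: continuous_map_pw_eval)

lemma cont_comp_left:
  assumes "T \<in> S"
  shows "continuous_map SX pw (\<lambda>U. T \<circ> U)"
proof (rule continuous_map_into_pw)
  fix x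
  show "continuous_map SX weak_topology (\<lambda>U. (T \<circ> U) x)"
    unfolding o_apply
  proof (rule S_weakly_continuous[OF assms])
    show "continuous_map SX weak_topology (\<lambda>U. U x)"
      by (intro continuous_map_from_subtopology continuous_map_pw_eval)
    show "U x \<in> wap" if "U \<in> topspace SX" for U
      using that S_wap[of U x] S_off[of U x] csubspace_wap by (cases "x \<in> wap") (auto simp: csubspace_def)
  qed
qed

lemma closure_of_SX: "A \<subseteq> S \<Longrightarrow> SX closure_of A = pw closure_of A"
proof -
  assume A: "A \<subseteq> S"
  have "pw closure_of A \<subseteq> S"
    using closure_of_mono[of A S pw] A by (metis S_def closure_of_closure_of)
  then show ?thesis using A by (simp add: closure_of_subtopology Int_absorb1)
qed

lemma \<gamma>_add: "\<gamma> (s + t) = \<gamma> s \<circ> \<gamma> t"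
proof
  have "0 \<in> wap" using csubspace_wap by (simp add: csubspace_def)
  then show "\<gamma> (s + t) x = (\<gamma> s \<circ> \<gamma> t) x" for x by (simp add: \<gamma>_def act_wap act_add act_simps)
qed

text \<open>Composition is separately continuous, so products of closures lie in closures of products.\<close>

lemma closure_comp:
  assumes A: "A \<subseteq> range \<gamma>" and B: "B \<subseteq> range \<gamma>" and AB: "\<And>a b. a \<in> A \<Longrightarrow> b \<in> B \<Longrightarrow> a \<circ> b \<in> D"
    and T: "T \<in> pw closure_of A" and U: "U \<in> pw closure_of B"
  shows "T \<circ> U \<in> pw closure_of D"
proof -
  have S: "A \<subseteq> S" "B \<subseteq> S" using A B \<gamma>_in_S by auto
  have AU: "a \<circ> U \<in> pw closure_of D" if a: "a \<in> A" for a
  proof -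
    have "a \<circ> U \<in> (\<lambda>U. a \<circ> U) ` (SX closure_of B)" using U closure_of_SX[OF S(2)] by blast
    also have "\<dots> \<subseteq> pw closure_of ((\<lambda>U. a \<circ> U) ` B)"
      using a S by (intro continuous_map_image_closure_subset cont_comp_left) auto
    also have "\<dots> \<subseteq> pw closure_of D" using a AB by (intro closure_of_mono) auto
    finally show ?thesis .
  qed
  have "T \<circ> U \<in> (\<lambda>T. T \<circ> U) ` (SX closure_of A)" using T closure_of_SX[OF S(1)] by blast
  also have "\<dots> \<subseteq> pw closure_of ((\<lambda>T. T \<circ> U) ` A)"
    by (intro continuous_map_image_closure_subset cont_comp_right)
  also have "\<dots> \<subseteq> pw closure_of (pw closure_of D)" using AU by (intro closure_of_mono) auto
  finally show ?thesis by simp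
qed

lemma S_comp: "T \<in> S \<Longrightarrow> U \<in> S \<Longrightarrow> T \<circ> U \<in> S"
  unfolding S_def by (rule closure_comp[of "range \<gamma>" "range \<gamma>"]) (auto simp flip: \<gamma>_add)

lemma semigroup: "dense_group_semigroup SX (\<circ>) \<gamma>"
proof
  show "compact_space SX" using compactin_S by (simp add: compact_space_subtopology)
  show "Hausdorff_space SX" by (rule Hausdorff_space_subtopology[OF Hausdorff_pw])
  show "continuous_map SX SX ((\<circ>) T)" if "T \<in> topspace SX" for T
    using that cont_comp_left S_comp by (auto simp: continuous_map_in_subtopology)
  show "continuous_map SX SX (\<lambda>U. U \<circ> T)" if "T \<in> topspace SX" for T
    using that cont_comp_right S_comp by (auto simp: continuous_map_in_subtopology)
  show "T \<circ> \<gamma> 0 = T" if "T \<in> topspace SX" for T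
  proof
    show "(T \<circ> \<gamma> 0) x = T x" for x
      using that S_off[of T x] S_zero[of T] by (simp add: \<gamma>_def act_zero)
  qed
  show "\<gamma> 0 \<circ> T = T" if "T \<in> topspace SX" for T
  proof
    show "(\<gamma> 0 \<circ> T) x = T x" for x
      using that S_off[of T x] S_wap[of T x] by (cases "x \<in> wap") (auto simp: \<gamma>_def act_zero)
  qed
  show "SX closure_of range \<gamma> = topspace SX"
    using \<gamma>_in_S by (subst closure_of_SX) (auto simp: S_def)
qed (auto simp: S_comp \<gamma>_add \<gamma>_in_S o_assoc)

end

context bounded_action
begin

section \<open>Operators that are limits along the neighbourhoods of the identity\<close>

text \<open>\<open>S0\<close> consists of the limits of \<open>\<rho> s\<close> as \<open>s\<close> tends to \<open>0\<close>. Its common fixed vectors are the continuous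
  vectors.\<close>

definition S0 :: "('x \<Rightarrow> 'x) set" where
  "S0 = (\<Inter>U\<in>{U. open U \<and> 0 \<in> U}. pw closure_of (\<gamma> ` U))"

lemma S0_subset: "S0 \<subseteq> S"
  unfolding S0_def S_def by (rule INF_lower2[of UNIV]) auto

lemma S0D: "T \<in> S0 \<Longrightarrow> open U \<Longrightarrow> 0 \<in> U \<Longrightarrow> T \<in> pw closure_of (\<gamma> ` U)"
  by (auto simp: S0_def)

text \<open>Continuity of addition at \<open>0\<close>: products of two neighbourhoods fit into a given one.\<close>

lemma S0_comp:
  assumes "T \<in> S0" "T' \<in> S0"
  shows "T \<circ> T' \<in> S0"
  unfolding S0_def
proof (rule INT_I)
  fix U :: "'g set" assume "U \<in> {U. open U \<and> 0 \<in> U}"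
  then have U: "open U" "0 \<in> U" by auto
  have "continuous_on UNIV (\<lambda>p::'g \<times> 'g. fst p + snd p)" by (intro continuous_intros)
  then have "open ((\<lambda>p::'g \<times> 'g. fst p + snd p) -` U)" using U(1) by (rule open_vimage[rotated])
  moreover have "(0, 0) \<in> (\<lambda>p::'g \<times> 'g. fst p + snd p) -` U" using U(2) by simp
  ultimately obtain A B where AB: "open A" "open B" "(0, 0) \<in> A \<times> B" "A \<times> B \<subseteq> (\<lambda>p. fst p + snd p) -` U"
    by (rule open_prod_elim)
  show "T \<circ> T' \<in> pw closure_of (\<gamma> ` U)"
  proof (rule closure_comp[of "\<gamma> ` A" "\<gamma> ` B"])
    show "a \<circ> b \<in> \<gamma> ` U" if "a \<in> \<gamma> ` A" "b \<in> \<gamma> ` B" for a b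
      using that AB(4) by (force simp flip: \<gamma>_add)
  qed (use assms AB in \<open>auto intro!: S0D\<close>)
qed

lemma S0_conj:
  assumes T: "T \<in> S0"
  shows "\<gamma> s \<circ> T \<circ> \<gamma> (- s) \<in> S0"
  unfolding S0_def
proof (rule INT_I)
  fix U :: "'g set" assume "U \<in> {U. open U \<and> 0 \<in> U}"
  then have U: "open U" "0 \<in> U" by auto
  define W where "W = (\<lambda>t. s + t + - s) -` U"
  have "continuous_on UNIV (\<lambda>t. s + t + - s)" by (intro continuous_intros)
  then have W: "open W" "0 \<in> W" unfolding W_def using U by (auto intro: open_vimage simp del: add_uminus_conv_diff)
  have single: "\<gamma> r \<in> pw closure_of {\<gamma> r}" for r
    by (rule subsetD[OF closure_of_subset]) auto
  have st: "\<gamma> s \<circ> T \<in> pw closure_of ((\<lambda>t. \<gamma> (s + t)) ` W)"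
    by (rule closure_comp[OF _ _ _ single S0D[OF T W]]) (auto simp flip: \<gamma>_add)
  show "\<gamma> s \<circ> T \<circ> \<gamma> (- s) \<in> pw closure_of (\<gamma> ` U)"
    by (rule closure_comp[OF _ _ _ st single]) (auto simp: W_def simp flip: \<gamma>_add)
qed

lemma invariant: "invariant_subsemigroup SX (\<circ>) \<gamma> S0"
proof -
  interpret dense_group_semigroup SX "(\<circ>)" \<gamma> by (rule semigroup)
  show ?thesis
  proof
    have "closedin pw S0" unfolding S0_def by (intro closedin_INT) auto
    then show "closedin SX S0" using S0_subset by (metis closedin_subset_topspace)
    have "\<gamma> 0 \<in> pw closure_of (\<gamma> ` U)" if "0 \<in> U" for U
      by (rule subsetD[OF closure_of_subset]) (use that in auto)
    then show "S0 \<noteq> {}" by (auto simp: S0_def)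
  qed (use S0_comp S0_conj in auto)
qed

lemma continuous_vector_fixed:
  assumes x: "x \<in> wap" and c: "continuous_map euclidean weak_topology (\<lambda>s. \<rho> s x)" and T: "T \<in> S0"
  shows "T x = x"
proof (rule functionals_separate)
  fix \<psi> :: "'x \<Rightarrow> real" assume \<psi>: "bounded_linear \<psi>"
  have "\<bar>\<psi> (T x) - \<psi> x\<bar> \<le> \<epsilon>" if \<epsilon>: "0 < \<epsilon>" for \<epsilon>
  proof -
    define U where "U = {s. \<bar>\<psi> (\<rho> s x) - \<psi> x\<bar> < \<epsilon>}"
    have "continuous_map euclidean euclideanreal (\<lambda>s. \<psi> (\<rho> s x))" by (rule continuous_map_weak_compose[OF c \<psi>])
    then have "openin euclidean {s \<in> topspace euclidean. \<bar>\<psi> (\<rho> s x) - \<psi> x\<bar> < \<epsilon>}"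
      by (intro openin_Collect_less continuous_intros)
    then have U: "open U" "0 \<in> U" using \<epsilon> by (simp_all add: U_def act_zero)
    have "pw closure_of (\<gamma> ` U) \<subseteq> {f \<in> topspace pw. \<bar>\<psi> (f x) - \<psi> x\<bar> \<le> \<epsilon>}"
    proof (rule closure_of_minimal)
      show "closedin pw {f \<in> topspace pw. \<bar>\<psi> (f x) - \<psi> x\<bar> \<le> \<epsilon>}"
        by (intro closedin_Collect_le continuous_intros continuous_map_weak_compose[OF continuous_map_pw_eval \<psi>])
    qed (auto simp: U_def \<gamma>_wap x)
    then show ?thesis using S0D[OF T U] by auto
  qed
  from this[of "\<bar>\<psi> (T x) - \<psi> x\<bar> / 2"] show "\<psi> (T x) = \<psi> x" by (cases "\<psi> (T x) = \<psi> x") simp_all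
qed

text \<open>If \<open>\<rho> s x\<close> stayed away from \<open>x\<close>, in terms of one functional, for \<open>s\<close> in every neighbourhood of \<open>0\<close>,
  compactness of \<open>S\<close> would provide an element of \<open>S0\<close> that moves \<open>x\<close>. Continuity at the other points
  follows by translation.\<close>

lemma fixed_vector_continuous:
  assumes x: "x \<in> wap" and fixed: "\<And>T. T \<in> S0 \<Longrightarrow> T x = x"
  shows "continuous_map euclidean weak_topology (\<lambda>s. \<rho> s x)"
proof (rule continuous_map_into_weak)
  fix \<psi> :: "'x \<Rightarrow> real" assume \<psi>: "bounded_linear \<psi>"
  have near: "\<exists>U. open U \<and> 0 \<in> U \<and> (\<forall>t\<in>U. \<bar>\<phi> (\<rho> t x) - \<phi> x\<bar> < \<epsilon>)"
    if \<phi>: "bounded_linear \<phi>" and \<epsilon>: "0 < \<epsilon>" for \<phi> :: "'x \<Rightarrow> real" and \<epsilon>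
  proof (rule ccontr)
    assume no: "\<not> ?thesis"
    define G where "G U = pw closure_of (\<gamma> ` U) \<inter> {f \<in> topspace pw. \<epsilon> \<le> \<bar>\<phi> (f x) - \<phi> x\<bar>}" for U
    have "closedin pw {f \<in> topspace pw. \<epsilon> \<le> \<bar>\<phi> (f x) - \<phi> x\<bar>}"
      by (intro closedin_Collect_le continuous_intros continuous_map_weak_compose[OF continuous_map_pw_eval \<phi>])
    then have "closedin pw (G U)" for U unfolding G_def by (intro closedin_Int) auto
    moreover have GS: "G U \<subseteq> S" for U unfolding G_def S_def using closure_of_mono[of "\<gamma> ` U" "range \<gamma>" pw] by blast
    ultimately have cl: "\<forall>B\<in>G ` {U. open U \<and> 0 \<in> U}. closedin SX B"
      by (metis (no_types, lifting) closedin_subset_topspace imageE)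
    have fip: "\<Inter>\<F> \<noteq> {}" if \<F>: "finite \<F>" "\<F> \<subseteq> G ` {U. open U \<and> 0 \<in> U}" for \<F>
    proof -
      obtain \<U> where \<U>: "\<U> \<subseteq> {U. open U \<and> 0 \<in> U}" "finite \<U>" "\<F> = G ` \<U>"
        using finite_subset_image[OF \<F>] by blast
      have I: "open (\<Inter>\<U>)" "0 \<in> \<Inter>\<U>" using \<U> by (auto intro: open_Inter)
      have "\<not> (\<forall>t\<in>\<Inter>\<U>. \<bar>\<phi> (\<rho> t x) - \<phi> x\<bar> < \<epsilon>)"
      proof
        assume "\<forall>t\<in>\<Inter>\<U>. \<bar>\<phi> (\<rho> t x) - \<phi> x\<bar> < \<epsilon>"
        then have "\<exists>U. open U \<and> 0 \<in> U \<and> (\<forall>t\<in>U. \<bar>\<phi> (\<rho> t x) - \<phi> x\<bar> < \<epsilon>)"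
          by (intro exI[of _ "\<Inter>\<U>"] conjI I)
        then show False by (rule notE[OF no])
      qed
      then obtain t where t: "t \<in> \<Inter>\<U>" "\<epsilon> \<le> \<bar>\<phi> (\<rho> t x) - \<phi> x\<bar>" by (meson not_less)
      have "\<gamma> t \<in> G U" if "U \<in> \<U>" for U
      proof -
        have "\<gamma> t \<in> pw closure_of (\<gamma> ` U)" by (rule subsetD[OF closure_of_subset]) (use t that in auto)
        then show ?thesis using t(2) by (simp add: G_def \<gamma>_wap x)
      qed
      then show ?thesis using \<U>(3) by blast
    qed
    have "compact_space SX" using compactin_S by (rule compact_space_subtopology)
    from this[unfolded compact_space_fip, rule_format, of "G ` {U. open U \<and> 0 \<in> U}"]
    have "\<Inter>(G ` {U. open U \<and> 0 \<in> U}) \<noteq> {}" using cl fip by blast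
    then obtain T where "T \<in> \<Inter>(G ` {U. open U \<and> 0 \<in> U})" by (meson ex_in_conv)
    then have T: "T \<in> G U" if "open U" "0 \<in> U" for U using that by simp
    then have "T \<in> S0" by (auto simp: S0_def G_def)
    moreover have "\<epsilon> \<le> \<bar>\<phi> (T x) - \<phi> x\<bar>" using T[of UNIV] by (simp add: G_def)
    ultimately show False using fixed[of T] \<epsilon> by simp
  qed
  have "((\<lambda>s. \<psi> (\<rho> s x)) \<longlongrightarrow> \<psi> (\<rho> s x)) (at s)" for s
  proof (rule tendstoI)
    fix \<epsilon> :: real assume \<epsilon>: "0 < \<epsilon>"
    from near[OF bounded_linear_compose[OF \<psi> linear_act[of s]] \<epsilon>]
    obtain U where U: "open U" "0 \<in> U" "\<forall>t\<in>U. \<bar>\<psi> (\<rho> s (\<rho> t x)) - \<psi> (\<rho> s x)\<bar> < \<epsilon>"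
      by (elim exE conjE)
    have "continuous_on UNIV (\<lambda>t. - s + t)" by (intro continuous_intros)
    then have "open ((\<lambda>t. - s + t) -` U)" using U(1) by (intro open_vimage) auto
    moreover have "s \<in> (\<lambda>t. - s + t) -` U" using U(2) by simp
    moreover have "dist (\<psi> (\<rho> t x)) (\<psi> (\<rho> s x)) < \<epsilon>" if "t \<in> (\<lambda>t. - s + t) -` U" for t
    proof -
      have "\<rho> s (\<rho> (- s + t) x) = \<rho> t x" by (simp flip: act_add add.assoc)
      then show ?thesis using bspec[OF U(3), of "- s + t"] that by (simp add: dist_real_def)
    qed
    ultimately show "\<forall>\<^sub>F t in at s. dist (\<psi> (\<rho> t x)) (\<psi> (\<rho> s x)) < \<epsilon>"
      unfolding eventually_at_topological by blast
  qed
  then show "continuous_map euclidean euclideanreal (\<lambda>s. \<psi> (\<rho> s x))"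
    by (simp add: continuous_on_def)
qed

text \<open>Orbits of the group \<open>L\<close> are norm precompact, not merely weakly compact. Fragmentation for
  \<open>h \<mapsto> \<psi> (h x)\<close> with \<open>\<psi>\<close> in the dual ball gives an open set of operators whose values at \<open>x\<close> are close in
  norm, and finitely many translates of it cover \<open>L\<close>.\<close>

lemma compact_group_precompact_orbits:
  assumes L: "closedin SX L" "e \<in> L" "\<And>h k. h \<in> L \<Longrightarrow> k \<in> L \<Longrightarrow> h \<circ> k \<in> L"
      "\<And>h. h \<in> L \<Longrightarrow> e \<circ> h = h" "\<And>h. h \<in> L \<Longrightarrow> h \<circ> e = h"
      "\<And>h. h \<in> L \<Longrightarrow> \<exists>k\<in>L. k \<circ> h = e \<and> h \<circ> k = e"
    and x: "x \<in> wap" and \<epsilon>: "0 < \<epsilon>"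
  shows "\<exists>c::('x \<Rightarrow> 'x) \<Rightarrow> nat. finite (c ` L) \<and> (\<forall>h\<in>L. \<forall>k\<in>L. c h = c k \<longrightarrow> norm (h x - k x) \<le> \<epsilon>)"
proof -
  have LS: "L \<subseteq> S" using closedin_subset[OF L(1)] by simp
  have "compactin SX L"
    using L(1) compactin_S by (intro closedin_compact_space) (auto simp: compact_space_subtopology)
  then have Lc: "compactin pw L" by (simp add: compactin_subtopology)
  have tL: "topspace (subtopology pw L) = L" by simp
  obtain U where U: "openin (subtopology pw L) U" "U \<noteq> {}"
    "\<And>h k \<psi>. h \<in> U \<Longrightarrow> k \<in> U \<Longrightarrow> \<psi> \<in> topspace (top_of_set dual_ball) \<Longrightarrow> \<bar>\<psi> (h x) - \<psi> (k x)\<bar> \<le> \<epsilon> / C"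
  \<comment> \<open>The quotient by \<open>C\<close> leaves room for undoing a translation.\<close>
  proof (rule fragmentation[of "subtopology pw L" "top_of_set dual_ball" "\<lambda>h \<psi>. \<psi> (h x)" "\<epsilon> / C"])
    show "compact_space (subtopology pw L)" using Lc by (rule compact_space_subtopology)
    show "topspace (subtopology pw L) \<noteq> {}" using L(2) by auto
    show "compact_space (top_of_set (dual_ball :: ('x \<Rightarrow> real) set))"
      by (rule compact_space_subtopology) (simp add: compact_dual_ball)
    show "continuous_map (subtopology pw L) euclideanreal (\<lambda>h. \<psi> (h x))" if "\<psi> \<in> topspace (top_of_set dual_ball)" for \<psi>
      using that by (intro continuous_map_from_subtopology continuous_map_weak_compose[OF continuous_map_pw_eval])
        (simp add: dual_ball_bounded_linear)
    show "continuous_map (top_of_set dual_ball) euclideanreal (\<lambda>\<psi>. \<psi> (h x))" for h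
      by (intro continuous_map_from_subtopology) simp
    show "0 < \<epsilon> / C" using \<epsilon> C by simp
  qed blast
  have UL: "U \<subseteq> L" using openin_subset[OF U(1)] by simp
  have Unorm: "norm (h x - k x) \<le> \<epsilon> / C" if "h \<in> U" "k \<in> U" for h k
  proof (rule norm_le_dual_ball)
    fix \<psi> :: "'x \<Rightarrow> real" assume \<psi>: "\<psi> \<in> dual_ball"
    then have "\<psi> (h x - k x) = \<psi> (h x) - \<psi> (k x)" by (simp add: dual_ball_def linear_diff)
    then show "\<psi> (h x - k x) \<le> \<epsilon> / C" using U(3)[OF that, of \<psi>] \<psi> by simp
  qed
  define O' where "O' k = {h \<in> L. k \<circ> h \<in> U}" for k
  have op: "openin (subtopology pw L) (O' k)" if k: "k \<in> L" for k
  proof -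
    have "continuous_map (subtopology SX L) pw (\<lambda>h. k \<circ> h)"
      using k LS by (intro continuous_map_from_subtopology cont_comp_left) auto
    moreover have "subtopology SX L = subtopology pw L" using LS by (simp add: subtopology_subtopology Int_absorb1)
    ultimately have "continuous_map (subtopology pw L) (subtopology pw L) (\<lambda>h. k \<circ> h)"
      using L(3) k by (auto simp: continuous_map_in_subtopology)
    from openin_continuous_map_preimage[OF this U(1)] show ?thesis by (simp add: O'_def)
  qed
  have cover: "\<exists>k\<in>L. h \<in> O' k" if h: "h \<in> L" for h
  proof -
    obtain u where u: "u \<in> U" "u \<in> L" using U(2) UL by blast
    obtain j where j: "j \<in> L" "j \<circ> h = e" using L(6)[OF h] by blast
    have "(u \<circ> j) \<circ> h = u" using j(2) L(5)[OF u(2)] by (simp add: o_assoc[symmetric])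
    then show ?thesis using h u j L(3) by (intro bexI[of _ "u \<circ> j"]) (auto simp: O'_def)
  qed
  have "compact_space (subtopology pw L)" using Lc by (rule compact_space_subtopology)
  then have "\<exists>\<F>. finite \<F> \<and> \<F> \<subseteq> O' ` L \<and> topspace (subtopology pw L) \<subseteq> \<Union>\<F>"
    unfolding compact_space_def by (rule compactinD) (use op cover in auto)
  then obtain \<F> where \<F>: "finite \<F>" "\<F> \<subseteq> O' ` L" "L \<subseteq> \<Union>\<F>" by auto
  obtain K where K: "K \<subseteq> L" "finite K" "\<F> = O' ` K" using finite_subset_image[OF \<F>(1,2)] by blast
  define p where "p h = (SOME k. k \<in> K \<and> h \<in> O' k)" for h
  have p: "p h \<in> K" "h \<in> O' (p h)" if "h \<in> L" for h
  proof -
    have "\<exists>k. k \<in> K \<and> h \<in> O' k" using \<F>(3) that K(3) by blast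
    from someI_ex[OF this] show "p h \<in> K" "h \<in> O' (p h)" by (auto simp: p_def)
  qed
  obtain i :: "('x \<Rightarrow> 'x) \<Rightarrow> nat" where i: "inj_on i K"
    using finite_imp_inj_to_nat_seg[OF K(2)] by blast
  show ?thesis
  proof (intro exI[of _ "\<lambda>h. i (p h)"] conjI ballI impI)
    have "(\<lambda>h. i (p h)) ` L \<subseteq> i ` K" using p(1) by blast
    then show "finite ((\<lambda>h. i (p h)) ` L)" by (rule finite_subset) (simp add: K(2))
  next
    fix h k assume h: "h \<in> L" and k: "k \<in> L" and "i (p h) = i (p k)"
    then have eq: "p h = p k" using i p(1) by (meson inj_onD)
    define g where "g = p h"
    have g: "g \<in> L" "g \<circ> h \<in> U" "g \<circ> k \<in> U"
      using p[OF h] p[OF k] K(1) eq by (auto simp: g_def O'_def)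
    obtain j where j: "j \<in> L" "j \<circ> g = e" using L(6)[OF g(1)] by blast
    have jg: "j (g (f x)) = f x" if "f \<in> L" for f
      using j(2) L(4)[OF that] by (metis o_apply)
    have S: "h \<in> S" "k \<in> S" "g \<in> S" "j \<in> S" using h k g(1) j(1) LS by auto
    have w: "g (h x) \<in> wap" "g (k x) \<in> wap" using S x by (auto intro: S_wap)
    have "h x - k x = j (g (h x)) - j (g (k x))" using jg[OF h] jg[OF k] by simp
    also have "\<dots> = j (g (h x) - g (k x))"
      using S_add[OF S(4), of "g (h x) - g (k x)" "g (k x)"] w subspace_diff[OF subspace_wap w] by simp
    finally have "norm (h x - k x) \<le> C * norm (g (h x) - g (k x))" using S_bound[OF S(4)] by simp
    also have "\<dots> \<le> C * (\<epsilon> / C)" using Unorm[OF g(2,3)] C by (intro mult_left_mono) auto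
    finally show "norm (h x - k x) \<le> \<epsilon>" using C by simp
  qed
qed

text \<open>\<open>M\<close> is the mean over the least ideal \<open>L\<close> of \<open>S0\<close>. Its range is fixed by \<open>S0\<close>, since \<open>T \<circ> e \<in> L\<close> for
  \<open>T \<in> S0\<close>, and vectors fixed by \<open>S0\<close> are fixed by every average. It commutes with the action because
  \<open>L\<close> is invariant under conjugation.\<close>

theorem continuous_projection:
  obtains M where "\<And>x. x \<in> wap \<Longrightarrow> M x \<in> wap"
    "\<And>x y. x \<in> wap \<Longrightarrow> y \<in> wap \<Longrightarrow> M (x + y) = M x + M y"
    "\<And>a x. x \<in> wap \<Longrightarrow> M (a *\<^sub>C x) = a *\<^sub>C M x"
    "\<And>x. x \<in> wap \<Longrightarrow> norm (M x) \<le> C * norm x"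
    "\<And>x. x \<in> wap \<Longrightarrow> M (M x) = M x"
    "\<And>s x. x \<in> wap \<Longrightarrow> M (\<rho> s x) = \<rho> s (M x)"
    "\<And>x. x \<in> wap \<Longrightarrow> M x = x \<longleftrightarrow> continuous_map euclidean weak_topology (\<lambda>s. \<rho> s x)"
    "\<And>\<Xi> \<epsilon>. finite \<Xi> \<Longrightarrow> \<Xi> \<subseteq> wap \<Longrightarrow> 0 < \<epsilon> \<Longrightarrow>
       \<exists>A. finite A \<and> A \<noteq> {} \<and> A \<subseteq> S \<and> (\<forall>x\<in>\<Xi>. norm (M x - average A x) \<le> \<epsilon>)"
proof -
  interpret N: invariant_subsemigroup SX "(\<circ>)" \<gamma> S0 by (rule invariant)
  obtain L e where L: "closedin SX L" "L \<subseteq> S0" "e \<in> L"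
    "\<And>h k. h \<in> L \<Longrightarrow> k \<in> L \<Longrightarrow> h \<circ> k \<in> L"
    "\<And>h. h \<in> L \<Longrightarrow> e \<circ> h = h" "\<And>h. h \<in> L \<Longrightarrow> h \<circ> e = h"
    "\<And>h. h \<in> L \<Longrightarrow> \<exists>k\<in>L. k \<circ> h = e \<and> h \<circ> k = e"
    "\<And>x h. x \<in> S0 \<Longrightarrow> h \<in> L \<Longrightarrow> x \<circ> h \<in> L"
    "\<And>s h. h \<in> L \<Longrightarrow> \<gamma> s \<circ> h \<circ> \<gamma> (- s) \<in> L"
    by (rule N.kernel_group) blast
  have LS: "h \<in> S" if "h \<in> L" for h using that L(2) S0_subset by auto
  interpret G: compact_operator_group wap L e C
  proof
    show "\<exists>c::('x \<Rightarrow> 'x) \<Rightarrow> nat. finite (c ` L) \<and> (\<forall>h\<in>L. \<forall>k\<in>L. c h = c k \<longrightarrow> norm (h x - k x) \<le> \<epsilon>)"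
      if "x \<in> wap" "0 < \<epsilon>" for x \<epsilon>
      by (rule compact_group_precompact_orbits[OF L(1,3-7) that])
  qed (use subspace_wap closed_wap LS C L in \<open>auto simp: S_wap S_add S_scaleR S_bound\<close>)
  obtain M where M: "\<And>x. x \<in> wap \<Longrightarrow> M x \<in> wap"
    "\<And>x y. x \<in> wap \<Longrightarrow> y \<in> wap \<Longrightarrow> M (x + y) = M x + M y"
    "\<And>x. x \<in> wap \<Longrightarrow> norm (M x) \<le> C * norm x"
    "\<And>h x. h \<in> L \<Longrightarrow> x \<in> wap \<Longrightarrow> h (M x) = M x" "\<And>h x. h \<in> L \<Longrightarrow> x \<in> wap \<Longrightarrow> M (h x) = M x"
    "\<And>\<Xi> \<epsilon>. finite \<Xi> \<Longrightarrow> \<Xi> \<subseteq> wap \<Longrightarrow> 0 < \<epsilon> \<Longrightarrow>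
       \<exists>A. finite A \<and> A \<noteq> {} \<and> A \<subseteq> L \<and> (\<forall>x\<in>\<Xi>. norm (M x - average A x) \<le> \<epsilon>)"
    by (rule G.mean_exists) blast
  have M_scaleC: "M (a *\<^sub>C x) = a *\<^sub>C M x" if x: "x \<in> wap" for a x
  proof (rule eq_if_norm_diff_le[where D = "1 + cmod a"])
    fix \<epsilon> :: real assume "0 < \<epsilon>"
    moreover have "{x, a *\<^sub>C x} \<subseteq> wap" using x by (simp add: wap_scaleC)
    ultimately obtain A where A: "A \<subseteq> L" "\<forall>z\<in>{x, a *\<^sub>C x}. norm (M z - average A z) \<le> \<epsilon>"
      using M(6)[of "{x, a *\<^sub>C x}" \<epsilon>] by blast
    note la = bounded_linear.linear[OF bounded_linear_scaleC[of a]]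
    have "average A (a *\<^sub>C x) = (1 / real (card A)) *\<^sub>R (\<Sum>h\<in>A. a *\<^sub>C h x)"
      unfolding average_def using A(1) LS x
      by (intro arg_cong[where f = "\<lambda>y. (1 / real (card A)) *\<^sub>R y"] sum.cong refl S_scaleC) auto
    also have "\<dots> = a *\<^sub>C average A x"
      by (simp add: average_def linear_sum[OF la] linear_scale[OF la])
    finally have "M (a *\<^sub>C x) - a *\<^sub>C M x = (M (a *\<^sub>C x) - average A (a *\<^sub>C x)) - a *\<^sub>C (M x - average A x)"
      by (simp add: linear_diff[OF la])
    also have "norm \<dots> \<le> \<epsilon> + cmod a * \<epsilon>"
    proof -
      have "norm (a *\<^sub>C (M x - average A x)) \<le> cmod a * \<epsilon>"
        using A(2) unfolding norm_scaleC by (intro mult_left_mono) auto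
      moreover have "norm (M (a *\<^sub>C x) - average A (a *\<^sub>C x)) \<le> \<epsilon>" using A(2) by simp
      ultimately show ?thesis
        using norm_triangle_ineq4[of "M (a *\<^sub>C x) - average A (a *\<^sub>C x)" "a *\<^sub>C (M x - average A x)"] by linarith
    qed
    finally show "norm (M (a *\<^sub>C x) - a *\<^sub>C M x) \<le> (1 + cmod a) * \<epsilon>" by (simp add: algebra_simps)
  qed (simp add: add_pos_nonneg)
  have S0_M: "T (M x) = M x" if T: "T \<in> S0" and x: "x \<in> wap" for T x
  proof -
    have "(T \<circ> e) (M x) = M x" using L(8)[OF T L(3)] x by (rule M(4))
    then show ?thesis using M(4)[OF L(3) x] by simp
  qed
  have M_fixed: "M x = x" if x: "x \<in> wap" and fixed: "\<And>T. T \<in> S0 \<Longrightarrow> T x = x" for x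
  proof (rule eq_if_norm_diff_le[where D = 1])
    fix \<epsilon> :: real assume "0 < \<epsilon>"
    then obtain A where A: "finite A" "A \<noteq> {}" "A \<subseteq> L" "norm (M x - average A x) \<le> \<epsilon>"
      using M(6)[of "{x}" \<epsilon>] x by auto
    have "(\<Sum>h\<in>A. h x) = (\<Sum>h\<in>A. x)" 
    proof (rule sum.cong)
      show "h x = x" if "h \<in> A" for h using that A(3) L(2) by (intro fixed) blast
    qed simp
    then have "average A x = x" using A(1,2) by (simp add: average_def sum_constant_scaleR)
    then show "norm (M x - x) \<le> 1 * \<epsilon>" using A(4) by simp
  qed simp
  have M_idem: "M (M x) = M x" if "x \<in> wap" for x
  proof (rule M_fixed[OF M(1)[OF that]])
    show "T (M x) = M x" if "T \<in> S0" for T using that \<open>x \<in> wap\<close> by (rule S0_M)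
  qed
  have M_diff: "M (x - y) = M x - M y" if "x \<in> wap" "y \<in> wap" for x y
    using M(2)[of "x - y" y] that subspace_diff[OF subspace_wap] by simp
  have M_comm: "M (\<rho> s x) = \<rho> s (M x)" if x: "x \<in> wap" for s x
  proof (rule eq_if_norm_diff_le[where D = "C * C"])
    fix \<epsilon> :: real assume "0 < \<epsilon>"
    then obtain A where A: "finite A" "A \<noteq> {}" "A \<subseteq> L" "norm (M x - average A x) \<le> \<epsilon>"
      using M(6)[of "{x}" \<epsilon>] x by auto
    have Mx: "M x \<in> wap" and Ax: "average A x \<in> wap"
      using M(1)[OF x] G.average_mem[OF A(3) x] by auto
    \<comment> \<open>The translate of a vector fixed by \<open>S0\<close> is again fixed by \<open>S0\<close>.\<close>
    have 1: "M (\<rho> s (M x)) = \<rho> s (M x)"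
    proof (rule M_fixed)
      show "\<rho> s (M x) \<in> wap" by (rule act_wap[OF Mx])
      fix T assume T: "T \<in> S0"
      have "\<gamma> (- s) \<circ> T \<circ> \<gamma> (- (- s)) \<in> S0" by (rule S0_conj[OF T])
      from S0_M[OF this x] have "\<rho> (- s) (T (\<rho> s (M x))) = M x"
        using T S0_subset Mx by (simp add: \<gamma>_wap act_wap S_wap subset_iff)
      then show "T (\<rho> s (M x)) = \<rho> s (M x)" by (metis act_cancel(2))
    qed
    \<comment> \<open>Each \<open>\<rho> s (h x)\<close> is \<open>h' (\<rho> s x)\<close> with \<open>h'\<close> the conjugate of \<open>h\<close>, and \<open>M h' = M\<close>.\<close>
    have 2: "M (\<rho> s (average A x)) = M (\<rho> s x)"
    proof -
      have each: "M (\<rho> s (h x)) = M (\<rho> s x)" "\<rho> s (h x) \<in> wap" if h: "h \<in> L" for h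
      proof -
        have "(\<gamma> s \<circ> h \<circ> \<gamma> (- s)) (\<rho> s x) = \<rho> s (h x)"
          using x h LS by (simp add: \<gamma>_wap act_wap act_cancel S_wap)
        then show "M (\<rho> s (h x)) = M (\<rho> s x)" using M(5)[OF L(9)[OF h], of "\<rho> s x" s] act_wap[OF x] by simp
        show "\<rho> s (h x) \<in> wap" using h LS x by (simp add: act_wap S_wap)
      qed
      have M0: "M 0 = 0" using M(2)[of 0 0] subspace_0[OF subspace_wap] by simp
      have "M (\<Sum>h\<in>B. \<rho> s (h x)) = real (card B) *\<^sub>R M (\<rho> s x)" if "finite B" "B \<subseteq> L" for B
        using that
      proof (induction B rule: finite_induct)
        case (insert h B)
        have "(\<Sum>h\<in>B. \<rho> s (h x)) \<in> wap" using insert.prems each(2) by (intro subspace_sum[OF subspace_wap]) auto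
        then show ?case using insert each by (simp add: M(2) scaleR_add_left)
      qed (simp add: M0)
      from this[OF A(1,3)] have sum: "M (\<Sum>h\<in>A. \<rho> s (h x)) = real (card A) *\<^sub>R M (\<rho> s x)" .
      have "(\<Sum>h\<in>A. \<rho> s (h x)) \<in> wap" using A(3) each(2) by (intro subspace_sum[OF subspace_wap]) auto
      moreover have "\<rho> s (average A x) = complex_of_real (1 / real (card A)) *\<^sub>C (\<Sum>h\<in>A. \<rho> s (h x))"
        unfolding scaleC_of_real average_def
        by (simp add: linear_sum[OF bounded_linear.linear[OF linear_act]] linear_scale[OF bounded_linear.linear[OF linear_act]])
      ultimately have "M (\<rho> s (average A x)) = complex_of_real (1 / real (card A)) *\<^sub>C (real (card A) *\<^sub>R M (\<rho> s x))"
        by (simp only: M_scaleC sum)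
      then show ?thesis unfolding scaleC_of_real using A(1,2) by simp
    qed
    have "M (\<rho> s x) - \<rho> s (M x) = M (\<rho> s (average A x - M x))"
      using 1 2 M_diff[OF act_wap[OF Ax] act_wap[OF Mx]] by (simp add: act_simps)
    also have "norm \<dots> \<le> C * norm (\<rho> s (average A x - M x))"
      by (intro M(3) act_wap subspace_diff[OF subspace_wap] Ax Mx)
    also have "\<dots> \<le> C * (C * norm (average A x - M x))"
      using C act_bound by (intro mult_left_mono) auto
    also have "\<dots> \<le> C * (C * \<epsilon>)"
      using C A(4) by (intro mult_left_mono) (auto simp: norm_minus_commute)
    finally show "norm (M (\<rho> s x) - \<rho> s (M x)) \<le> C * C * \<epsilon>" by (simp add: mult.assoc)
  qed (use C in simp)
  show thesis
  proof (rule that[of M])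
    show "M x = x \<longleftrightarrow> continuous_map euclidean weak_topology (\<lambda>s. \<rho> s x)" if x: "x \<in> wap" for x
    proof
      assume "M x = x"
      then have "T x = x" if "T \<in> S0" for T using S0_M[OF that x] by simp
      then show "continuous_map euclidean weak_topology (\<lambda>s. \<rho> s x)" by (rule fixed_vector_continuous[OF x])
    next
      assume "continuous_map euclidean weak_topology (\<lambda>s. \<rho> s x)"
      then have "T x = x" if "T \<in> S0" for T using continuous_vector_fixed[OF x _ that] by blast
      then show "M x = x" by (rule M_fixed[OF x])
    qed
    show "\<exists>A. finite A \<and> A \<noteq> {} \<and> A \<subseteq> S \<and> (\<forall>x\<in>\<Xi>. norm (M x - average A x) \<le> \<epsilon>)"
      if "finite \<Xi>" "\<Xi> \<subseteq> wap" "0 < \<epsilon>" for \<Xi> \<epsilon>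
      using M(6)[OF that] LS by blast
  qed (fact M(1) M(2) M_scaleC M(3) M_idem M_comm)+
qed

end

section \<open>Reducing subspaces of weakly almost periodic representations\<close>

lemma openin_weak_imp_open:
  assumes "openin weak_topology (U :: 'a::complex_normed_vector set)"
  shows "open U"
proof -
  have "continuous_map euclidean weak_topology (\<lambda>x::'a. x)"
    by (rule continuous_map_into_weak) (simp add: linear_continuous_on)
  from openin_continuous_map_preimage[OF this assms] show ?thesis by simp
qed

lemma pw_closure_of_norm_approx:
  fixes f :: "'i \<Rightarrow> 'a::complex_normed_vector"
  assumes "\<And>\<Xi> \<epsilon>. finite \<Xi> \<Longrightarrow> 0 < \<epsilon> \<Longrightarrow> \<exists>g\<in>Q. \<forall>x\<in>\<Xi>. norm (f x - g x) \<le> \<epsilon>"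
  shows "f \<in> pw closure_of Q"
  unfolding in_closure_of
proof (intro conjI allI impI, simp, elim conjE)
  fix T assume "f \<in> T" "openin pw T"
  then obtain U where U: "finite {i. U i \<noteq> UNIV}" "\<And>i. openin weak_topology (U i)" "\<And>i. f i \<in> U i" "PiE UNIV U \<subseteq> T"
    unfolding openin_product_topology_alt by (auto simp: PiE_iff)
  have "\<exists>\<epsilon>>0. \<forall>i\<in>I. cball (f i) \<epsilon> \<subseteq> U i" if "finite I" for I
    using that
  proof (induction I rule: finite_induct)
    case empty
    show ?case by (intro exI[of _ 1]) simp
  next
    case (insert i I)
    then obtain \<epsilon> where \<epsilon>: "0 < \<epsilon>" "\<forall>j\<in>I. cball (f j) \<epsilon> \<subseteq> U j" by blast
    obtain \<delta> where \<delta>: "0 < \<delta>" "cball (f i) \<delta> \<subseteq> U i"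
      using openin_weak_imp_open[OF U(2)] U(3) open_contains_cball by metis
    have "cball (f j) (min \<epsilon> \<delta>) \<subseteq> U j" if "j \<in> insert i I" for j
      using that \<epsilon>(2) \<delta>(2) by fastforce
    then show ?case using \<epsilon>(1) \<delta>(1) by (intro exI[of _ "min \<epsilon> \<delta>"]) auto
  qed
  from this[OF U(1)] obtain \<epsilon> where \<epsilon>: "0 < \<epsilon>" "\<And>i. U i \<noteq> UNIV \<Longrightarrow> cball (f i) \<epsilon> \<subseteq> U i" by auto
  obtain g where g: "g \<in> Q" "\<forall>x\<in>{i. U i \<noteq> UNIV}. norm (f x - g x) \<le> \<epsilon>" using assms[OF U(1) \<epsilon>(1)] by blast
  have "g i \<in> U i" for i
  proof (cases "U i = UNIV")
    case False
    then have "g i \<in> cball (f i) \<epsilon>" using g(2) by (simp add: dist_norm)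
    then show ?thesis using \<epsilon>(2)[OF False] by blast
  qed simp
  then have "g \<in> T" using U(4) by (auto simp: PiE_iff)
  then show "\<exists>y. y \<in> Q \<and> y \<in> T" using g(1) by blast
qed

text \<open>The combination is continuous in each argument separately, so one argument at a time can be taken from
  \<open>A\<close> to its closure.\<close>

lemma pw_closure_convex:
  fixes A :: "('i \<Rightarrow> 'a::complex_normed_vector) set"
  assumes conv: "\<And>f g. f \<in> A \<Longrightarrow> g \<in> A \<Longrightarrow> (\<lambda>x. a *\<^sub>R f x + b *\<^sub>R g x) \<in> A"
    and f: "f \<in> pw closure_of A" and g: "g \<in> pw closure_of A"
  shows "(\<lambda>x. a *\<^sub>R f x + b *\<^sub>R g x) \<in> pw closure_of A"
proof -
  have cont: "continuous_map pw pw (\<lambda>f::'i \<Rightarrow> 'a. \<lambda>x. a *\<^sub>R f x + b *\<^sub>R g x)"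
    "continuous_map pw pw (\<lambda>g::'i \<Rightarrow> 'a. \<lambda>x. a *\<^sub>R f x + b *\<^sub>R g x)" for f g
    by (intro continuous_map_into_pw continuous_map_weak_add
        continuous_map_weak_linear_compose[OF _ bounded_linear_scaleR_right] continuous_map_pw_eval; simp)+
  have 1: "(\<lambda>x. a *\<^sub>R f x + b *\<^sub>R g x) \<in> pw closure_of A" if f: "f \<in> A" for f
  proof -
    have "(\<lambda>x. a *\<^sub>R f x + b *\<^sub>R g x) \<in> (\<lambda>g. \<lambda>x. a *\<^sub>R f x + b *\<^sub>R g x) ` (pw closure_of A)"
      using g by blast
    also have "\<dots> \<subseteq> pw closure_of ((\<lambda>g. \<lambda>x. a *\<^sub>R f x + b *\<^sub>R g x) ` A)"
      by (rule continuous_map_image_closure_subset[OF cont(2)])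
    also have "\<dots> \<subseteq> pw closure_of A" using conv f by (intro closure_of_mono) blast
    finally show ?thesis .
  qed
  have "(\<lambda>x. a *\<^sub>R f x + b *\<^sub>R g x) \<in> (\<lambda>f. \<lambda>x. a *\<^sub>R f x + b *\<^sub>R g x) ` (pw closure_of A)"
    using f by blast
  also have "\<dots> \<subseteq> pw closure_of ((\<lambda>f. \<lambda>x. a *\<^sub>R f x + b *\<^sub>R g x) ` A)"
    by (rule continuous_map_image_closure_subset[OF cont(1)])
  also have "\<dots> \<subseteq> pw closure_of (pw closure_of A)" using 1 by (intro closure_of_mono) blast
  finally show ?thesis by simp
qed

lemma average_mem_convex:
  fixes Q :: "('a \<Rightarrow> 'b::real_vector) set"
  assumes conv: "\<And>f g a b. f \<in> Q \<Longrightarrow> g \<in> Q \<Longrightarrow> 0 \<le> a \<Longrightarrow> 0 \<le> b \<Longrightarrow> a + b = 1 \<Longrightarrow> (\<lambda>x. a *\<^sub>R f x + b *\<^sub>R g x) \<in> Q"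
    and A: "finite A" "A \<noteq> {}" "A \<subseteq> Q"
  shows "average A \<in> Q"
  using A
proof (induction A rule: finite_ne_induct)
  case (singleton f)
  then show ?case by (simp add: average_def[abs_def])
next
  case (insert f A)
  define n where "n = real (card A)"
  have n: "0 < n" using insert.hyps by (simp add: n_def card_gt_0_iff)
  have "average (insert f A) = (\<lambda>x. (1 / (n + 1)) *\<^sub>R f x + (n / (n + 1)) *\<^sub>R average A x)"
    using insert.hyps n by (auto simp: average_def fun_eq_iff n_def scaleR_add_right add.commute)
  also have "\<dots> \<in> Q"
    using insert n by (intro conv) (auto simp: field_simps)
  finally show ?case .
qed

text \<open>The weak operator topology is the pullback of pointwise weak convergence along the inclusion of the
  operators into the functions.\<close>

lemma openin_wo_topology:
  assumes "openin wo_topology (T :: ('x::complex_banach \<Rightarrow>\<^sub>L 'x) set)"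
  obtains U where "openin pw U" "T = {A \<in> bounded_operators. blinfun_apply A \<in> U}"
proof -
  let ?F = "{\<lambda>T. \<phi> (blinfun_apply T \<xi>) | (\<phi> :: 'x \<Rightarrow> complex) \<xi>. bounded_clinear \<phi>}"
  obtain T' where T': "openin (initial_topology ?F) T'" "T = T' \<inter> bounded_operators"
    using assms by (auto simp: wo_topology_def openin_subtopology)
  have "continuous_map (pullback_topology UNIV blinfun_apply pw) (initial_topology ?F) (\<lambda>T. T)"
  proof (rule continuous_map_into_initial_topology)
    fix \<Phi> assume "\<Phi> \<in> ?F"
    then obtain \<phi> \<xi> where \<phi>: "bounded_clinear \<phi>" "\<Phi> = (\<lambda>T. \<phi> (blinfun_apply T \<xi>))" by blast
    have "continuous_map weak_topology euclidean \<phi>"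
      unfolding weak_topology_def using \<phi>(1) by (intro continuous_map_initial_topology) simp
    from continuous_map_compose[OF continuous_map_pw_eval this]
    have "continuous_map pw euclidean (\<lambda>f. \<phi> (f \<xi>))" by (simp add: o_def)
    from continuous_map_pullback[OF this]
    show "continuous_map (pullback_topology UNIV blinfun_apply pw) euclidean (\<lambda>T. \<Phi> T)"
      by (simp add: o_def \<phi>(2))
  qed
  from openin_continuous_map_preimage[OF this T'(1)]
  have "openin (pullback_topology UNIV blinfun_apply pw) T'"
    by (simp add: topspace_pullback_topology)
  then obtain U where "openin pw U" "T' = blinfun_apply -` U"
    by (auto simp: openin_pullback_topology)
  then show thesis using T'(2) by (intro that[of U]) auto
qed

lemma topspace_wo [simp]: "topspace wo_topology = bounded_operators"
  by (auto simp: wo_topology_def initial_topology_def)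

lemma continuous_map_wo_eval: "continuous_map wo_topology weak_topology (\<lambda>T. blinfun_apply T \<xi>)"
  unfolding wo_topology_def weak_topology_def
  by (intro continuous_map_from_subtopology continuous_map_into_initial_topology continuous_map_initial_topology) blast

lemma convex_bounded_operators: "convex bounded_operators"
  unfolding convex_def bounded_operators_def bounded_clinear_def
proof (safe, goal_cases)
  case (1 A B u v)
  show ?case by (rule blinfun.bounded_linear_right)
next
  case (2 A B u v a x)
  have "r *\<^sub>R (a *\<^sub>C y) = a *\<^sub>C (r *\<^sub>R y)" for r and y :: 'a
    by (simp add: linear_scale[OF bounded_linear.linear[OF bounded_linear_scaleC]])
  then show ?case using 2 by (simp add: blinfun.add_left blinfun.scaleR_left scaleC_add_right)
qed

text \<open>Compactness of the closure of \<open>range \<pi>\<close> makes every orbit relatively weakly compact and, by uniform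
  boundedness twice, \<open>\<pi>\<close> bounded in norm. The projection is approximated in norm, at finitely many vectors,
  by averages of elements of \<open>S\<close>, and these lie in the closure of the convex hull.\<close>

lemma wap_representation_reducing:
  fixes \<pi> :: "'g::topological_group_add discrete \<Rightarrow> ('x::complex_banach \<Rightarrow>\<^sub>L 'x)"
  assumes wap: "wap_representation \<pi>"
  shows "reducing_subspace \<pi> (continuous_vectors \<pi>)"
proof -
  have rep: "range \<pi> \<subseteq> bounded_operators" "\<pi> 0 = id_blinfun" "\<And>s t. \<pi> (s + t) = \<pi> s o\<^sub>L \<pi> t"
    and comp: "compactin wo_topology (wo_topology closure_of range \<pi>)"
    using wap by (auto simp: wap_representation_def representation_def)
  define K where "K \<xi> = (\<lambda>T. blinfun_apply T \<xi>) ` (wo_topology closure_of range \<pi>)" for \<xi>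
  have K: "compactin weak_topology (K \<xi>)" for \<xi>
    unfolding K_def by (rule image_compactin[OF comp continuous_map_wo_eval])
  have in_K: "\<pi> s \<xi> \<in> K \<xi>" for s \<xi>
    using closure_of_subset[of "range \<pi>" wo_topology] rep(1) by (auto simp: K_def)
  have "\<exists>B. \<forall>s\<in>UNIV. norm (\<pi> s \<xi>) \<le> B" for \<xi>
  proof -
    have "\<exists>B. \<forall>x\<in>K \<xi>. norm x \<le> B"
    proof (rule weakly_bounded_imp_bounded)
      fix f :: "'x \<Rightarrow> real" assume "bounded_linear f"
      then have "compactin euclideanreal (f ` K \<xi>)"
        by (intro image_compactin[OF K] continuous_map_weak_functional)
      then have "bounded (f ` K \<xi>)" by (simp add: compact_imp_bounded)
      then show "\<exists>B. \<forall>x\<in>K \<xi>. \<bar>f x\<bar> \<le> B" by (auto simp: bounded_iff)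
    qed
    then show ?thesis using in_K by blast
  qed
  then obtain C0 where C0: "\<And>s x. norm (\<pi> s x) \<le> C0 * norm x"
    using uniform_boundedness[of UNIV "\<lambda>s. blinfun_apply (\<pi> s)"] blinfun.bounded_linear_right by (metis UNIV_I)
  define C where "C = max 1 C0"
  have C: "norm (\<pi> s x) \<le> C * norm x" for s x
    using C0[of s x] mult_right_mono[of C0 C "norm x"] by (simp add: C_def)
  define \<rho> where "\<rho> s = blinfun_apply (\<pi> (discrete s))" for s :: 'g
  interpret bounded_action \<rho> C
  proof
    show "bounded_clinear (\<rho> s)" for s using rep(1) by (auto simp: \<rho>_def bounded_operators_def)
    have "discrete (s + t) = discrete s + discrete t" for s t :: 'g
      by (simp add: plus_discrete_def discrete_inverse)
    then show "\<rho> (s + t) x = \<rho> s (\<rho> t x)" for s t x by (simp add: \<rho>_def rep(3))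
    show "\<rho> 0 x = x" for x using rep(2) by (simp add: \<rho>_def flip: zero_discrete_def)
  qed (use C in \<open>simp_all add: C_def \<rho>_def\<close>)
  have all: "x \<in> wap" for x
  proof (rule wapI(1)[OF K[of x]])
    show "orbit x \<subseteq> K x" using in_K by (auto simp: orbit_def \<rho>_def)
  qed
  obtain M where M: "\<And>x y. x \<in> wap \<Longrightarrow> y \<in> wap \<Longrightarrow> M (x + y) = M x + M y"
    "\<And>a x. x \<in> wap \<Longrightarrow> M (a *\<^sub>C x) = a *\<^sub>C M x" "\<And>x. x \<in> wap \<Longrightarrow> norm (M x) \<le> C * norm x"
    "\<And>x. x \<in> wap \<Longrightarrow> M (M x) = M x" "\<And>s x. x \<in> wap \<Longrightarrow> M (\<rho> s x) = \<rho> s (M x)"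
    "\<And>x. x \<in> wap \<Longrightarrow> M x = x \<longleftrightarrow> continuous_map euclidean weak_topology (\<lambda>s. \<rho> s x)"
    "\<And>\<Xi> \<epsilon>. finite \<Xi> \<Longrightarrow> \<Xi> \<subseteq> wap \<Longrightarrow> 0 < \<epsilon> \<Longrightarrow>
       \<exists>A. finite A \<and> A \<noteq> {} \<and> A \<subseteq> S \<and> (\<forall>x\<in>\<Xi>. norm (M x - average A x) \<le> \<epsilon>)"
    by (rule continuous_projection) blast
  note M' = M(1)[OF all all] M(2-6)[OF all]
  have blM: "bounded_linear M"
  proof (rule bounded_linear_intro)
    show "M (r *\<^sub>R x) = r *\<^sub>R M x" for r x using M'(2)[of "complex_of_real r" x] by (simp add: scaleC_of_real)
    show "norm (M x) \<le> norm x * C" for x using M'(3)[of x] by (simp add: mult.commute)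
  qed (rule M'(1))
  define P where "P = Blinfun M"
  have P: "blinfun_apply P = M" unfolding P_def by (rule bounded_linear_Blinfun_apply[OF blM])
  have Pop: "P \<in> bounded_operators"
    using blM M'(2) by (simp add: bounded_operators_def bounded_clinear_def P)
  let ?conv = "convex hull (range \<pi>)"
  have conv_sub: "?conv \<subseteq> bounded_operators" by (intro hull_minimal rep(1) convex_bounded_operators)
  define Q where "Q = pw closure_of (blinfun_apply ` ?conv)"
  have Q_convex: "(\<lambda>x. a *\<^sub>R f x + b *\<^sub>R g x) \<in> Q"
    if "f \<in> Q" "g \<in> Q" "0 \<le> a" "0 \<le> b" "a + b = 1" for f g a b
    unfolding Q_def
  proof (rule pw_closure_convex)
    fix f g assume "f \<in> blinfun_apply ` ?conv" "g \<in> blinfun_apply ` ?conv"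
    then obtain A B where "A \<in> ?conv" "B \<in> ?conv" "f = blinfun_apply A" "g = blinfun_apply B" by blast
    moreover from this have "a *\<^sub>R A + b *\<^sub>R B \<in> ?conv"
      using that(3-5) by (intro convexD convex_convex_hull)
    ultimately show "(\<lambda>x. a *\<^sub>R f x + b *\<^sub>R g x) \<in> blinfun_apply ` ?conv"
      by (intro image_eqI[of _ _ "a *\<^sub>R A + b *\<^sub>R B"]) (auto simp: blinfun.add_left blinfun.scaleR_left)
  qed (use that in \<open>simp_all add: Q_def\<close>)
  \<comment> \<open>As \<open>wap\<close> is the whole space, \<open>\<gamma> s\<close> is \<open>\<pi> s\<close> itself.\<close>
  have "\<gamma> s \<in> blinfun_apply ` ?conv" for s
  proof (rule image_eqI)
    show "\<gamma> s = blinfun_apply (\<pi> (discrete s))" by (rule ext) (simp add: \<gamma>_def all \<rho>_def)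
  qed (simp add: hull_inc)
  then have SQ: "S \<subseteq> Q" unfolding S_def Q_def by (intro closure_of_mono) blast
  have "M \<in> pw closure_of Q"
  proof (rule pw_closure_of_norm_approx)
    fix \<Xi> :: "'x set" and \<epsilon> :: real assume "finite \<Xi>" "0 < \<epsilon>"
    then obtain A where A: "finite A" "A \<noteq> {}" "A \<subseteq> S" "\<forall>x\<in>\<Xi>. norm (M x - average A x) \<le> \<epsilon>"
      using M(7)[of \<Xi> \<epsilon>] all by blast
    have "average A \<in> Q"
      using A SQ by (intro average_mem_convex Q_convex) auto
    then show "\<exists>g\<in>Q. \<forall>x\<in>\<Xi>. norm (M x - g x) \<le> \<epsilon>" using A(4) by blast
  qed
  then have MQ: "M \<in> pw closure_of (blinfun_apply ` ?conv)" by (simp add: Q_def)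
  have "P \<in> Aff_wo \<pi>"
    unfolding Aff_wo_def in_closure_of
  proof (intro conjI allI impI, simp add: Pop, elim conjE)
    fix T assume "P \<in> T" "openin wo_topology T"
    then obtain U where U: "openin pw U" "T = {A \<in> bounded_operators. blinfun_apply A \<in> U}"
      using openin_wo_topology by metis
    have "M \<in> U" using \<open>P \<in> T\<close> U(2) P by simp
    then obtain B where "B \<in> ?conv" "blinfun_apply B \<in> U" using MQ U(1) unfolding in_closure_of by blast
    then show "\<exists>y. y \<in> ?conv \<and> y \<in> T" using U(2) conv_sub by blast
  qed
  moreover have "P o\<^sub>L P = P" by (rule blinfun_eqI) (simp add: P M'(4))
  moreover have "\<pi> s o\<^sub>L P = P o\<^sub>L \<pi> s" for s
    using M'(5)[of "of_discrete s"] by (intro blinfun_eqI) (simp add: P \<rho>_def of_discrete_inverse)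
  moreover have "continuous_vectors \<pi> = range (blinfun_apply P)"
  proof -
    have "continuous_vectors \<pi> = {x. M x = x}" by (simp add: continuous_vectors_def M'(6) \<rho>_def)
    also have "\<dots> = range M"
    proof safe
      show "x \<in> range M" if "M x = x" for x using that by (metis rangeI)
    qed (rule M'(4))
    finally show ?thesis by (simp add: P)
  qed
  ultimately show ?thesis unfolding reducing_subspace_def by blast
qed

section \<open>Weakly almost periodic functions\<close>

instance bcontfun :: (metric_space, complex_banach) complex_banach ..

lemma wap_functionsI:
  fixes u :: "'h::topological_group_add \<Rightarrow>\<^sub>C complex"
  assumes Q: "compactin weak_topology Q" and sub: "\<And>s. right_translate u s \<in> Q"
  shows "u \<in> wap_functions"
proof -
  have "weak_topology closure_of range (right_translate u) \<subseteq> Q"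
    using sub by (intro closure_of_minimal compactin_imp_closedin[OF Hausdorff_weak Q]) auto
  then have "compactin weak_topology (weak_topology closure_of range (right_translate u))"
    by (rule closed_compactin[OF Q]) simp
  then show ?thesis by (simp add: wap_functions_def)
qed

lemma wap_functions_compact:
  assumes "u \<in> wap_functions"
  obtains Q where "compactin weak_topology Q" "\<And>s. right_translate u s \<in> Q"
proof
  show "compactin weak_topology (weak_topology closure_of range (right_translate u))"
    using assms by (simp add: wap_functions_def)
  show "right_translate u s \<in> weak_topology closure_of range (right_translate u)" for s
    using closure_of_subset[of "range (right_translate u)" weak_topology] by auto
qed

lemma bounded_clinear_evaluation: "bounded_clinear (\<lambda>u::'a::topological_space \<Rightarrow>\<^sub>C complex. apply_bcontfun u t)"
  unfolding bounded_clinear_def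
proof
  show "bounded_linear (\<lambda>u::'a \<Rightarrow>\<^sub>C complex. apply_bcontfun u t)"
    by (rule bounded_linear_intro[where K = 1]) (simp_all add: norm_bounded)
qed (simp add: scaleC_bcontfun.rep_eq)

lemma continuous_map_weak_evaluation:
  "continuous_map weak_topology euclidean (\<lambda>u::'a::topological_space \<Rightarrow>\<^sub>C complex. apply_bcontfun u t)"
  unfolding weak_topology_def by (rule continuous_map_initial_topology) (simp add: bounded_clinear_evaluation)

lemma bounded_linear_left_translate: "bounded_linear (left_translate s)"
proof (rule bounded_linear_intro[where K = 1])
  show "norm (left_translate s u) \<le> norm u * 1" for u
    by (rule norm_bound) (simp add: left_translate.rep_eq norm_bounded)
qed (auto intro!: bcontfun_eqI simp: left_translate.rep_eq)

lemma bounded_clinear_right_translate: "bounded_clinear (\<lambda>u. right_translate u s)"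
  unfolding bounded_clinear_def
proof
  show "bounded_linear (\<lambda>u. right_translate u s)"
  proof (rule bounded_linear_intro[where K = 1])
    show "norm (right_translate u s) \<le> norm u * 1" for u
      by (rule norm_bound) (simp add: right_translate.rep_eq norm_bounded)
  qed (auto intro!: bcontfun_eqI simp: right_translate.rep_eq)
qed (auto intro!: bcontfun_eqI simp: right_translate.rep_eq scaleC_bcontfun.rep_eq)

lemma translate_commute: "right_translate (left_translate s u) t = left_translate s (right_translate u t)"
  by (rule bcontfun_eqI) (simp add: left_translate.rep_eq right_translate.rep_eq add.assoc)

lemma right_translate_add: "right_translate (right_translate u s) t = right_translate u (s + t)"
  by (rule bcontfun_eqI) (simp add: right_translate.rep_eq add.assoc)

lemma translation_invariant_wap_functions:
  "translation_invariant (wap_functions :: ('h::topological_group_add \<Rightarrow>\<^sub>C complex) set)"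
  unfolding translation_invariant_def
proof (intro ballI allI conjI)
  fix u :: "'h \<Rightarrow>\<^sub>C complex" and s assume "u \<in> wap_functions"
  then obtain Q where Q: "compactin weak_topology Q" "\<And>s. right_translate u s \<in> Q"
    by (rule wap_functions_compact) blast
  show "right_translate u s \<in> wap_functions"
    by (rule wap_functionsI[OF Q(1)]) (simp add: right_translate_add Q(2))
  have "compactin weak_topology (left_translate s ` Q)"
    by (rule image_compactin[OF Q(1) bounded_linear_weakly_continuous[OF bounded_linear_left_translate]])
  then show "left_translate s u \<in> wap_functions"
    by (rule wap_functionsI) (simp add: translate_commute Q(2))
qed

subsection \<open>The functions on the group inside the functions on the discrete group\<close>

lemma norm_on_discrete: "norm (on_discrete w) = norm w"
proof (rule antisym)
  show "norm (on_discrete w) \<le> norm w"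
    by (rule norm_bound) (simp add: on_discrete.rep_eq norm_bounded)
  show "norm w \<le> norm (on_discrete w)"
  proof (rule norm_bound)
    show "norm (apply_bcontfun w x) \<le> norm (on_discrete w)" for x
      using norm_bounded[of "on_discrete w" "discrete x"] by (simp add: on_discrete.rep_eq discrete_inverse)
  qed
qed

lemma on_discrete_add: "on_discrete (u + v) = on_discrete u + on_discrete v"
  and on_discrete_scaleR: "on_discrete (r *\<^sub>R u) = r *\<^sub>R on_discrete u"
  by (auto intro!: bcontfun_eqI simp: on_discrete.rep_eq)

lemma linear_on_discrete: "linear on_discrete"
  by (rule linearI) (simp_all add: on_discrete_add on_discrete_scaleR)

lemma bounded_linear_on_discrete: "bounded_linear on_discrete"
  by (rule bounded_linear_intro[where K = 1]) (simp_all add: on_discrete_add on_discrete_scaleR norm_on_discrete)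

lemma inj_on_discrete: "inj on_discrete"
  unfolding linear_injective_0[OF linear_on_discrete] by (metis norm_eq_zero norm_on_discrete)

lemma right_translate_on_discrete: "right_translate (on_discrete w) s = on_discrete (right_translate w (of_discrete s))"
  and left_translate_on_discrete: "left_translate s (on_discrete w) = on_discrete (left_translate (of_discrete s) w)"
  by (auto intro!: bcontfun_eqI simp: on_discrete.rep_eq right_translate.rep_eq left_translate.rep_eq
      plus_discrete_def discrete_inverse)

lemma in_range_on_discrete:
  fixes u :: "'g::topological_space discrete \<Rightarrow>\<^sub>C complex"
  assumes "continuous_on UNIV (\<lambda>s. apply_bcontfun u (discrete s))"
  obtains w where "u = on_discrete w"
proof
  have "(\<lambda>s. apply_bcontfun u (discrete s)) \<in> bcontfun"
    using assms norm_bounded[of u] by (auto simp: bcontfun_def intro!: boundedI)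
  then have "apply_bcontfun (Bcontfun (\<lambda>s. apply_bcontfun u (discrete s))) = (\<lambda>s. apply_bcontfun u (discrete s))"
    by (rule Bcontfun_inverse)
  then show "u = on_discrete (Bcontfun (\<lambda>s. apply_bcontfun u (discrete s)))"
    by (intro bcontfun_eqI) (simp add: on_discrete.rep_eq of_discrete_inverse)
qed

lemma closed_range_on_discrete: "closed (range (on_discrete :: ('g::topological_space \<Rightarrow>\<^sub>C complex) \<Rightarrow> _))"
  unfolding closed_sequential_limits
proof (intro allI impI, elim conjE)
  fix U :: "nat \<Rightarrow> 'g discrete \<Rightarrow>\<^sub>C complex" and u
  assume U: "\<forall>n. U n \<in> range on_discrete" and lim: "U \<longlonglongrightarrow> u"
  have "uniform_limit UNIV (\<lambda>n. apply_bcontfun (U n)) (apply_bcontfun u) sequentially"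
    by (rule tendsto_bcontfun_uniform_limit[OF lim])
  then have "uniform_limit UNIV (\<lambda>n s. apply_bcontfun (U n) (discrete s)) (\<lambda>s. apply_bcontfun u (discrete s)) sequentially"
    by (auto simp: uniform_limit_iff elim!: eventually_mono)
  moreover have "continuous_on UNIV (\<lambda>s. apply_bcontfun (U n) (discrete s))" for n
  proof -
    obtain w where "U n = on_discrete w" using U by auto
    then show ?thesis by (simp add: on_discrete.rep_eq discrete_inverse continuous_on_apply_bcontfun)
  qed
  ultimately have "continuous_on UNIV (\<lambda>s. apply_bcontfun u (discrete s))"
    by (intro uniform_limit_theorem[where F = sequentially]) auto
  then show "u \<in> range on_discrete" using in_range_on_discrete by blast
qed

text \<open>The image of the continuous functions is a closed subspace, so it contains the weak closure of the
  orbit; and by the Hahn-Banach theorem the inverse of the isometry is weakly continuous on this image.\<close>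

lemma wap_functions_of_on_discrete:
  fixes w :: "'g::topological_group_add \<Rightarrow>\<^sub>C complex"
  assumes "on_discrete w \<in> wap_functions"
  shows "w \<in> wap_functions"
proof -
  let ?R = "range (on_discrete :: ('g \<Rightarrow>\<^sub>C complex) \<Rightarrow> _)"
  obtain Q where Q: "compactin weak_topology Q" "\<And>s. right_translate (on_discrete w) s \<in> Q"
    using assms by (rule wap_functions_compact) blast
  have "closedin weak_topology ?R"
    using linear_subspace_image[OF linear_on_discrete subspace_UNIV] closed_range_on_discrete
    by (intro closedin_weak_subspace) auto
  then have QR: "compactin weak_topology (Q \<inter> ?R)"
    using Q(1) by (metis Int_commute closed_Int_compactin)
  have "continuous_map (subtopology weak_topology (Q \<inter> ?R)) weak_topology (inv on_discrete)"
  proof (rule continuous_map_into_weak)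
    fix \<psi> :: "('g \<Rightarrow>\<^sub>C complex) \<Rightarrow> real" assume \<psi>: "bounded_linear \<psi>"
    interpret \<psi>: bounded_linear \<psi> by fact
    obtain B where B: "0 \<le> B" "\<And>v. \<bar>\<psi> v\<bar> \<le> norm v * B" using \<psi>.nonneg_bounded by auto
    obtain g where g: "bounded_linear g" "\<And>v. v \<in> UNIV \<Longrightarrow> g (on_discrete v) = \<psi> v"
      by (rule functional_extends_along_isometry[of UNIV on_discrete \<psi> B])
         (use B in \<open>auto simp: on_discrete_add on_discrete_scaleR norm_on_discrete \<psi>.add \<psi>.scaleR mult.commute\<close>)
    have "continuous_map (subtopology weak_topology (Q \<inter> ?R)) euclideanreal g"
      by (intro continuous_map_from_subtopology continuous_map_weak_functional g(1))
    then show "continuous_map (subtopology weak_topology (Q \<inter> ?R)) euclideanreal (\<lambda>v. \<psi> (inv on_discrete v))"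
      by (rule continuous_map_eq) (use g(2) in \<open>auto simp: inv_f_f[OF inj_on_discrete]\<close>)
  qed
  moreover have "compactin (subtopology weak_topology (Q \<inter> ?R)) (Q \<inter> ?R)"
    using QR by (simp add: compactin_subtopology)
  ultimately have "compactin weak_topology (inv on_discrete ` (Q \<inter> ?R))" by (rule image_compactin[rotated])
  then show ?thesis
  proof (rule wap_functionsI)
    fix s
    have "on_discrete (right_translate w s) \<in> Q \<inter> ?R"
      using Q(2)[of "discrete s"] by (simp add: right_translate_on_discrete discrete_inverse)
    then show "right_translate w s \<in> inv on_discrete ` (Q \<inter> ?R)"
      by (rule rev_image_eqI) (simp add: inv_f_f[OF inj_on_discrete])
  qed
qed

lemma on_discrete_wap_functions:
  assumes "w \<in> wap_functions"
  shows "on_discrete w \<in> wap_functions"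
proof -
  obtain Q where Q: "compactin weak_topology Q" "\<And>s. right_translate w s \<in> Q"
    using assms by (rule wap_functions_compact) blast
  have "compactin weak_topology (on_discrete ` Q)"
    by (rule image_compactin[OF Q(1) bounded_linear_weakly_continuous[OF bounded_linear_on_discrete]])
  then show ?thesis by (rule wap_functionsI) (simp add: right_translate_on_discrete Q(2))
qed

lemma translation_invariant_on_discrete:
  "translation_invariant (on_discrete ` (wap_functions :: ('g::topological_group_add \<Rightarrow>\<^sub>C complex) set))"
  using translation_invariant_wap_functions[where 'h = 'g]
  by (auto simp: translation_invariant_def right_translate_on_discrete left_translate_on_discrete)

text \<open>Closed subsets of the compact set \<open>K\<close> have closed images under \<open>j\<close>, so preimages of closed sets under \<open>f\<close>
  are preimages of closed sets under \<open>j \<circ> f\<close>.\<close>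

lemma continuous_map_into_compact:
  assumes K: "compactin X K" and j: "continuous_map X Z j" "inj_on j K" and Z: "Hausdorff_space Z"
    and f: "\<And>t. t \<in> topspace Y \<Longrightarrow> f t \<in> K" "continuous_map Y Z (\<lambda>t. j (f t))"
  shows "continuous_map Y X f"
  unfolding continuous_map_closedin
proof (intro conjI allI impI)
  show "f \<in> topspace Y \<rightarrow> topspace X" using f(1) compactin_subset_topspace[OF K] by auto
  fix D assume "closedin X D"
  then have "compactin X (D \<inter> K)" using K by (metis closed_Int_compactin)
  then have "closedin Z (j ` (D \<inter> K))"
    by (intro compactin_imp_closedin[OF Z] image_compactin[OF _ j(1)])
  then have "closedin Y {t \<in> topspace Y. j (f t) \<in> j ` (D \<inter> K)}"
    by (rule closedin_continuous_map_preimage[OF f(2)])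
  moreover have "{t \<in> topspace Y. j (f t) \<in> j ` (D \<inter> K)} = {t \<in> topspace Y. f t \<in> D}"
    using f(1) j(2) by (auto simp: inj_on_def)
  ultimately show "closedin Y {t \<in> topspace Y. f t \<in> D}" by simp
qed

text \<open>Let the group act by \<open>\<rho> s u = u \<cdot> (- s)\<close>; the sign turns right translation into a left action with
  the same orbits, so its weakly almost periodic vectors are the functions in \<open>\<W>(G\<^sub>d)\<close>. Such a \<open>u\<close> is a
  continuous vector if and only if it is a continuous function on \<open>G\<close>: evaluation at \<open>0\<close> gives one
  direction. For the other, on the weakly compact orbit closure the weak topology is that of pointwise
  convergence, in which translation of a continuous function is continuous. The kernel of the
  projection is the complement.\<close>

lemma complemented_wap_functions:
  "complemented_in (on_discrete ` (wap_functions :: ('g::topological_group_add \<Rightarrow>\<^sub>C complex) set))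
     (wap_functions :: ('g discrete \<Rightarrow>\<^sub>C complex) set)"
proof -
  define \<rho> :: "'g \<Rightarrow> ('g discrete \<Rightarrow>\<^sub>C complex) \<Rightarrow> ('g discrete \<Rightarrow>\<^sub>C complex)"
    where "\<rho> s u = right_translate u (discrete (- s))" for s u
  have disc: "discrete s + discrete t = discrete (s + t)" "(0::'g discrete) = discrete 0" for s t :: 'g
    by (simp_all add: plus_discrete_def discrete_inverse zero_discrete_def)
  interpret bounded_action \<rho> 1
  proof
    show "bounded_clinear (\<rho> s)" for s
      unfolding \<rho>_def by (rule bounded_clinear_right_translate)
    show "\<rho> (s + t) u = \<rho> s (\<rho> t u)" for s t u
      by (simp add: \<rho>_def right_translate_add disc minus_add)
    show "\<rho> 0 u = u" for u
      unfolding \<rho>_def minus_zero disc(2)[symmetric] by (rule bcontfun_eqI) (simp add: right_translate.rep_eq)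
    show "norm (\<rho> s u) \<le> 1 * norm u" for s u
      unfolding \<rho>_def by (simp, rule norm_bound) (simp add: right_translate.rep_eq norm_bounded)
  qed simp
  have "range (right_translate u) = orbit u" for u
  proof -
    have "right_translate u s \<in> orbit u" for s
      unfolding orbit_def by (rule image_eqI[of _ _ "- of_discrete s"]) (simp_all add: \<rho>_def of_discrete_inverse)
    moreover have "orbit u \<subseteq> range (right_translate u)" by (auto simp: orbit_def \<rho>_def)
    ultimately show ?thesis by blast
  qed
  then have wap_eq: "wap_functions = wap"
    by (simp add: wap_functions_def wap_def orbit_closure_def)
  let ?W = "on_discrete ` (wap_functions :: ('g \<Rightarrow>\<^sub>C complex) set)"
  have cont: "continuous_map euclidean weak_topology (\<lambda>s. \<rho> s u) \<longleftrightarrow> u \<in> range on_discrete" if u: "u \<in> wap" for u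
  proof
    assume "continuous_map euclidean weak_topology (\<lambda>s. \<rho> s u)"
    from continuous_map_compose[OF this continuous_map_weak_evaluation[of 0]]
    have "continuous_on UNIV (\<lambda>s. apply_bcontfun u (discrete (- s)))"
      by (simp add: o_def \<rho>_def right_translate.rep_eq)
    then have "continuous_on UNIV (\<lambda>s. apply_bcontfun u (discrete (- (- s))))"
      by (rule continuous_on_compose2) (auto intro: continuous_intros)
    then show "u \<in> range on_discrete" using in_range_on_discrete[of u] by auto
  next
    assume "u \<in> range on_discrete"
    then obtain w where w: "u = on_discrete w" by blast
    show "continuous_map euclidean weak_topology (\<lambda>s. \<rho> s u)"
    proof (rule continuous_map_into_compact[OF compact_orbit_closure[OF u]])
      show "continuous_map weak_topology (product_topology (\<lambda>_. euclidean) UNIV)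
          (apply_bcontfun :: ('g discrete \<Rightarrow>\<^sub>C complex) \<Rightarrow> _)"
        by (subst continuous_map_componentwise_UNIV) (simp add: continuous_map_weak_evaluation)
      show "inj_on apply_bcontfun (orbit_closure u)" by (simp add: inj_on_def apply_bcontfun_inject)
      show "Hausdorff_space (product_topology (\<lambda>_::'g discrete. euclidean :: complex topology) UNIV)"
        by (simp add: Hausdorff_space_product_topology)
      show "continuous_map euclidean (product_topology (\<lambda>_. euclidean) UNIV) (\<lambda>s. apply_bcontfun (\<rho> s u))"
      proof (subst continuous_map_componentwise_UNIV, rule allI)
        fix t
        have "continuous_on UNIV (\<lambda>s. apply_bcontfun w (- s + of_discrete t))"
          by (rule continuous_on_compose2[OF continuous_on_apply_bcontfun[of UNIV]]) (intro continuous_intros subset_UNIV)+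
        then show "continuous_map euclidean euclidean (\<lambda>s. apply_bcontfun (\<rho> s u) t)"
          by (simp add: w \<rho>_def right_translate.rep_eq on_discrete.rep_eq plus_discrete_def discrete_inverse)
      qed
    qed (rule act_in_orbit_closure)
  qed
  have W: "?W = {u \<in> wap. continuous_map euclidean weak_topology (\<lambda>s. \<rho> s u)}"
  proof (intro equalityI subsetI)
    fix u assume "u \<in> ?W"
    then have "u \<in> wap" "u \<in> range on_discrete" using on_discrete_wap_functions wap_eq by blast+
    then show "u \<in> {u \<in> wap. continuous_map euclidean weak_topology (\<lambda>s. \<rho> s u)}" using cont by simp
  next
    fix u assume "u \<in> {u \<in> wap. continuous_map euclidean weak_topology (\<lambda>s. \<rho> s u)}"
    then have "u \<in> wap" "u \<in> range on_discrete" using cont by auto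
    then show "u \<in> ?W" using wap_functions_of_on_discrete wap_eq by blast
  qed
  obtain M where M: "\<And>u. u \<in> wap \<Longrightarrow> M u \<in> wap"
    "\<And>u v. u \<in> wap \<Longrightarrow> v \<in> wap \<Longrightarrow> M (u + v) = M u + M v"
    "\<And>a u. u \<in> wap \<Longrightarrow> M (a *\<^sub>C u) = a *\<^sub>C M u"
    "\<And>u. u \<in> wap \<Longrightarrow> norm (M u) \<le> 1 * norm u"
    "\<And>u. u \<in> wap \<Longrightarrow> M (M u) = M u"
    "\<And>u. u \<in> wap \<Longrightarrow> M u = u \<longleftrightarrow> continuous_map euclidean weak_topology (\<lambda>s. \<rho> s u)"
    by (rule continuous_projection) blast
  have W_M: "?W = {u \<in> wap. M u = u}" unfolding W using M(6) by blast
  define N where "N = {u \<in> wap. M u = 0}"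
  have sub: "u - v \<in> wap" if "u \<in> wap" "v \<in> wap" for u v
    using that subspace_diff[OF subspace_wap] by blast
  have M_diff: "M (u - v) = M u - M v" if "u \<in> wap" "v \<in> wap" for u v
    using M(2)[of "u - v" v] that sub by simp
  have M_lim: "(\<lambda>n. M (U n)) \<longlonglongrightarrow> M u" if U: "\<And>n. U n \<in> wap" and u: "u \<in> wap" and lim: "U \<longlonglongrightarrow> u" for U u
  proof (rule LIM_zero_cancel, rule Lim_null_comparison)
    show "\<forall>\<^sub>F n in sequentially. norm (M (U n) - M u) \<le> norm (U n - u)"
      using M(4)[OF sub[OF U u]] M_diff[OF U u] by simp
    show "(\<lambda>n. norm (U n - u)) \<longlonglongrightarrow> 0" using lim by (simp add: LIM_zero tendsto_norm_zero)
  qed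
  have z: "0 \<in> wap" by (rule subspace_0[OF subspace_wap])
  have M0: "M 0 = 0" using M_diff[OF z z] by simp
  have eigen: "csubspace {u \<in> wap. M u = r *\<^sub>R u}" "closed {u \<in> wap. M u = r *\<^sub>R u}" for r
  proof -
    have "r *\<^sub>R (a *\<^sub>C u) = a *\<^sub>C (r *\<^sub>R u)" for a and u :: "'g discrete \<Rightarrow>\<^sub>C complex"
      by (simp add: linear_scale[OF bounded_linear.linear[OF bounded_linear_scaleC]])
    then show "csubspace {u \<in> wap. M u = r *\<^sub>R u}"
      unfolding csubspace_def using M(2,3) M0 z by (auto simp: wap_add wap_scaleC scaleR_add_right)
    show "closed {u \<in> wap. M u = r *\<^sub>R u}"
      unfolding closed_sequential_limits
    proof (intro allI impI, elim conjE)
      fix U u assume U: "\<forall>n::nat. U n \<in> {u \<in> wap. M u = r *\<^sub>R u}" and lim: "U \<longlonglongrightarrow> u"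
      have u: "u \<in> wap" using closed_sequentially[OF closed_wap _ lim] U by blast
      have "(\<lambda>n. M (U n)) \<longlonglongrightarrow> M u" by (rule M_lim[OF _ u lim]) (use U in blast)
      then have "(\<lambda>n. r *\<^sub>R U n) \<longlonglongrightarrow> M u" using U by simp
      moreover have "(\<lambda>n. r *\<^sub>R U n) \<longlonglongrightarrow> r *\<^sub>R u" by (intro tendsto_intros lim)
      ultimately show "u \<in> {u \<in> wap. M u = r *\<^sub>R u}" using u LIMSEQ_unique by blast
    qed
  qed
  have "csubspace ?W" "closed ?W" using eigen[of 1] by (simp_all add: W_M)
  moreover have "csubspace N" "closed N" using eigen[of 0] by (simp_all add: N_def)
  moreover have "?W \<inter> N = {0}" unfolding W_M N_def using M0 z by auto
  moreover have "wap = {w + n |w n. w \<in> ?W \<and> n \<in> N}"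
  proof (intro equalityI subsetI)
    fix u assume u: "u \<in> wap"
    have "M u \<in> ?W" "u - M u \<in> N"
      using u M(1,5) sub M_diff by (simp_all add: W_M N_def)
    moreover have "u = M u + (u - M u)" by simp
    ultimately show "u \<in> {w + n |w n. w \<in> ?W \<and> n \<in> N}" by blast
  next
    fix u assume "u \<in> {w + n |w n. w \<in> ?W \<and> n \<in> N}"
    then show "u \<in> wap" unfolding W_M N_def by (auto intro: wap_add)
  qed
  moreover have "?W \<subseteq> wap" "N \<subseteq> wap" unfolding W_M N_def by auto
  ultimately show ?thesis unfolding complemented_in_def wap_eq by blast
qed

theorem corollary3p6:
  assumes "wap_group TYPE('g::topological_group_add)"
  shows "(\<forall>\<pi> :: 'g discrete \<Rightarrow> ('x::complex_banach \<Rightarrow>\<^sub>L 'x).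
            wap_representation \<pi> \<longrightarrow> reducing_subspace \<pi> (continuous_vectors \<pi>)) \<and>
         complemented_in (on_discrete ` (wap_functions :: ('g \<Rightarrow>\<^sub>C complex) set))
           (wap_functions :: ('g discrete \<Rightarrow>\<^sub>C complex) set) \<and>
         translation_invariant (on_discrete ` (wap_functions :: ('g \<Rightarrow>\<^sub>C complex) set))"
  by (intro conjI allI impI wap_representation_reducing complemented_wap_functions
      translation_invariant_on_discrete)

end
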